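(* Let $X$ and $Y$ be metric spaces with bounded geometry such that $Y$ coarsely embeds into some $L^p$-space for some $p\in[1,\infty)$. Then the following are equivalent: (1) $X$ is coarsely equivalent to $Y$; (2) $C^*_u(X)$ is stably $*$-isomorphic to $C^*_u(Y)$; (3) $C^*(X)$ is $*$-isomorphic to $C^*(Y)$.
   Context: All metric spaces whose Roe algebras are considered are non-empty and discrete. $(X,d)$ has bounded geometry if $\sup_{x\in X}|B(x,R)|<\infty$ for each $R>0$ (closed balls). An $L^p$-space is $L^p(Z,\nu)$ for some measure space $(Z,\nu)$. A map $f:X\to Y$ between metric spaces is a coarse embedding if there are non-decreasing unbounded $\rho_\pm:[0,\infty)\to[0,\infty)$ with $\rho_-(d_X(x,y))\le d_Y(f(x),f(y))\le\rho_+(d_X(x,y))$ for all $x,y\in X$; $X$ and $Y$ are coarsely equivalent if there is a coarse embedding $f:X\to Y$ and $C>0$ such that every point of $Y$ is within distance $C$ of $f(X)$. For a Hilbert space $H_0$, write $T\in\mathfrak B(\ell^2(X;H_0))$ as a matrix $(T_{x,y})_{x,y\in X}$ with entries in $\mathfrak B(H_0)$. $T$ has finite propagation if $\sup\{d(x,y):T_{x,y}\ne0\}<\infty$, and is locally compact if all $T_{x,y}$ are compact. $C^*_u(X)$ is the norm closure of the finite propagation operators in $\mathfrak B(\ell^2(X))$; $C^*(X)$ is the norm closure of the finite propagation locally compact operators in $\mathfrak B(\ell^2(X;H_0))$ with $H_0$ a fixed infinite-dimensional separable Hilbert space. $C^*$-algebras $A,B$ are stably $*$-isomorphic if $A\otimes\mathfrak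 K\cong B\otimes\mathfrak K$, with $\mathfrak K$ the compact operators on a separable infinite-dimensional Hilbert space. *)

theory Defs
  imports "HOL-Analysis.Analysis"
begin

section \<open>Complex Hilbert spaces\<close>

class scaleC =
  fixes scaleC :: "complex \<Rightarrow> 'a \<Rightarrow> 'a"  (infixr \<open>*\<^sub>C\<close> 75)

class complex_vector = scaleC + real_vector +
  assumes scaleC_add_right: "a *\<^sub>C (x + y) = a *\<^sub>C x + a *\<^sub>C y"
    and scaleC_add_left: "(a + b) *\<^sub>C x = a *\<^sub>C x + b *\<^sub>C x"
    and scaleC_scaleC: "a *\<^sub>C (b *\<^sub>C x) = (a * b) *\<^sub>C x"
    and scaleR_scaleC: "r *\<^sub>R x = complex_of_real r *\<^sub>C x"

global_interpretation cvec: vector_space "scaleC :: complex \<Rightarrow> 'a \<Rightarrow> 'a::complex_vector"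
proof
  show "1 *\<^sub>C x = x" for x :: 'a
    using scaleR_scaleC[of 1 x] by simp
qed (simp_all add: scaleC_add_right scaleC_add_left scaleC_scaleC)

text \<open>The inner product is linear in the first argument. Since a norm is nonnegative and
  definite, so is \<open>cinner\<close>, by the last axiom.\<close>

class chilbert_space = complex_vector + banach +
  fixes cinner :: "'a \<Rightarrow> 'a \<Rightarrow> complex"
  assumes cinner_commute: "cinner x y = cnj (cinner y x)"
    and cinner_add_left: "cinner (x + y) z = cinner x z + cinner y z"
    and cinner_scaleC_left: "cinner (a *\<^sub>C x) y = a * cinner x y"
    and norm_eq_sqrt_cinner: "norm x = sqrt (Re (cinner x x))"

lemma cinner_add_right: "cinner x (y + z) = cinner x y + cinner x z"
  for x :: "'a::chilbert_space"
  by (metis cinner_add_left cinner_commute complex_cnj_add)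

lemma cinner_scaleC_right: "cinner x (a *\<^sub>C y) = cnj a * cinner x y"
  for x :: "'a::chilbert_space"
  by (metis cinner_commute cinner_scaleC_left complex_cnj_mult)

lemma cinner_scaleR_left: "cinner (r *\<^sub>R x) y = of_real r * cinner x y"
  for x :: "'a::chilbert_space"
  by (simp add: scaleR_scaleC cinner_scaleC_left)

lemma cinner_scaleR_right: "cinner x (r *\<^sub>R y) = of_real r * cinner x y"
  for x :: "'a::chilbert_space"
  by (simp add: scaleR_scaleC cinner_scaleC_right)

lemma cinner_minus_left: "cinner (- x) y = - cinner x y" for x :: "'a::chilbert_space"
  using cinner_scaleR_left[of "-1" x y] by simp

lemma cinner_minus_right: "cinner x (- y) = - cinner x y" for x :: "'a::chilbert_space"
  using cinner_scaleR_right[of x "-1" y] by simp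

lemma cinner_diff_left: "cinner (x - y) z = cinner x z - cinner y z" for x :: "'a::chilbert_space"
  using cinner_add_left[of x "- y" z] by (simp add: cinner_minus_left)

lemma cinner_diff_right: "cinner x (y - z) = cinner x y - cinner x z" for x :: "'a::chilbert_space"
  using cinner_add_right[of x y "- z"] by (simp add: cinner_minus_right)

lemma Re_cinner_self: "Re (cinner x x) = (norm x)\<^sup>2" for x :: "'a::chilbert_space"
proof -
  have "Re (cinner x x) \<ge> 0"
    using norm_eq_sqrt_cinner[of x] norm_ge_zero[of x] real_sqrt_ge_0_iff by metis
  thus ?thesis by (simp add: norm_eq_sqrt_cinner)
qed

lemma cinner_self: "cinner x x = complex_of_real ((norm x)\<^sup>2)" for x :: "'a::chilbert_space"
proof -
  have "Im (cinner x x) = 0"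
    using cinner_commute[of x x] by (simp add: complex_eq_iff)
  thus ?thesis using Re_cinner_self[of x] by (simp add: complex_eq_iff)
qed

lemma norm_scaleC: "norm (a *\<^sub>C x) = cmod a * norm x" for x :: "'a::chilbert_space"
proof -
  have "complex_of_real ((norm (a *\<^sub>C x))\<^sup>2) = (a * cnj a) * complex_of_real ((norm x)\<^sup>2)"
    unfolding cinner_self[symmetric] by (simp add: cinner_scaleC_left cinner_scaleC_right)
  also have "\<dots> = complex_of_real ((cmod a * norm x)\<^sup>2)"
    by (simp add: complex_norm_square[symmetric] power_mult_distrib)
  finally have "(norm (a *\<^sub>C x))\<^sup>2 = (cmod a * norm x)\<^sup>2" by (simp only: of_real_eq_iff)
  thus ?thesis by (simp add: power2_eq_iff_nonneg)
qed

lemma norm_add_square: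
  "(norm (x + y))\<^sup>2 = (norm x)\<^sup>2 + 2 * Re (cinner x y) + (norm y)\<^sup>2" for x :: "'a::chilbert_space"
proof -
  have "Re (cinner y x) = Re (cinner x y)" by (subst cinner_commute) simp
  thus ?thesis
    by (simp add: Re_cinner_self[symmetric] cinner_add_left cinner_add_right)
qed

lemma Re_cinner_le: "Re (cinner x y) \<le> norm x * norm y" for x :: "'a::chilbert_space"
proof -
  have "(norm (x + y))\<^sup>2 \<le> (norm x + norm y)\<^sup>2"
    by (simp add: norm_triangle_ineq power_mono)
  thus ?thesis by (simp add: norm_add_square power2_sum)
qed

lemma norm_cinner_le: "cmod (cinner x y) \<le> norm x * norm y" for x :: "'a::chilbert_space"
proof (cases "cinner x y = 0")
  case False
  define a where "a = cnj (cinner x y) / of_real (cmod (cinner x y))"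
  have "cmod a = 1" using False by (simp add: a_def norm_divide)
  have "a * cinner x y = of_real (cmod (cinner x y))"
    using False by (simp add: a_def field_simps complex_norm_square[symmetric] power2_eq_square)
  hence "cmod (cinner x y) = Re (cinner (a *\<^sub>C x) y)" by (simp add: cinner_scaleC_left)
  also have "\<dots> \<le> norm (a *\<^sub>C x) * norm y" by (rule Re_cinner_le)
  finally show ?thesis by (simp add: norm_scaleC \<open>cmod a = 1\<close>)
qed simp

lemma cinner_eqI: "(\<And>x. cinner x y = cinner x z) \<Longrightarrow> y = z" for y :: "'a::chilbert_space"
proof -
  assume "\<And>x. cinner x y = cinner x z"
  hence "cinner (y - z) (y - z) = 0" by (simp add: cinner_diff_right)
  thus "y = z" by (simp add: cinner_self)
qed

instantiation complex :: chilbert_space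
begin

definition scaleC_complex :: "complex \<Rightarrow> complex \<Rightarrow> complex"
  where "scaleC_complex a x = a * x"

definition cinner_complex :: "complex \<Rightarrow> complex \<Rightarrow> complex"
  where "cinner_complex x y = x * cnj y"

instance
  by standard
    (simp_all add: scaleC_complex_def cinner_complex_def algebra_simps scaleR_conv_of_real
      cmod_def power2_eq_square)

end

section \<open>The space of square-summable functions \<open>\<ell>\<^sup>2(X; H)\<close>\<close>

typedef (overloaded) ('x, 'h) ell2 =
    "{f :: 'x \<Rightarrow> 'h::real_normed_vector. (\<lambda>x. (norm (f x))\<^sup>2) summable_on UNIV}"
  morphisms ell2_apply Abs_ell2
  by (rule exI[of _ "\<lambda>_. 0"]) simp

setup_lifting type_definition_ell2

lemma L2_set_norm_le_iff:
  "L2_set (\<lambda>x. norm (f x)) F \<le> C \<longleftrightarrow> (\<Sum>x\<in>F. (norm (f x))\<^sup>2) \<le> C\<^sup>2" if "C \<ge> 0"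
  using that by (simp add: L2_set_def real_sqrt_le_iff' sum_nonneg)

lemma square_summable_bound:
  fixes f :: "'x \<Rightarrow> 'h::real_normed_vector"
  assumes "C \<ge> 0" and "\<And>F. finite F \<Longrightarrow> L2_set (\<lambda>x. norm (f x)) F \<le> C"
  shows "(\<lambda>x. (norm (f x))\<^sup>2) summable_on UNIV"
    and "sqrt (\<Sum>\<^sub>\<infinity>x. (norm (f x))\<^sup>2) \<le> C"
proof -
  have *: "(\<Sum>x\<in>F. (norm (f x))\<^sup>2) \<le> C\<^sup>2" if "finite F" for F
    using assms that L2_set_norm_le_iff by blast
  show s: "(\<lambda>x. (norm (f x))\<^sup>2) summable_on UNIV"
    by (rule nonneg_bdd_above_summable_on) (auto intro!: bdd_aboveI2[where M = "C\<^sup>2"] *)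
  have "(\<Sum>\<^sub>\<infinity>x. (norm (f x))\<^sup>2) \<le> C\<^sup>2"
    by (rule infsum_le_finite_sums[OF s]) (use * in auto)
  thus "sqrt (\<Sum>\<^sub>\<infinity>x. (norm (f x))\<^sup>2) \<le> C"
    using assms(1) real_le_lsqrt infsum_nonneg by (simp add: real_sqrt_le_iff')
qed

lemma L2_set_le_ell2:
  fixes f :: "'x \<Rightarrow> 'h::real_normed_vector"
  assumes "(\<lambda>x. (norm (f x))\<^sup>2) summable_on UNIV" and "finite F"
  shows "L2_set (\<lambda>x. norm (f x)) F \<le> sqrt (\<Sum>\<^sub>\<infinity>x. (norm (f x))\<^sup>2)"
  unfolding L2_set_def
  by (intro real_sqrt_le_mono finite_sum_le_infsum) (use assms in auto)

lemma L2_set_norm_triangle: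
  "L2_set (\<lambda>x. norm (f x + g x)) F \<le> L2_set (\<lambda>x. norm (f x)) F + L2_set (\<lambda>x. norm (g x)) F"
  by (rule order_trans[OF L2_set_mono L2_set_triangle_ineq]) (auto intro: norm_triangle_ineq)

lemma square_summable_add:
  fixes f g :: "'x \<Rightarrow> 'h::real_normed_vector"
  assumes f: "(\<lambda>x. (norm (f x))\<^sup>2) summable_on UNIV"
    and g: "(\<lambda>x. (norm (g x))\<^sup>2) summable_on UNIV"
  shows "(\<lambda>x. (norm (f x + g x))\<^sup>2) summable_on UNIV"
    and "sqrt (\<Sum>\<^sub>\<infinity>x. (norm (f x + g x))\<^sup>2)
      \<le> sqrt (\<Sum>\<^sub>\<infinity>x. (norm (f x))\<^sup>2) + sqrt (\<Sum>\<^sub>\<infinity>x. (norm (g x))\<^sup>2)"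
proof -
  have *: "L2_set (\<lambda>x. norm (f x + g x)) F
      \<le> sqrt (\<Sum>\<^sub>\<infinity>x. (norm (f x))\<^sup>2) + sqrt (\<Sum>\<^sub>\<infinity>x. (norm (g x))\<^sup>2)" if "finite F" for F
    using L2_set_norm_triangle[of f g F] L2_set_le_ell2[OF f that] L2_set_le_ell2[OF g that]
    by linarith
  have nn: "0 \<le> sqrt (\<Sum>\<^sub>\<infinity>x. (norm (f x))\<^sup>2) + sqrt (\<Sum>\<^sub>\<infinity>x. (norm (g x))\<^sup>2)"
    by (simp add: infsum_nonneg)
  show "(\<lambda>x. (norm (f x + g x))\<^sup>2) summable_on UNIV"
    by (rule square_summable_bound(1)[OF nn *])
  show "sqrt (\<Sum>\<^sub>\<infinity>x. (norm (f x + g x))\<^sup>2)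
      \<le> sqrt (\<Sum>\<^sub>\<infinity>x. (norm (f x))\<^sup>2) + sqrt (\<Sum>\<^sub>\<infinity>x. (norm (g x))\<^sup>2)"
    by (rule square_summable_bound(2)[OF nn *])
qed

lemma cinner_summable:
  fixes f g :: "'x \<Rightarrow> 'h::chilbert_space"
  assumes f: "(\<lambda>x. (norm (f x))\<^sup>2) summable_on UNIV"
    and g: "(\<lambda>x. (norm (g x))\<^sup>2) summable_on UNIV"
  shows "(\<lambda>x. cinner (f x) (g x)) summable_on UNIV"
proof (rule abs_summable_summable, rule summable_on_comparison_test)
  show "(\<lambda>x. (norm (f x))\<^sup>2 + (norm (g x))\<^sup>2) summable_on UNIV"
    by (rule summable_on_add[OF f g])
  fix x
  have "0 \<le> (norm (f x) - norm (g x))\<^sup>2" by simp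
  hence "2 * (norm (f x) * norm (g x)) \<le> (norm (f x))\<^sup>2 + (norm (g x))\<^sup>2"
    by (simp add: power2_diff)
  moreover have "0 \<le> norm (f x) * norm (g x)" by simp
  moreover note norm_cinner_le[of "f x" "g x"]
  ultimately show "norm (cinner (f x) (g x)) \<le> (norm (f x))\<^sup>2 + (norm (g x))\<^sup>2"
    by linarith
qed simp

instantiation ell2 :: (type, real_normed_vector) real_normed_vector
begin

lift_definition zero_ell2 :: "('a, 'b) ell2" is "\<lambda>_. 0" by simp

lift_definition plus_ell2 :: "('a, 'b) ell2 \<Rightarrow> ('a, 'b) ell2 \<Rightarrow> ('a, 'b) ell2"
  is "\<lambda>f g x. f x + g x" by (rule square_summable_add(1))

lift_definition uminus_ell2 :: "('a, 'b) ell2 \<Rightarrow> ('a, 'b) ell2"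
  is "\<lambda>f x. - f x" by simp

lift_definition minus_ell2 :: "('a, 'b) ell2 \<Rightarrow> ('a, 'b) ell2 \<Rightarrow> ('a, 'b) ell2"
  is "\<lambda>f g x. f x - g x"
  subgoal for f g using square_summable_add(1)[of f "\<lambda>x. - g x"] by simp
  done

lift_definition scaleR_ell2 :: "real \<Rightarrow> ('a, 'b) ell2 \<Rightarrow> ('a, 'b) ell2"
  is "\<lambda>a f x. a *\<^sub>R f x"
  by (simp add: power_mult_distrib summable_on_cmult_right)

lift_definition norm_ell2 :: "('a, 'b) ell2 \<Rightarrow> real"
  is "\<lambda>f. sqrt (\<Sum>\<^sub>\<infinity>x. (norm (f x))\<^sup>2)" .

definition sgn_ell2 :: "('a, 'b) ell2 \<Rightarrow> ('a, 'b) ell2"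
  where "sgn_ell2 f = inverse (norm f) *\<^sub>R f"

definition dist_ell2 :: "('a, 'b) ell2 \<Rightarrow> ('a, 'b) ell2 \<Rightarrow> real"
  where "dist_ell2 f g = norm (f - g)"

definition uniformity_ell2 :: "(('a, 'b) ell2 \<times> ('a, 'b) ell2) filter"
  where "uniformity_ell2 = (INF e\<in>{0 <..}. principal {(x, y). dist x y < e})"

definition open_ell2 :: "('a, 'b) ell2 set \<Rightarrow> bool"
  where "open_ell2 S = (\<forall>x\<in>S. \<forall>\<^sub>F (x', y) in uniformity. x' = x \<longrightarrow> y \<in> S)"

instance proof intro_classes
  fix f g h :: "('a, 'b) ell2" and r s :: real
  show "f + g + h = f + (g + h)" by transfer (simp add: add.assoc)
  show "f + g = g + f" by transfer (simp add: add.commute)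
  show "0 + f = f" by transfer simp
  show "- f + f = 0" by transfer simp
  show "f - g = f + - g" by transfer simp
  show "r *\<^sub>R (f + g) = r *\<^sub>R f + r *\<^sub>R g" by transfer (simp add: scaleR_add_right)
  show "(r + s) *\<^sub>R f = r *\<^sub>R f + s *\<^sub>R f" by transfer (simp add: scaleR_add_left)
  show "r *\<^sub>R s *\<^sub>R f = (r * s) *\<^sub>R f" by transfer simp
  show "1 *\<^sub>R f = f" by transfer simp
  show "sgn f = inverse (norm f) *\<^sub>R f" by (rule sgn_ell2_def)
  show "dist f g = norm (f - g)" by (rule dist_ell2_def)
  show "uniformity = (INF e\<in>{0 <..}. principal {(x, y::('a, 'b) ell2). dist x y < e})"
    by (rule uniformity_ell2_def)
  show "open S = (\<forall>x\<in>S. \<forall>\<^sub>F (x', y) in uniformity. x' = x \<longrightarrow> y \<in> S)"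
    for S :: "('a, 'b) ell2 set" by (rule open_ell2_def)
  show "norm f = 0 \<longleftrightarrow> f = 0"
  proof
    show "norm f = 0 \<Longrightarrow> f = 0"
    proof transfer
      fix f :: "'a \<Rightarrow> 'b"
      assume f: "(\<lambda>x. (norm (f x))\<^sup>2) summable_on UNIV"
        and 0: "sqrt (\<Sum>\<^sub>\<infinity>x. (norm (f x))\<^sup>2) = 0"
      have "norm (f x) \<le> 0" for x
        using L2_set_le_ell2[OF f, of "{x}"] 0 by simp
      thus "f = (\<lambda>_. 0)" by auto
    qed
    show "f = 0 \<Longrightarrow> norm f = 0" by transfer simp
  qed
  show "norm (f + g) \<le> norm f + norm g" by transfer (rule square_summable_add(2))
  show "norm (r *\<^sub>R f) = \<bar>r\<bar> * norm f"
    by transfer (simp add: power_mult_distrib infsum_cmult_right' real_sqrt_mult)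
qed

end

instantiation ell2 :: (type, chilbert_space) chilbert_space
begin

lift_definition scaleC_ell2 :: "complex \<Rightarrow> ('a, 'b) ell2 \<Rightarrow> ('a, 'b) ell2"
  is "\<lambda>a f x. a *\<^sub>C f x"
  by (simp add: norm_scaleC power_mult_distrib summable_on_cmult_right)

lift_definition cinner_ell2 :: "('a, 'b) ell2 \<Rightarrow> ('a, 'b) ell2 \<Rightarrow> complex"
  is "\<lambda>f g. \<Sum>\<^sub>\<infinity>x. cinner (f x) (g x)" .

instance proof intro_classes
  fix f g h :: "('a, 'b) ell2" and a b :: complex and r :: real
  show "a *\<^sub>C (f + g) = a *\<^sub>C f + a *\<^sub>C g" by transfer (simp add: scaleC_add_right)
  show "(a + b) *\<^sub>C f = a *\<^sub>C f + b *\<^sub>C f" by transfer (simp add: scaleC_add_left)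
  show "a *\<^sub>C b *\<^sub>C f = (a * b) *\<^sub>C f" by transfer (simp add: scaleC_scaleC)
  show "r *\<^sub>R f = complex_of_real r *\<^sub>C f" by transfer (simp add: scaleR_scaleC)
  show "cinner f g = cnj (cinner g f)"
    by transfer (metis (no_types, lifting) cinner_commute infsum_cnj infsum_cong)
  show "cinner (f + g) h = cinner f h + cinner g h"
    by transfer (simp add: cinner_add_left infsum_add cinner_summable)
  show "cinner (a *\<^sub>C f) g = a * cinner f g"
    by transfer (simp add: cinner_scaleC_left infsum_cmult_right')
  show "norm f = sqrt (Re (cinner f f))"
    by transfer (simp add: infsum_Re[symmetric] cinner_summable Re_cinner_self)
  show "convergent F" if F: "Cauchy F" for F :: "nat \<Rightarrow> ('a, 'b) ell2"
  proof -
    have nm: "L2_set (\<lambda>x. norm (ell2_apply u x)) A \<le> norm u" if "finite A"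
      for u :: "('a, 'b) ell2" and A
      using that by transfer (rule L2_set_le_ell2)
    have d: "norm (ell2_apply (F m) x - ell2_apply (F n) x) \<le> norm (F m - F n)" for m n x
      using nm[of "{x}" "F m - F n"] by (simp add: minus_ell2.rep_eq)
    have "Cauchy (\<lambda>n. ell2_apply (F n) x)" for x
    proof (rule metric_CauchyI)
      fix e :: real assume "e > 0"
      then obtain M where "\<forall>m\<ge>M. \<forall>n\<ge>M. dist (F m) (F n) < e"
        using metric_CauchyD[OF F] by blast
      thus "\<exists>M. \<forall>m\<ge>M. \<forall>n\<ge>M. dist (ell2_apply (F m) x) (ell2_apply (F n) x) < e"
        using d[of _ x] unfolding dist_norm dist_ell2_def by (meson le_less_trans)
    qed
    hence "\<exists>l. \<forall>x. (\<lambda>n. ell2_apply (F n) x) \<longlonglongrightarrow> l x"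
      by (intro choice allI) (simp add: Cauchy_convergent_iff convergent_def)
    then obtain l where l: "\<And>x. (\<lambda>n. ell2_apply (F n) x) \<longlonglongrightarrow> l x" by blast
    have tail: "L2_set (\<lambda>x. norm (ell2_apply (F n) x - l x)) A \<le> e"
      if M: "\<forall>m\<ge>M. \<forall>n\<ge>M. dist (F m) (F n) < e" and n: "n \<ge> M" and A: "finite A" for n M e A
    proof (rule LIMSEQ_le_const2)
      show "(\<lambda>m. L2_set (\<lambda>x. norm (ell2_apply (F n) x - ell2_apply (F m) x)) A)
          \<longlonglongrightarrow> L2_set (\<lambda>x. norm (ell2_apply (F n) x - l x)) A"
        unfolding L2_set_def by (intro tendsto_intros l)
      have "L2_set (\<lambda>x. norm (ell2_apply (F n) x - ell2_apply (F m) x)) A \<le> e" if "m \<ge> M" for m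
        using nm[OF A, of "F n - F m"] M n that
        by (simp add: minus_ell2.rep_eq dist_ell2_def) (meson less_le_not_le order_trans)
      thus "\<exists>N. \<forall>m\<ge>N. L2_set (\<lambda>x. norm (ell2_apply (F n) x - ell2_apply (F m) x)) A \<le> e"
        by blast
    qed
    obtain M1 where M1: "\<forall>m\<ge>M1. \<forall>n\<ge>M1. dist (F m) (F n) < 1"
      using metric_CauchyD[OF F, of 1] by auto
    have "L2_set (\<lambda>x. norm (l x)) A \<le> norm (F M1) + 1" if A: "finite A" for A
    proof -
      have "L2_set (\<lambda>x. norm (ell2_apply (F M1) x + (- (ell2_apply (F M1) x - l x)))) A
          \<le> L2_set (\<lambda>x. norm (ell2_apply (F M1) x)) A
            + L2_set (\<lambda>x. norm (- (ell2_apply (F M1) x - l x))) A"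
        by (rule L2_set_norm_triangle)
      also have "\<dots> \<le> norm (F M1) + 1"
        using nm[OF A, of "F M1"] tail[OF M1 order_refl A] unfolding norm_minus_cancel by linarith
      finally show ?thesis by simp
    qed
    hence lsum: "(\<lambda>x. (norm (l x))\<^sup>2) summable_on UNIV"
      using square_summable_bound(1)[of "norm (F M1) + 1" l] by (simp add: add_nonneg_nonneg)
    define L where "L = Abs_ell2 l"
    have L: "ell2_apply L = l" using lsum by (simp add: L_def Abs_ell2_inverse)
    have "F \<longlonglongrightarrow> L"
    proof (rule metric_LIMSEQ_I)
      fix e :: real assume "e > 0"
      then obtain M where M: "\<forall>m\<ge>M. \<forall>n\<ge>M. dist (F m) (F n) < e / 2"
        using metric_CauchyD[OF F, of "e / 2"] by auto
      have "dist (F n) L \<le> e / 2" if "n \<ge> M" for n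
        unfolding dist_ell2_def norm_ell2.rep_eq minus_ell2.rep_eq L
        using tail[OF M that] \<open>e > 0\<close> by (intro square_summable_bound(2)) auto
      thus "\<exists>no. \<forall>n\<ge>no. dist (F n) L < e"
        using \<open>e > 0\<close> by (intro exI[of _ M]) fastforce
    qed
    thus ?thesis by (auto simp: convergent_def)
  qed
qed

end

lemma norm_ell2_apply_le: "norm (ell2_apply f x) \<le> norm f"
  using L2_set_le_ell2[of "ell2_apply f" "{x}"] ell2_apply[of f] by (simp add: norm_ell2.rep_eq)

definition ell2_coord :: "'x \<Rightarrow> ('x, 'h::real_normed_vector) ell2 \<Rightarrow>\<^sub>L 'h"
  where "ell2_coord x = Blinfun (\<lambda>f. ell2_apply f x)"

lemma ell2_coord_apply [simp]: "ell2_coord x f = ell2_apply f x"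
  for f :: "('a, 'b::real_normed_vector) ell2"
proof -
  have "bounded_linear (\<lambda>f :: ('a, 'b) ell2. ell2_apply f x)"
    by (rule bounded_linear_intro[where K = 1])
      (simp_all add: plus_ell2.rep_eq scaleR_ell2.rep_eq norm_ell2_apply_le)
  thus ?thesis by (simp add: ell2_coord_def bounded_linear_Blinfun_apply)
qed

definition ell2_single :: "'x \<Rightarrow> 'h \<Rightarrow>\<^sub>L ('x, 'h::real_normed_vector) ell2"
  where "ell2_single x = Blinfun (\<lambda>h. Abs_ell2 (\<lambda>y. if y = x then h else 0))"

lemma single_square_sum:
  "((\<lambda>y. (norm (if y = x then h else 0))\<^sup>2) has_sum (norm h)\<^sup>2) UNIV"
  for h :: "'h::real_normed_vector"
  by (rule has_sum_finite_neutralI[of "{x}"]) auto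

lemma ell2_apply_single [simp]: "ell2_apply (ell2_single x h) y = (if y = x then h else 0)"
proof -
  have *: "ell2_apply (Abs_ell2 (\<lambda>y. if y = x then h else 0)) = (\<lambda>y. if y = x then h else 0)"
    for h :: 'a
    using single_square_sum[of x h] by (intro Abs_ell2_inverse) (auto simp: summable_on_def)
  have "bounded_linear (\<lambda>h::'a. Abs_ell2 (\<lambda>y. if y = x then h else 0))"
  proof (rule bounded_linear_intro[where K = 1])
    show "norm (Abs_ell2 (\<lambda>y. if y = x then h else 0)) \<le> norm h * 1" for h :: 'a
      using infsumI[OF single_square_sum[of x h]] by (simp add: norm_ell2.rep_eq *)
  qed (auto simp: ell2_apply_inject[symmetric] plus_ell2.rep_eq scaleR_ell2.rep_eq *)
  thus ?thesis by (simp add: ell2_single_def bounded_linear_Blinfun_apply *)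
qed

section \<open>Operators\<close>

instantiation blinfun :: (real_normed_vector, chilbert_space) complex_vector
begin

lift_definition scaleC_blinfun :: "complex \<Rightarrow> ('a \<Rightarrow>\<^sub>L 'b) \<Rightarrow> ('a \<Rightarrow>\<^sub>L 'b)"
  is "\<lambda>a T x. a *\<^sub>C T x"
proof -
  fix a :: complex and T :: "'a \<Rightarrow> 'b"
  assume "bounded_linear T"
  then interpret T: bounded_linear T .
  obtain K where K: "\<And>x. norm (T x) \<le> norm x * K" using T.bounded by blast
  show "bounded_linear (\<lambda>x. a *\<^sub>C T x)"
  proof (rule bounded_linear_intro[where K = "cmod a * K"])
    show "norm (a *\<^sub>C T x) \<le> norm x * (cmod a * K)" for x
      using mult_left_mono[OF K[of x], of "cmod a"] by (simp add: norm_scaleC mult.left_commute)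
  qed (simp_all add: T.add T.scaleR scaleC_add_right scaleR_scaleC scaleC_scaleC mult.commute)
qed

instance
  by standard
    (transfer, simp add: scaleC_add_right scaleC_add_left scaleC_scaleC scaleR_scaleC)+

end

text \<open>Elements of \<open>'a \<Rightarrow>\<^sub>L 'b\<close> are only real-linear; the bounded operators between complex
  Hilbert spaces are those satisfying the following predicate.\<close>

definition clinear_op :: "('a::chilbert_space \<Rightarrow>\<^sub>L 'b::chilbert_space) \<Rightarrow> bool"
  where "clinear_op T \<longleftrightarrow> (\<forall>a x. T (a *\<^sub>C x) = a *\<^sub>C T x)"

definition compact_op :: "('a::chilbert_space \<Rightarrow>\<^sub>L 'b::chilbert_space) \<Rightarrow> bool"
  where "compact_op T \<longleftrightarrow> compact (closure (T ` cball 0 1))"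

definition adj :: "('a::chilbert_space \<Rightarrow>\<^sub>L 'b::chilbert_space) \<Rightarrow> ('b \<Rightarrow>\<^sub>L 'a)"
  where "adj T = (THE S. \<forall>x y. cinner (T x) y = cinner x (blinfun_apply S y))"

lemma riesz:
  fixes f :: "'a::chilbert_space \<Rightarrow> complex"
  assumes add: "\<And>x y. f (x + y) = f x + f y" and scale: "\<And>a x. f (a *\<^sub>C x) = a * f x"
    and K: "\<And>x. cmod (f x) \<le> K * norm x"
  obtains z where "\<And>x. f x = cinner x z"
proof -
  define J where "J x = (norm x)\<^sup>2 - 2 * Re (f x)" for x
  define m where "m = Inf (range J)"
  have scaleR: "f (r *\<^sub>R x) = of_real r * f x" for r x by (simp add: scaleR_scaleC scale)
  have lb: "- (K\<^sup>2) \<le> J x" for x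
  proof -
    have "Re (f x) \<le> K * norm x" using K[of x] complex_Re_le_cmod[of "f x"] by linarith
    moreover have "0 \<le> (norm x - K)\<^sup>2" by simp
    ultimately show ?thesis by (simp add: J_def power2_diff mult.commute)
  qed
  hence bdd: "bdd_below (range J)" by (intro bdd_belowI2)
  have m_le: "m \<le> J x" for x unfolding m_def by (rule cInf_lower) (use bdd in auto)
  have "\<exists>x. J x < m + e" if "e > 0" for e
    using cInf_lessD[of "range J" "m + e"] that by (auto simp: m_def)
  hence "\<forall>n. \<exists>x. J x < m + inverse (real (Suc n))" by simp
  then obtain u where u: "\<And>n. J (u n) < m + inverse (real (Suc n))" by metis
  have para: "(norm (x - y))\<^sup>2 = 2 * J x + 2 * J y - 4 * J ((1/2) *\<^sub>R (x + y))" for x y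
  proof -
    have "(norm ((1/2) *\<^sub>R (x + y)))\<^sup>2 = (norm (x + y))\<^sup>2 / 4"
      unfolding norm_scaleR by (simp add: power2_eq_square)
    moreover have "Re (f ((1/2) *\<^sub>R (x + y))) = (Re (f x) + Re (f y)) / 2"
      unfolding scaleR add by simp
    ultimately show ?thesis
      using norm_add_square[of x y] norm_add_square[of x "- y"]
      by (simp add: J_def cinner_minus_right)
  qed
  have "Cauchy u"
  proof (rule metric_CauchyI)
    fix e :: real assume e: "e > 0"
    then obtain N where N: "inverse (real (Suc N)) < e\<^sup>2 / 4"
      using reals_Archimedean[of "e\<^sup>2 / 4"] by auto
    have "dist (u i) (u j) < e" if ij: "i \<ge> N" "j \<ge> N" for i j
    proof -
      have "inverse (real (Suc i)) \<le> inverse (real (Suc N))"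
        "inverse (real (Suc j)) \<le> inverse (real (Suc N))"
        using ij by (auto intro!: le_imp_inverse_le)
      hence "(norm (u i - u j))\<^sup>2 < e\<^sup>2"
        using para[of "u i" "u j"] u[of i] u[of j] m_le[of "(1/2) *\<^sub>R (u i + u j)"] N by linarith
      thus ?thesis using e by (simp add: dist_norm power2_less_imp_less)
    qed
    thus "\<exists>M. \<forall>m\<ge>M. \<forall>n\<ge>M. dist (u m) (u n) < e" by blast
  qed
  then obtain z where z: "u \<longlonglongrightarrow> z" using Cauchy_convergent_iff convergent_def by blast
  interpret f: bounded_linear f
    by (rule bounded_linear_intro[where K = K])
      (use K in \<open>simp_all add: add scaleR scaleR_conv_of_real mult.commute\<close>)
  have "(\<lambda>n. J (u n)) \<longlonglongrightarrow> J z" unfolding J_def by (intro tendsto_intros f.tendsto z)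
  moreover have "(\<lambda>n. m + inverse (real (Suc n))) \<longlonglongrightarrow> m"
    using tendsto_add[OF tendsto_const LIMSEQ_inverse_real_of_nat, of m] by simp
  ultimately have "J z \<le> m" using u by (meson LIMSEQ_le less_imp_le)
  hence min: "J z \<le> J x" for x using m_le[of x] by linarith
  have re: "Re (f x) = Re (cinner x z)" for x
  proof -
    define c where "c = Re (cinner z x) - Re (f x)"
    have q: "0 \<le> 2 * t * c + t\<^sup>2 * (norm x)\<^sup>2" for t :: real
      using min[of "z + t *\<^sub>R x"] norm_add_square[of z "t *\<^sub>R x"]
      by (simp add: J_def add scaleR cinner_scaleR_right c_def power_mult_distrib algebra_simps)
    have "c = 0"
    proof (rule ccontr)
      assume c: "c \<noteq> 0"
      define d where "d = (norm x)\<^sup>2 + 1"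
      have d: "d > 0" by (simp add: d_def add_nonneg_pos)
      have "2 * (- c / d) * c + (- c / d)\<^sup>2 * (norm x)\<^sup>2 = - (c\<^sup>2 / d\<^sup>2) * (d + 1)"
        using d unfolding d_def by (simp add: power2_eq_square divide_simps) (simp add: algebra_simps)
      also have "\<dots> < 0" using c d by (auto intro!: mult_pos_pos)
      finally show False using q[of "- c / d"] by linarith
    qed
    thus ?thesis using cinner_commute[of z x] by (simp add: c_def)
  qed
  have "f x = cinner x z" for x
    using re[of x] re[of "\<i> *\<^sub>C x"] by (simp add: scale cinner_scaleC_left complex_eq_iff)
  thus ?thesis by (rule that)
qed

lemma cinner_adj: "cinner (T x) y = cinner x (adj T y)" if T: "clinear_op T"
  for T :: "'a::chilbert_space \<Rightarrow>\<^sub>L 'b::chilbert_space"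
proof -
  have "\<exists>z. \<forall>x. cinner (T x) y = cinner x z" for y
  proof -
    have "cmod (cinner (T x) y) \<le> (norm T * norm y) * norm x" for x
      using order_trans[OF norm_cinner_le mult_right_mono[OF norm_blinfun], of y T x]
      by (simp add: mult_ac)
    from riesz[OF _ _ this] T show ?thesis
      by (metis cinner_add_left cinner_scaleC_left blinfun.add_right clinear_op_def)
  qed
  then obtain S where S: "\<And>x y. cinner (T x) y = cinner x (S y)" by metis
  have "bounded_linear S"
  proof (rule bounded_linear_intro[where K = "norm T"])
    show "S (x + y) = S x + S y" for x y
      by (rule cinner_eqI) (simp add: S[symmetric] cinner_add_right)
    show "S (r *\<^sub>R x) = r *\<^sub>R S x" for r x
      by (rule cinner_eqI) (simp add: S[symmetric] cinner_scaleR_right)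
    show "norm (S y) \<le> norm y * norm T" for y
    proof (cases "S y = 0")
      case False
      have "(norm (S y))\<^sup>2 = Re (cinner (T (S y)) y)" by (simp add: S Re_cinner_self)
      also have "\<dots> \<le> norm (T (S y)) * norm y" by (rule Re_cinner_le)
      also have "\<dots> \<le> (norm T * norm (S y)) * norm y" by (intro mult_right_mono norm_blinfun) simp
      finally have "norm (S y) * norm (S y) \<le> norm (S y) * (norm y * norm T)"
        by (simp add: power2_eq_square mult_ac)
      thus ?thesis using False by simp
    qed simp
  qed
  hence "\<forall>x y. cinner (T x) y = cinner x (blinfun_apply (Blinfun S) y)"
    by (simp add: S bounded_linear_Blinfun_apply)
  hence "\<forall>x y. cinner (T x) y = cinner x (adj T y)"
    unfolding adj_def
  proof (rule theI)
    fix S' assume S': "\<forall>x y. cinner (T x) y = cinner x (blinfun_apply S' y)"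
    show "S' = Blinfun S"
      by (rule blinfun_eqI, rule cinner_eqI)
        (use S S' \<open>bounded_linear S\<close> in \<open>metis bounded_linear_Blinfun_apply\<close>)
  qed
  thus ?thesis by blast
qed

text \<open>Meaningful when \<open>A\<close> and \<open>B\<close> are closed under the \<open>*\<close>-algebra operations.\<close>

definition star_isomorphic ::
    "('a::chilbert_space \<Rightarrow>\<^sub>L 'a) set \<Rightarrow> ('b::chilbert_space \<Rightarrow>\<^sub>L 'b) set \<Rightarrow> bool"
  where "star_isomorphic A B \<longleftrightarrow>
    (\<exists>\<phi>. bij_betw \<phi> A B \<and>
      (\<forall>S\<in>A. \<forall>T\<in>A. \<phi> (S + T) = \<phi> S + \<phi> T) \<and>
      (\<forall>a. \<forall>T\<in>A. \<phi> (a *\<^sub>C T) = a *\<^sub>C \<phi> T) \<and>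
      (\<forall>S\<in>A. \<forall>T\<in>A. \<phi> (S o\<^sub>L T) = \<phi> S o\<^sub>L \<phi> T) \<and>
      (\<forall>T\<in>A. \<phi> (adj T) = adj (\<phi> T)))"

text \<open>The Hilbert space tensor product of \<open>\<ell>\<^sup>2(X)\<close> and \<open>K\<close> is realised as
  \<open>\<ell>\<^sup>2(X; K)\<close>, with \<open>\<xi> \<otimes> \<eta>\<close> the function \<open>x \<mapsto> \<xi>(x) \<eta>\<close>.\<close>

lift_definition ell2_tensor ::
    "('x, complex) ell2 \<Rightarrow> 'k::chilbert_space \<Rightarrow> ('x, 'k) ell2"
  is "\<lambda>\<xi> \<eta> x. \<xi> x *\<^sub>C \<eta>"
  by (simp add: norm_scaleC power_mult_distrib summable_on_cmult_left)

lemma cinner_ell2_tensor: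
  "cinner (ell2_tensor \<xi> \<eta>) (ell2_tensor \<xi>' \<eta>') = cinner \<xi> \<xi>' * cinner \<eta> \<eta>'"
proof transfer
  fix \<xi> \<xi>' :: "'x \<Rightarrow> complex" and \<eta> \<eta>' :: "'k::chilbert_space"
  have "cinner (\<xi> x *\<^sub>C \<eta>) (\<xi>' x *\<^sub>C \<eta>') = cinner (\<xi> x) (\<xi>' x) * cinner \<eta> \<eta>'" for x
    by (simp add: cinner_scaleC_left cinner_scaleC_right cinner_complex_def)
  thus "(\<Sum>\<^sub>\<infinity>x. cinner (\<xi> x *\<^sub>C \<eta>) (\<xi>' x *\<^sub>C \<eta>'))
      = (\<Sum>\<^sub>\<infinity>x. cinner (\<xi> x) (\<xi>' x)) * cinner \<eta> \<eta>'"
    by (simp add: infsum_cmult_left')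
qed

text \<open>For a \<open>C\<^sup>*\<close>-algebra \<open>A\<close> of operators on \<open>\<ell>\<^sup>2(X)\<close>, this is the spatial tensor product
  of \<open>A\<close> with the compact operators on \<open>K\<close>: the closed linear span of the operators
  \<open>a \<otimes> k\<close> on \<open>\<ell>\<^sup>2(X; K)\<close>. The compact operators are nuclear, so the choice of
  \<open>C\<^sup>*\<close>-norm on the algebraic tensor product does not matter.\<close>

definition tensor_compacts ::
    "(('x, complex) ell2 \<Rightarrow>\<^sub>L ('x, complex) ell2) set \<Rightarrow>
      (('x, 'k::chilbert_space) ell2 \<Rightarrow>\<^sub>L ('x, 'k) ell2) set"
  where "tensor_compacts A = closure (cvec.span
    {S. clinear_op S \<and> (\<exists>a\<in>A. \<exists>k. clinear_op k \<and> compact_op k \<and>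
      (\<forall>\<xi> \<eta>. S (ell2_tensor \<xi> \<eta>) = ell2_tensor (a \<xi>) (k \<eta>)))})"

definition stably_star_isomorphic ::
    "'k::chilbert_space itself \<Rightarrow>
      (('x, complex) ell2 \<Rightarrow>\<^sub>L ('x, complex) ell2) set \<Rightarrow>
      (('y, complex) ell2 \<Rightarrow>\<^sub>L ('y, complex) ell2) set \<Rightarrow> bool"
  where "stably_star_isomorphic _ A B \<longleftrightarrow>
    star_isomorphic (tensor_compacts A :: (('x, 'k) ell2 \<Rightarrow>\<^sub>L ('x, 'k) ell2) set)
      (tensor_compacts B :: (('y, 'k) ell2 \<Rightarrow>\<^sub>L ('y, 'k) ell2) set)"

definition infinite_dimensional_separable :: "'h::chilbert_space itself \<Rightarrow> bool"
  where "infinite_dimensional_separable _ \<longleftrightarrow>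
    (\<nexists>B :: 'h set. finite B \<and> cvec.span B = UNIV) \<and> separable_space (euclidean :: 'h topology)"

section \<open>Roe algebras\<close>

definition matrix_entry ::
    "(('x, 'h) ell2 \<Rightarrow>\<^sub>L ('x, 'h) ell2) \<Rightarrow> 'x \<Rightarrow> 'x \<Rightarrow> ('h \<Rightarrow>\<^sub>L 'h::chilbert_space)"
  where "matrix_entry T x y = ell2_coord x o\<^sub>L T o\<^sub>L ell2_single y"

definition finite_propagation ::
    "(('x::metric_space, 'h::chilbert_space) ell2 \<Rightarrow>\<^sub>L ('x, 'h) ell2) \<Rightarrow> bool"
  where "finite_propagation T \<longleftrightarrow> bdd_above {dist x y | x y. matrix_entry T x y \<noteq> 0}"

definition locally_compact_op ::
    "(('x, 'h::chilbert_space) ell2 \<Rightarrow>\<^sub>L ('x, 'h) ell2) \<Rightarrow> bool"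
  where "locally_compact_op T \<longleftrightarrow> (\<forall>x y. compact_op (matrix_entry T x y))"

definition uniform_Roe_algebra ::
    "'x::metric_space itself \<Rightarrow> (('x, complex) ell2 \<Rightarrow>\<^sub>L ('x, complex) ell2) set"
  where "uniform_Roe_algebra _ = closure {T. clinear_op T \<and> finite_propagation T}"

definition Roe_algebra ::
    "'x::metric_space itself \<Rightarrow> 'h::chilbert_space itself \<Rightarrow>
      (('x, 'h) ell2 \<Rightarrow>\<^sub>L ('x, 'h) ell2) set"
  where "Roe_algebra _ _ =
    closure {T. clinear_op T \<and> finite_propagation T \<and> locally_compact_op T}"

section \<open>Coarse geometry\<close>

definition bounded_geometry :: "'x::metric_space itself \<Rightarrow> bool"
  where "bounded_geometry _ \<longleftrightarrow>
    (\<forall>R>0. \<exists>N. \<forall>x::'x. finite (cball x R) \<and> card (cball x R) \<le> N)"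

definition control_function :: "(real \<Rightarrow> real) \<Rightarrow> bool"
  where "control_function \<rho> \<longleftrightarrow>
    mono_on {0..} \<rho> \<and> \<rho> ` {0..} \<subseteq> {0..} \<and> \<not> bdd_above (\<rho> ` {0..})"

definition coarse_embedding ::
    "('x \<Rightarrow> 'x \<Rightarrow> real) \<Rightarrow> ('y \<Rightarrow> 'y \<Rightarrow> real) \<Rightarrow> ('x \<Rightarrow> 'y) \<Rightarrow> bool"
  where "coarse_embedding d d' f \<longleftrightarrow>
    (\<exists>\<rho> \<sigma>. control_function \<rho> \<and> control_function \<sigma> \<and>
      (\<forall>x y. \<rho> (d x y) \<le> d' (f x) (f y) \<and> d' (f x) (f y) \<le> \<sigma> (d x y)))"

definition coarsely_equivalent :: "'x::metric_space itself \<Rightarrow> 'y::metric_space itself \<Rightarrow> bool"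
  where "coarsely_equivalent _ _ \<longleftrightarrow>
    (\<exists>f :: 'x \<Rightarrow> 'y. coarse_embedding dist dist f \<and> (\<exists>C>0. \<forall>y. \<exists>x. dist y (f x) \<le> C))"

text \<open>Elements of \<open>L\<^sup>p(\<nu>)\<close> are represented by functions, so \<open>Lp_dist\<close> is only a
  pseudometric on \<open>Lp\<close>; a map into the quotient by almost everywhere equality is a coarse
  embedding iff any choice of representatives for its values is one. Scalars are complex, and real
  \<open>L\<^sup>p\<close>-spaces embed isometrically.\<close>

definition Lp :: "real \<Rightarrow> 'z measure \<Rightarrow> ('z \<Rightarrow> complex) set"
  where "Lp p \<nu> = {g \<in> borel_measurable \<nu>. integrable \<nu> (\<lambda>z. cmod (g z) powr p)}"

definition Lp_dist :: "real \<Rightarrow> 'z measure \<Rightarrow> ('z \<Rightarrow> complex) \<Rightarrow> ('z \<Rightarrow> complex) \<Rightarrow> real"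
  where "Lp_dist p \<nu> g h = (\<integral>z. cmod (g z - h z) powr p \<partial>\<nu>) powr (1 / p)"

definition coarsely_embeds_into_Lp :: "'y::metric_space itself \<Rightarrow> real \<Rightarrow> 'z measure \<Rightarrow> bool"
  where "coarsely_embeds_into_Lp _ p \<nu> \<longleftrightarrow>
    (\<exists>f :: 'y \<Rightarrow> 'z \<Rightarrow> complex. range f \<subseteq> Lp p \<nu> \<and> coarse_embedding dist (Lp_dist p \<nu>) f)"

end

theory Submission
  imports Defs
begin

text \<open>A coarse equivalence gives a bijection of \<open>X \<times> \<nat>\<close> with \<open>Y \<times> \<nat>\<close> of controlled distortion, hence a
  unitary implementing isomorphisms of both kinds of algebras.

  Conversely, an isomorphism is implemented by a unitary \<open>U\<close>. By a gliding hump argument the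
  measures \<open>\<parallel>(U (\<delta>\<^sub>x \<otimes> e)) y\<parallel>\<^sup>2\<close> on \<open>Y\<close> are concentrated at a uniform scale: two well-separated sets cannot
  both have large mass. So a large part of \<open>Y\<close> satisfies a uniform isoperimetric inequality for such a
  measure, hence a Poincare inequality for maps into \<open>L\<^sup>p\<close>. Applied to the coarse embedding of \<open>Y\<close>, it
  shows that a definite part of the mass lies in a ball of uniform radius around some \<open>f x\<close>. Further
  gliding humps show that \<open>f\<close> is a coarse embedding. Hence \<open>X\<close> also embeds coarsely into \<open>L\<^sup>p\<close>, the same
  argument for the inverse of \<open>U\<close> gives \<open>g : Y \<rightarrow> X\<close>, and \<open>f \<circ> g\<close> is close to the identity.\<close>

text \<open>Concentration alone does not localise a vector: mass spread evenly over a large expander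
  is concentrated at a uniform scale as well. The embedding of \<open>Y\<close> excludes this, since
  a Poincare inequality on a set of definite mass forces most of that set into a bounded part of the
  \<open>L^p\<close>-space.

  All gliding humps have the same shape. Infinitely many rank-one operators with well-spaced
  supports add up strongly to one element of the algebra of the source space. Its image is
  quasi-local, although every single summand is sent to an operator joining two far-apart pieces.
  For such a sum to stay in the stabilised uniform Roe algebra, one projection \<open>p\<close> is
  made to cut down all summands. The vectors \<open>ell2_single x e\<close> with fixed
  \<open>e\<close> allow this, their images under \<open>U\<close> may not. These images are however
  all fixed by one element of the algebra, the conjugate by \<open>U\<close> of the amplified
  rank-one projection onto \<open>e\<close>, and a norm approximation of that element which is cut
  down by some \<open>p\<close> corrects them uniformly. Hence the test vectors enter as values of
  algebra elements \<open>D\<close>.\<close>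

section \<open>Hilbert space preliminaries\<close>

interpretation cinner: bounded_bilinear "cinner :: 'a::chilbert_space \<Rightarrow> 'a \<Rightarrow> complex"
  by standard
    (auto simp: cinner_add_left cinner_add_right cinner_scaleR_left cinner_scaleR_right
      scaleR_conv_of_real intro!: exI[of _ 1] norm_cinner_le)

interpretation scaleC: bounded_bilinear "scaleC :: complex \<Rightarrow> 'a \<Rightarrow> 'a::chilbert_space"
proof
  fix r :: real and a :: complex and b :: 'a
  show "(r *\<^sub>R a) *\<^sub>C b = r *\<^sub>R a *\<^sub>C b"
    unfolding scaleR_conv_of_real by (simp add: scaleR_scaleC[of r "a *\<^sub>C b"] scaleC_scaleC)
  show "a *\<^sub>C r *\<^sub>R b = r *\<^sub>R a *\<^sub>C b"
    unfolding scaleR_scaleC by (simp add: scaleC_scaleC mult.commute)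
qed (auto simp: scaleC_add_left scaleC_add_right norm_scaleC intro!: exI[of _ 1])

lemma cnj_cinner [simp]: "cnj (cinner x y) = cinner y x" for x :: "'a::chilbert_space"
  by (metis cinner_commute)

lemma cmod_cinner_commute: "cmod (cinner x y) = cmod (cinner y x)" for x :: "'a::chilbert_space"
  by (metis cinner_commute complex_mod_cnj)

section \<open>Complex linearity, adjoints and rank-one operators\<close>

lemma clinear_op_id: "clinear_op id_blinfun"
  and clinear_op_zero: "clinear_op 0"
  and clinear_op_compose: "clinear_op S \<Longrightarrow> clinear_op T \<Longrightarrow> clinear_op (S o\<^sub>L T)"
  and clinear_op_add: "clinear_op S' \<Longrightarrow> clinear_op T' \<Longrightarrow> clinear_op (S' + T')"
  and clinear_op_diff: "clinear_op S' \<Longrightarrow> clinear_op T' \<Longrightarrow> clinear_op (S' - T')"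
  and clinear_op_scaleC: "clinear_op T \<Longrightarrow> clinear_op (a *\<^sub>C T)"
  by (auto simp: clinear_op_def blinfun.add_left blinfun.diff_left scaleC_add_right
      scaleC.diff_right scaleC_blinfun.rep_eq scaleC_scaleC mult.commute)

lemma clinear_op_sum: "(\<And>i. i \<in> I \<Longrightarrow> clinear_op (T i)) \<Longrightarrow> clinear_op (\<Sum>i\<in>I. T i)"
  by (induction I rule: infinite_finite_induct) (auto intro: clinear_op_add clinear_op_zero)

lemma clinear_opD: "clinear_op T \<Longrightarrow> T (a *\<^sub>C x) = a *\<^sub>C T x"
  by (simp add: clinear_op_def)

text \<open>Since \<open>blinfun\<close> is only real-linear, complex linearity has to be tracked
  separately; closedness passes it from generating sets to the norm closures that are the
  algebras.\<close>

lemma closed_clinear_op: "closed {T :: 'a::chilbert_space \<Rightarrow>\<^sub>L 'b::chilbert_space. clinear_op T}"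
proof -
  have "{T :: 'a \<Rightarrow>\<^sub>L 'b. clinear_op T} = (\<Inter>a. \<Inter>x. {T :: 'a \<Rightarrow>\<^sub>L 'b. T (a *\<^sub>C x) = a *\<^sub>C T x})"
    by (auto simp: clinear_op_def)
  also have "closed \<dots>"
    by (intro closed_INT ballI closed_Collect_eq continuous_intros scaleC.continuous_on)
  finally show ?thesis .
qed

lemma adj_unique:
  fixes T :: "'a::chilbert_space \<Rightarrow>\<^sub>L 'b::chilbert_space"
  assumes "\<And>x y. cinner (T x) y = cinner x (blinfun_apply S y)"
  shows "adj T = S"
  unfolding adj_def
proof (rule the_equality)
  show "S' = S" if "\<forall>x y. cinner (T x) y = cinner x (blinfun_apply S' y)" for S'
    by (rule blinfun_eqI, rule cinner_eqI) (use that assms in metis)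
qed (use assms in blast)

lemma cinner_adj': "cinner x (T y) = cinner (adj T x) y" if "clinear_op T"
  for T :: "'a::chilbert_space \<Rightarrow>\<^sub>L 'b::chilbert_space"
  by (metis that cinner_adj cinner_commute)

definition rank_one :: "'b \<Rightarrow> 'a \<Rightarrow> ('a::chilbert_space \<Rightarrow>\<^sub>L 'b::chilbert_space)"
  where "rank_one u v = Blinfun (\<lambda>w. cinner w v *\<^sub>C u)"

lemma rank_one_apply [simp]: "rank_one u v w = cinner w v *\<^sub>C u"
proof -
  have "bounded_linear (\<lambda>w. cinner w v *\<^sub>C u)"
    by (intro bounded_linear_compose[OF scaleC.bounded_linear_left] cinner.bounded_linear_left)
  thus ?thesis by (simp add: rank_one_def bounded_linear_Blinfun_apply)
qed

lemma clinear_rank_one: "clinear_op (rank_one u v)"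
  by (simp add: clinear_op_def cinner_scaleC_left scaleC_scaleC)

lemma adj_rank_one: "adj (rank_one u v) = rank_one v u"
  by (rule adj_unique) (simp add: cinner_scaleC_left cinner_scaleC_right mult.commute)

lemma compose_rank_one: "clinear_op T \<Longrightarrow> T o\<^sub>L rank_one u v = rank_one (T u) v"
  by (rule blinfun_eqI) (simp add: clinear_opD)

lemma norm_rank_one_le: "norm (rank_one u v) \<le> norm u * norm v"
proof (rule norm_blinfun_bound)
  show "norm (rank_one u v w) \<le> norm u * norm v * norm w" for w
    using mult_right_mono[OF norm_cinner_le[of w v] norm_ge_zero[of u]]
    by (simp add: norm_scaleC mult_ac)
qed simp

lemma rank_one_diff:
  "rank_one u v - rank_one u' v' = rank_one (u - u') v + rank_one u' (v - v')"
  by (rule blinfun_eqI)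
    (simp add: blinfun.add_left blinfun.diff_left scaleC.diff_right cinner_diff_right
      scaleC.diff_left)

section \<open>Compact operators\<close>

lemma compact_op_subset:
  assumes "compact K" and "blinfun_apply T ` cball 0 1 \<subseteq> K"
  shows "compact_op T"
proof -
  have "closure (blinfun_apply T ` cball 0 1) \<subseteq> K"
    using assms by (simp add: closure_minimal compact_imp_closed)
  hence "closure (blinfun_apply T ` cball 0 1) = K \<inter> closure (blinfun_apply T ` cball 0 1)" by blast
  thus ?thesis
    unfolding compact_op_def by (metis compact_Int_closed[OF assms(1)] closed_closure)
qed

lemma compact_op_cball:
  assumes "compact_op T"
  shows "\<exists>K. compact K \<and> blinfun_apply T ` cball 0 r \<subseteq> K"
proof -
  \<comment> \<open>The added 1 keeps the scaling factor positive when \<open>r\<close> is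
    zero.\<close>
  define c where "c = \<bar>r\<bar> + 1"
  have c: "c > 0" "r \<le> c" by (auto simp: c_def)
  have "blinfun_apply T ` cball 0 r \<subseteq> (*\<^sub>R) c ` closure (blinfun_apply T ` cball 0 1)"
  proof (rule image_subsetI)
    fix x :: 'a assume "x \<in> cball 0 r"
    hence "(1 / c) *\<^sub>R x \<in> cball 0 1" using c by (simp add: field_simps)
    hence "T ((1 / c) *\<^sub>R x) \<in> closure (blinfun_apply T ` cball 0 1)"
      by (rule subsetD[OF closure_subset imageI])
    moreover have "T x = c *\<^sub>R T ((1 / c) *\<^sub>R x)"
      using c by (simp add: blinfun.scaleR_right)
    ultimately show "T x \<in> (*\<^sub>R) c ` closure (blinfun_apply T ` cball 0 1)"
      by (rule image_eqI[rotated])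
  qed
  moreover have "compact ((*\<^sub>R) c ` closure (blinfun_apply T ` cball 0 1))"
    using assms by (intro compact_scaling) (simp add: compact_op_def)
  ultimately show ?thesis by blast
qed

lemma compact_op_compose_left:
  assumes "compact_op T" shows "compact_op (S o\<^sub>L T)"
proof (rule compact_op_subset)
  show "compact (blinfun_apply S ` closure (blinfun_apply T ` cball 0 1))"
    using assms unfolding compact_op_def
    by (intro compact_continuous_image) (auto intro!: continuous_intros)
  show "blinfun_apply (S o\<^sub>L T) ` cball 0 1 \<subseteq> blinfun_apply S ` closure (blinfun_apply T ` cball 0 1)"
    by (auto intro!: imageI subsetD[OF closure_subset])
qed

lemma compact_op_compose_right:
  assumes "compact_op T" shows "compact_op (T o\<^sub>L S)"
proof -
  obtain K where K: "compact K" "blinfun_apply T ` cball 0 (norm S) \<subseteq> K"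
    using compact_op_cball[OF assms] by blast
  have "S x \<in> cball 0 (norm S)" if "norm x \<le> 1" for x
    using norm_blinfun[of S x] mult_left_le[OF that norm_ge_zero[of S]] by simp
  thus ?thesis using K by (intro compact_op_subset[OF K(1)]) auto
qed

lemma compact_op_add:
  assumes "compact_op S" "compact_op T" shows "compact_op (S + T)"
proof (rule compact_op_subset)
  show "compact {x + y |x y. x \<in> closure (blinfun_apply S ` cball 0 1) \<and> y \<in> closure (blinfun_apply T ` cball 0 1)}"
    using assms unfolding compact_op_def by (rule compact_sums)
  show "blinfun_apply (S + T) ` cball 0 1
      \<subseteq> {x + y |x y. x \<in> closure (blinfun_apply S ` cball 0 1) \<and> y \<in> closure (blinfun_apply T ` cball 0 1)}"
    by (fastforce simp: blinfun.add_left intro: subsetD[OF closure_subset] imageI)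
qed

lemma compact_op_zero: "compact_op 0"
  by (rule compact_op_subset[of "{0}"]) auto

lemma compact_op_sum: "(\<And>i. i \<in> I \<Longrightarrow> compact_op (T i)) \<Longrightarrow> compact_op (\<Sum>i\<in>I. T i)"
  by (induction I rule: infinite_finite_induct) (auto intro: compact_op_add compact_op_zero)

lemma compact_op_rank_one:
  fixes u :: "'b::chilbert_space" and v :: "'a::chilbert_space"
  shows "compact_op (rank_one u v)"
proof (rule compact_op_subset)
  show "compact ((\<lambda>c. c *\<^sub>C u) ` cball 0 (norm v))"
    by (intro compact_continuous_image scaleC.continuous_on continuous_intros compact_cball)
  show "blinfun_apply (rank_one u v) ` cball 0 1 \<subseteq> (\<lambda>c. c *\<^sub>C u) ` cball 0 (norm v)"
  proof (rule image_subsetI)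
    fix w :: 'a assume "w \<in> cball 0 1"
    hence "cmod (cinner w v) \<le> norm v"
      using order_trans[OF norm_cinner_le[of w v] mult_right_mono[of "norm w" 1 "norm v"]] by simp
    thus "rank_one u v w \<in> (\<lambda>c. c *\<^sub>C u) ` cball 0 (norm v)" by auto
  qed
qed

text \<open>A subsequence whose images stay away from 0 would have a norm-convergent subsequence of
  images by compactness, and moving \<open>T\<close> to its adjoint shows that the limit is
  orthogonal to everything.\<close>

lemma compact_op_weakly_null:
  fixes T :: "'a::chilbert_space \<Rightarrow>\<^sub>L 'b::chilbert_space"
  assumes "compact_op T" "clinear_op T" "\<And>n. norm (v n) \<le> 1"
    and "\<And>w. (\<lambda>n. cinner (v n) w) \<longlonglongrightarrow> 0"
  shows "(\<lambda>n. T (v n)) \<longlonglongrightarrow> 0"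
proof (rule ccontr)
  assume "\<not> (\<lambda>n. T (v n)) \<longlonglongrightarrow> 0"
  then obtain e where e: "e > 0" "\<forall>N. \<exists>n\<ge>N. norm (T (v n)) \<ge> e"
    unfolding lim_sequentially by (auto simp: not_less)
  define A where "A = {n. norm (T (v n)) \<ge> e}"
  have "infinite A" using e(2) by (auto simp: A_def infinite_nat_iff_unbounded_le)
  then obtain k :: "nat \<Rightarrow> nat" where k: "strict_mono k" "\<And>n. k n \<in> A"
    by (metis infinite_enumerate)
  have mem: "\<forall>n. T (v (k n)) \<in> closure (blinfun_apply T ` cball 0 1)"
    using assms(3) by (auto intro!: subsetD[OF closure_subset] imageI)
  have sc: "seq_compact (closure (blinfun_apply T ` cball 0 1))"
    using assms(1) by (simp add: compact_op_def compact_imp_seq_compact)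
  obtain l j where j: "strict_mono j" and l: "(\<lambda>n. T (v (k (j n)))) \<longlonglongrightarrow> l"
    using seq_compactE[OF sc mem] unfolding comp_def by metis
  have sub: "strict_mono (k \<circ> j)" using k j by (simp add: strict_mono_o)
  have "cinner l w = 0" for w :: 'b
  proof (rule LIMSEQ_unique)
    show "(\<lambda>n. cinner (T (v (k (j n)))) w) \<longlonglongrightarrow> cinner l w"
      by (intro cinner.tendsto l tendsto_const)
    show "(\<lambda>n. cinner (T (v (k (j n)))) w) \<longlonglongrightarrow> 0"
      using LIMSEQ_subseq_LIMSEQ[OF assms(4)[of "adj T w"] sub]
      by (simp add: cinner_adj[OF assms(2)] comp_def)
  qed
  hence "l = 0" by (metis cinner_self norm_eq_zero of_real_eq_0_iff power_eq_0_iff)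
  moreover have "e \<le> norm l"
    using k(2) by (intro LIMSEQ_le_const[OF tendsto_norm[OF l]]) (auto simp: A_def)
  ultimately show False using e(1) by simp
qed

section \<open>Orthogonal series\<close>

lemma norm_sum_orthogonal:
  fixes a :: "'i \<Rightarrow> 'a::chilbert_space"
  assumes "finite I" and "\<And>i j. i \<noteq> j \<Longrightarrow> cinner (a i) (a j) = 0"
  shows "(norm (\<Sum>i\<in>I. c i *\<^sub>C a i))\<^sup>2 = (\<Sum>i\<in>I. (cmod (c i))\<^sup>2 * (norm (a i))\<^sup>2)"
  using assms
proof (induction I rule: finite_induct)
  case (insert i I)
  have "cinner (c i *\<^sub>C a i) (\<Sum>j\<in>I. c j *\<^sub>C a j) = 0"
    unfolding cinner.sum_right using insert.hyps insert.prems
    by (intro sum.neutral ballI)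
      (metis cinner_scaleC_left cinner_scaleC_right mult_zero_right)
  thus ?case using insert by (simp add: norm_add_square norm_scaleC power_mult_distrib)
qed simp

text \<open>The \<open>b i\<close> may be shorter than unit vectors, as cut-down vectors are, so
  \<open>w\<close> need not be the projection of \<open>v\<close>. Still, the sum \<open>s\<close>
  equals \<open>cinner v w\<close> and dominates the square of \<open>norm w\<close>; Cauchy-Schwarz
  turns this into \<open>s \<le> norm v * sqrt s\<close>.\<close>

lemma bessel:
  fixes b :: "'i \<Rightarrow> 'a::chilbert_space"
  assumes "finite I" and orth: "\<And>i j. i \<noteq> j \<Longrightarrow> cinner (b i) (b j) = 0"
    and nb: "\<And>i. norm (b i) \<le> 1"
  shows "(\<Sum>i\<in>I. (cmod (cinner v (b i)))\<^sup>2) \<le> (norm v)\<^sup>2"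
proof -
  define w where "w = (\<Sum>i\<in>I. cinner v (b i) *\<^sub>C b i)"
  define s where "s = (\<Sum>i\<in>I. (cmod (cinner v (b i)))\<^sup>2)"
  have s0: "s \<ge> 0" by (simp add: s_def sum_nonneg)
  have "(norm w)\<^sup>2 = (\<Sum>i\<in>I. (cmod (cinner v (b i)))\<^sup>2 * (norm (b i))\<^sup>2)"
    unfolding w_def by (rule norm_sum_orthogonal) (use assms in auto)
  also have "\<dots> \<le> s"
    unfolding s_def using nb by (intro sum_mono mult_left_le) (auto simp: power_le_one)
  finally have "(norm w)\<^sup>2 \<le> s" .
  moreover have "cinner v w = complex_of_real s"
    unfolding w_def s_def cinner.sum_right cinner_scaleC_right of_real_sum complex_norm_square
    by (simp add: mult.commute)
  hence "s = Re (cinner v w)" by simp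
  ultimately have "(norm w)\<^sup>2 \<le> s" "s \<le> norm v * norm w" using Re_cinner_le[of v w] by auto
  hence "s \<le> norm v * sqrt s"
    by (meson mult_left_mono norm_ge_zero order_trans real_le_rsqrt)
  hence "sqrt s * sqrt s \<le> norm v * sqrt s" using s0 by simp
  hence "sqrt s \<le> norm v"
    using s0 mult_right_le_imp_le[of "sqrt s" "sqrt s" "norm v"] by (cases "s = 0") auto
  thus ?thesis unfolding s_def[symmetric] by (rule sqrt_le_D)
qed

text \<open>A block of the series has squared norm at most the same block of squared Bessel
  coefficients, so the series is Cauchy for each \<open>v\<close>. The sum is a strong one. It
  serves both to add up infinitely many rank-one blocks and to build a unitary from two orthonormal
  bases.\<close>

lemma orthogonal_sum_operator:
  fixes a :: "nat \<Rightarrow> 'b::chilbert_space" and b :: "nat \<Rightarrow> 'a::chilbert_space"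
  assumes oa: "\<And>i j. i \<noteq> j \<Longrightarrow> cinner (a i) (a j) = 0" and na: "\<And>i. norm (a i) \<le> 1"
    and ob: "\<And>i j. i \<noteq> j \<Longrightarrow> cinner (b i) (b j) = 0" and nb: "\<And>i. norm (b i) \<le> 1"
  obtains T :: "'a \<Rightarrow>\<^sub>L 'b" where "clinear_op T" "\<And>v. (\<lambda>n. cinner v (b n) *\<^sub>C a n) sums T v"
proof -
  have fin: "(norm (\<Sum>i\<in>I. cinner v (b i) *\<^sub>C a i))\<^sup>2 \<le> (\<Sum>i\<in>I. (cmod (cinner v (b i)))\<^sup>2)"
    if "finite I" for I v
  proof -
    have "(norm (\<Sum>i\<in>I. cinner v (b i) *\<^sub>C a i))\<^sup>2
        = (\<Sum>i\<in>I. (cmod (cinner v (b i)))\<^sup>2 * (norm (a i))\<^sup>2)"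
      by (rule norm_sum_orthogonal) (use that oa in auto)
    also have "\<dots> \<le> (\<Sum>i\<in>I. (cmod (cinner v (b i)))\<^sup>2)"
      using na by (intro sum_mono mult_left_le) (auto simp: power_le_one)
    finally show ?thesis .
  qed
  have summ: "summable (\<lambda>n. cinner v (b n) *\<^sub>C a n)" for v
    unfolding summable_Cauchy
  proof safe
    fix e :: real assume e: "e > 0"
    have "summable (\<lambda>n. (cmod (cinner v (b n)))\<^sup>2)"
      by (rule bounded_imp_summable[where B = "(norm v)\<^sup>2"]) (use bessel[where b = b, OF _ ob nb] in auto)
    then obtain N where N: "\<forall>m\<ge>N. \<forall>n. norm (\<Sum>i=m..<n. (cmod (cinner v (b i)))\<^sup>2) < e\<^sup>2"
      using e unfolding summable_Cauchy by (metis zero_less_power)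
    have "norm (\<Sum>i=m..<n. cinner v (b i) *\<^sub>C a i) < e" if "m \<ge> N" for m n
    proof -
      have "(norm (\<Sum>i=m..<n. cinner v (b i) *\<^sub>C a i))\<^sup>2 < e\<^sup>2"
        using fin[of "{m..<n}" v] N that by (smt (verit) finite_atLeastLessThan real_norm_def)
      thus ?thesis using e by (simp add: power2_less_imp_less)
    qed
    thus "\<exists>N. \<forall>m\<ge>N. \<forall>n. norm (\<Sum>i=m..<n. cinner v (b i) *\<^sub>C a i) < e" by blast
  qed
  define f where "f v = (\<Sum>n. cinner v (b n) *\<^sub>C a n)" for v
  have f: "(\<lambda>n. cinner v (b n) *\<^sub>C a n) sums f v" for v
    using summ by (simp add: f_def summable_sums)
  have fC: "f (c *\<^sub>C v) = c *\<^sub>C f v" for c v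
    using sums_unique2[OF f[of "c *\<^sub>C v"]] bounded_linear.sums[OF scaleC.bounded_linear_right f[of v]]
    by (simp add: cinner_scaleC_left scaleC_scaleC)
  have "bounded_linear f"
  proof (rule bounded_linear_intro[where K = 1])
    show "f (x + y) = f x + f y" for x y
      using sums_unique2[OF f[of "x + y"]] sums_add[OF f[of x] f[of y]]
      by (simp add: cinner_add_left scaleC_add_left)
    show "f (r *\<^sub>R x) = r *\<^sub>R f x" for r x by (simp add: scaleR_scaleC fC)
    show "norm (f x) \<le> norm x * 1" for x
    proof -
      have "norm (\<Sum>i<n. cinner x (b i) *\<^sub>C a i) \<le> norm x" for n
        using order_trans[OF fin bessel[where b = b, OF _ ob nb], of "{..<n}" x] by simp
      thus ?thesis
        using LIMSEQ_le_const2[OF tendsto_norm[OF f[unfolded sums_def, of x]]] by auto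
    qed
  qed
  hence ap: "blinfun_apply (Blinfun f) = f" by (rule bounded_linear_Blinfun_apply)
  show ?thesis by (rule that[of "Blinfun f"]) (simp_all add: clinear_op_def ap fC f)
qed

section \<open>Square-summable functions\<close>

type_synonym ('x, 'h) ell2_op = "('x, 'h) ell2 \<Rightarrow>\<^sub>L ('x, 'h) ell2"

lemma ell2_eqI: "(\<And>x. ell2_apply f x = ell2_apply g x) \<Longrightarrow> f = g"
  by (metis ell2_apply_inject ext)

lemmas ell2_simps = zero_ell2.rep_eq plus_ell2.rep_eq minus_ell2.rep_eq uminus_ell2.rep_eq
  scaleR_ell2.rep_eq scaleC_ell2.rep_eq

lemma ell2_apply_sum: "ell2_apply (\<Sum>i\<in>I. f i) x = (\<Sum>i\<in>I. ell2_apply (f i) x)"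
  by (induction I rule: infinite_finite_induct) (auto simp: ell2_simps)

lemma norm_ell2_has_sum: "((\<lambda>x. (norm (ell2_apply f x))\<^sup>2) has_sum (norm f)\<^sup>2) UNIV"
  by transfer (simp add: infsum_nonneg has_sum_infsum)

lemma cinner_ell2_has_sum:
  "((\<lambda>x. cinner (ell2_apply f x) (ell2_apply g x)) has_sum cinner f g) UNIV"
  by transfer (auto intro: has_sum_infsum cinner_summable)

lemma ell2_norm_le:
  assumes "\<And>x. norm (ell2_apply f x) \<le> c * norm (ell2_apply g x)" "c \<ge> 0"
  shows "norm f \<le> c * norm g"
proof -
  have "(norm f)\<^sup>2 \<le> c\<^sup>2 * (norm g)\<^sup>2"
  proof (rule has_sum_mono[OF norm_ell2_has_sum])
    show "((\<lambda>x. c\<^sup>2 * (norm (ell2_apply g x))\<^sup>2) has_sum c\<^sup>2 * (norm g)\<^sup>2) UNIV"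
      by (intro has_sum_cmult_right norm_ell2_has_sum)
    show "(norm (ell2_apply f x))\<^sup>2 \<le> c\<^sup>2 * (norm (ell2_apply g x))\<^sup>2" for x
      using power_mono[OF assms(1)[of x] norm_ge_zero, of 2] by (simp add: power_mult_distrib)
  qed
  thus ?thesis
    using assms(2) by (simp add: power_mult_distrib[symmetric] power2_le_iff_abs_le)
qed

lemma norm_ell2_single [simp]: "norm (ell2_single x h) = norm h"
proof -
  have "(norm (ell2_single x h))\<^sup>2 = (norm h)\<^sup>2"
    by (rule has_sum_unique[OF norm_ell2_has_sum]) (simp add: single_square_sum)
  thus ?thesis by simp
qed

lemma cinner_ell2_single: "cinner f (ell2_single x h) = cinner (ell2_apply f x) h"
proof (rule has_sum_unique[OF cinner_ell2_has_sum])
  show "((\<lambda>y. cinner (ell2_apply f y) (ell2_apply (ell2_single x h) y))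
      has_sum cinner (ell2_apply f x) h) UNIV"
    by (rule has_sum_finite_neutralI[of "{x}"]) (auto simp: cinner.zero_right)
qed

lemma cinner_ell2_single': "cinner (ell2_single x h) f = cinner h (ell2_apply f x)"
  by (metis cinner_ell2_single cinner_commute)

lemma clinear_ell2_single: "clinear_op (ell2_single x)"
  and clinear_ell2_coord: "clinear_op (ell2_coord x)"
  by (auto simp: clinear_op_def scaleC_ell2.rep_eq scaleC.zero_right intro!: ell2_eqI)

section \<open>Restriction to subsets and approximation by finite supports\<close>

lift_definition ell2_restrict ::
    "'x set \<Rightarrow> ('x, 'h::real_normed_vector) ell2 \<Rightarrow> ('x, 'h) ell2"
  is "\<lambda>B f x. if x \<in> B then f x else 0"
  by (erule summable_on_comparison_test) auto

lemma ell2_restrict_apply [simp]: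
  "ell2_apply (ell2_restrict B f) x = (if x \<in> B then ell2_apply f x else 0)"
  by transfer simp

lemma norm_ell2_restrict_le: "norm (ell2_restrict B f) \<le> norm f"
  using ell2_norm_le[of "ell2_restrict B f" 1 f] by simp

lemma cinner_ell2_restrict: "cinner (ell2_restrict B f) g = cinner f (ell2_restrict B g)"
proof (rule has_sum_unique[OF cinner_ell2_has_sum])
  show "((\<lambda>x. cinner (ell2_apply (ell2_restrict B f) x) (ell2_apply g x))
      has_sum cinner f (ell2_restrict B g)) UNIV"
    using cinner_ell2_has_sum[of f "ell2_restrict B g"]
    by (rule has_sum_cong[THEN iffD1, rotated]) (auto simp: cinner.zero_left cinner.zero_right)
qed

lemma ell2_restrict_idem [simp]: "ell2_restrict A (ell2_restrict B f) = ell2_restrict (A \<inter> B) f"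
  by (rule ell2_eqI) auto

lemma cinner_ell2_restrict_self: "cinner f (ell2_restrict B f) = of_real ((norm (ell2_restrict B f))\<^sup>2)"
  by (metis cinner_ell2_restrict cinner_self ell2_restrict_idem inf.idem)

lemma ell2_restrict_finite:
  "finite F \<Longrightarrow> ell2_restrict F f = (\<Sum>x\<in>F. ell2_single x (ell2_apply f x))"
  by (rule ell2_eqI) (auto simp: ell2_apply_sum)

lemma norm_ell2_restrict_finite:
  assumes "finite F"
  shows "(norm (ell2_restrict F f))\<^sup>2 = (\<Sum>x\<in>F. (norm (ell2_apply f x))\<^sup>2)"
  by (rule has_sum_unique[OF norm_ell2_has_sum], rule has_sum_finite_neutralI[of F])
    (use assms in auto)

lemma norm_ell2_diff_restrict:
  "(norm (f - ell2_restrict B f))\<^sup>2 = (norm f)\<^sup>2 - (norm (ell2_restrict B f))\<^sup>2"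
  for f :: "('x, 'h::chilbert_space) ell2"
proof -
  have "Re (cinner f (ell2_restrict B f)) = (norm (ell2_restrict B f))\<^sup>2"
    by (simp add: cinner_ell2_restrict_self)
  thus ?thesis using norm_add_square[of f "- ell2_restrict B f"] by (simp add: cinner_minus_right)
qed

text \<open>By orthogonality the squared distance is the squared norm of \<open>f\<close> minus a
  partial sum of the series defining it.\<close>

lemma ell2_restrict_tendsto:
  fixes f :: "('x, 'h::chilbert_space) ell2"
  shows "((\<lambda>F. ell2_restrict F f) \<longlongrightarrow> f) (finite_subsets_at_top UNIV)"
proof -
  have "((\<lambda>F. \<Sum>x\<in>F. (norm (ell2_apply f x))\<^sup>2) \<longlongrightarrow> (norm f)\<^sup>2) (finite_subsets_at_top UNIV)"
    using norm_ell2_has_sum[of f] by (simp add: has_sum_def)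
  hence "((\<lambda>F. (norm f)\<^sup>2 - (\<Sum>x\<in>F. (norm (ell2_apply f x))\<^sup>2)) \<longlongrightarrow> (norm f)\<^sup>2 - (norm f)\<^sup>2)
      (finite_subsets_at_top UNIV)"
    by (intro tendsto_intros)
  moreover have "\<forall>\<^sub>F F in finite_subsets_at_top UNIV.
      (norm f)\<^sup>2 - (\<Sum>x\<in>F. (norm (ell2_apply f x))\<^sup>2) = (norm (f - ell2_restrict F f))\<^sup>2"
    by (rule eventually_finite_subsets_at_top_weakI)
      (simp add: norm_ell2_diff_restrict norm_ell2_restrict_finite)
  ultimately have "((\<lambda>F. (norm (f - ell2_restrict F f))\<^sup>2) \<longlongrightarrow> 0) (finite_subsets_at_top UNIV)"
    using Lim_transform_eventually by fastforce
  hence "((\<lambda>F. sqrt ((norm (f - ell2_restrict F f))\<^sup>2)) \<longlongrightarrow> sqrt 0) (finite_subsets_at_top UNIV)"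
    by (intro tendsto_intros)
  thus ?thesis
    by (simp add: tendsto_dist_iff[of _ f] dist_norm norm_minus_commute)
qed

lemma ell2_has_sum: "((\<lambda>x. ell2_single x (ell2_apply f x)) has_sum f) UNIV"
  for f :: "('x, 'h::chilbert_space) ell2"
  unfolding has_sum_def
proof (rule Lim_transform_eventually[OF ell2_restrict_tendsto])
  show "\<forall>\<^sub>F F in finite_subsets_at_top UNIV.
      ell2_restrict F f = (\<Sum>x\<in>F. ell2_single x (ell2_apply f x))"
    by (rule eventually_finite_subsets_at_top_weakI) (simp add: ell2_restrict_finite)
qed

lemma ell2_finite_approx:
  fixes f :: "('x, 'h::chilbert_space) ell2"
  assumes "e > 0"
  obtains F where "finite F" "norm (f - ell2_restrict F f) < e"
proof -
  have "\<forall>\<^sub>F F in finite_subsets_at_top UNIV. dist (ell2_restrict F f) f < e"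
    using ell2_restrict_tendsto assms by (rule tendstoD)
  thus ?thesis
    using that by (auto simp: eventually_finite_subsets_at_top dist_norm norm_minus_commute)
qed

section \<open>Matrix entries and amplification of operators on the fibre\<close>

lemma matrix_entry_apply [simp]: "matrix_entry T x y h = ell2_apply (T (ell2_single y h)) x"
  by (simp add: matrix_entry_def)

lemma operator_has_sum:
  "((\<lambda>y. matrix_entry T x y (ell2_apply v y)) has_sum ell2_apply (T v) x) UNIV"
proof -
  have "((\<lambda>y. (ell2_coord x o\<^sub>L T) (ell2_single y (ell2_apply v y)))
      has_sum (ell2_coord x o\<^sub>L T) v) UNIV"
    using has_sum_bounded_linear[OF blinfun.bounded_linear_right[of "ell2_coord x o\<^sub>L T"]
        ell2_has_sum[of v]] by (simp add: comp_def)
  thus ?thesis by simp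
qed

lemma blinfun_eq_ell2I:
  fixes S T :: "('x, 'h::chilbert_space) ell2 \<Rightarrow>\<^sub>L 'a::real_normed_vector"
  assumes "\<And>x h. S (ell2_single x h) = T (ell2_single x h)"
  shows "S = T"
proof (rule blinfun_eqI)
  fix v
  have "((\<lambda>x. S (ell2_single x (ell2_apply v x))) has_sum S v) UNIV"
    and "((\<lambda>x. T (ell2_single x (ell2_apply v x))) has_sum T v) UNIV"
    using has_sum_bounded_linear[OF blinfun.bounded_linear_right[of S] ell2_has_sum[of v]]
      has_sum_bounded_linear[OF blinfun.bounded_linear_right[of T] ell2_has_sum[of v]]
    by (simp_all add: comp_def)
  thus "S v = T v" using assms has_sum_unique by simp
qed

lift_definition ell2_map :: "('h::real_normed_vector \<Rightarrow>\<^sub>L 'h) \<Rightarrow> ('x, 'h) ell2 \<Rightarrow> ('x, 'h) ell2"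
  is "\<lambda>p f x. blinfun_apply p (f x)"
proof -
  fix p :: "'h \<Rightarrow>\<^sub>L 'h" and f :: "'x \<Rightarrow> 'h"
  assume "(\<lambda>x. (norm (f x))\<^sup>2) summable_on UNIV"
  hence "(\<lambda>x. (norm p)\<^sup>2 * (norm (f x))\<^sup>2) summable_on UNIV"
    by (rule summable_on_cmult_right)
  thus "(\<lambda>x. (norm (p (f x)))\<^sup>2) summable_on UNIV"
    by (rule summable_on_comparison_test)
      (auto simp: power_mult_distrib[symmetric] intro: power_mono norm_blinfun)
qed

text \<open>This is \<open>1 \<otimes> p\<close> under the identification of the space with the
  tensor product of scalar sequences and the fibre.\<close>

definition amp :: "('h \<Rightarrow>\<^sub>L 'h) \<Rightarrow> ('x, 'h::real_normed_vector) ell2 \<Rightarrow>\<^sub>L ('x, 'h) ell2"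
  where "amp p = Blinfun (ell2_map p)"

lemma amp_apply [simp]: "ell2_apply (amp p f) x = p (ell2_apply f x)"
proof -
  have "bounded_linear (ell2_map p :: ('b, 'a) ell2 \<Rightarrow> ('b, 'a) ell2)"
  proof (rule bounded_linear_intro[where K = "norm p"])
    show "norm (ell2_map p f) \<le> norm f * norm p" for f :: "('b, 'a) ell2"
      using ell2_norm_le[of "ell2_map p f" "norm p" f] norm_blinfun[of p]
      by (simp add: ell2_map.rep_eq mult.commute)
  qed (auto intro!: ell2_eqI simp: ell2_simps ell2_map.rep_eq blinfun.add_right blinfun.scaleR_right)
  thus ?thesis by (simp add: amp_def bounded_linear_Blinfun_apply ell2_map.rep_eq)
qed

lemma norm_amp_apply_le:
  "(\<And>h. norm (blinfun_apply p h) \<le> c * norm h) \<Longrightarrow> c \<ge> 0 \<Longrightarrow> norm (amp p f) \<le> c * norm f"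
  by (rule ell2_norm_le) auto

lemma amp_single [simp]: "amp p (ell2_single x h) = ell2_single x (p h)"
  by (rule ell2_eqI) (simp add: blinfun.zero_right)

lemma amp_id: "amp id_blinfun = id_blinfun"
  by (auto intro!: blinfun_eqI ell2_eqI)

lemma amp_restrict: "amp p (ell2_restrict B f) = ell2_restrict B (amp p f)"
  by (auto intro!: ell2_eqI simp: blinfun.zero_right)

lemma clinear_amp: "clinear_op p \<Longrightarrow> clinear_op (amp p)"
  by (auto simp: clinear_op_def ell2_simps intro!: ell2_eqI)

lemma cinner_amp:
  assumes "\<And>u v. cinner (blinfun_apply p u) v = cinner u (blinfun_apply q v)"
  shows "cinner (amp p f) g = cinner f (amp q g)"
proof (rule has_sum_unique[OF cinner_ell2_has_sum])
  show "((\<lambda>x. cinner (ell2_apply (amp p f) x) (ell2_apply g x)) has_sum cinner f (amp q g)) UNIV"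
    using cinner_ell2_has_sum[of f "amp q g"] assms by simp
qed

section \<open>Quasi-local operators\<close>

definition separated :: "real \<Rightarrow> ('x::metric_space, 'h::chilbert_space) ell2 \<Rightarrow> ('x, 'h) ell2 \<Rightarrow> bool"
  where "separated s u v \<longleftrightarrow>
    (\<forall>x y. ell2_apply u x \<noteq> 0 \<longrightarrow> ell2_apply v y \<noteq> 0 \<longrightarrow> s \<le> dist x y)"

text \<open>Tested on vectors, this says that compressing \<open>T\<close> between two sets at
  distance at least \<open>s\<close> gives norm at most \<open>e\<close>. The form with inner
  products suits the gliding hump, where series of operators converge only weakly.\<close>

definition quasi_local ::
    "(('x::metric_space, 'h::chilbert_space) ell2 \<Rightarrow>\<^sub>L ('x, 'h) ell2) \<Rightarrow> bool"
  where "quasi_local T \<longleftrightarrow> (\<forall>e>0. \<exists>s. \<forall>u v. norm u \<le> 1 \<longrightarrow> norm v \<le> 1 \<longrightarrow> separated s u v \<longrightarrow>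
    cmod (cinner (T v) u) \<le> e)"

lemma separated_mono: "separated s u v \<Longrightarrow> t \<le> s \<Longrightarrow> separated t u v"
  unfolding separated_def by force

lemma separated_restrict:
  "(\<And>x y. x \<in> A \<Longrightarrow> y \<in> B \<Longrightarrow> s \<le> dist x y) \<Longrightarrow>
    separated s (ell2_restrict A u) (ell2_restrict B v)"
  by (auto simp: separated_def)

lemma finite_propagationE:
  assumes "finite_propagation T"
  obtains R where "\<And>x y. R < dist x y \<Longrightarrow> matrix_entry T x y = 0"
proof -
  obtain R where "\<And>x y. matrix_entry T x y \<noteq> 0 \<Longrightarrow> dist x y \<le> R"
    using assms unfolding finite_propagation_def bdd_above_def by blast
  thus ?thesis using that by (metis not_less)
qed

lemma finite_propagationI:
  "(\<And>x y. matrix_entry T x y \<noteq> 0 \<Longrightarrow> dist x y \<le> R) \<Longrightarrow> finite_propagation T"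
  unfolding finite_propagation_def bdd_above_def by blast

lemma finite_propagation_quasi_local:
  assumes "finite_propagation T"
  shows "quasi_local T"
proof -
  obtain R where R: "\<And>x y. R < dist x y \<Longrightarrow> matrix_entry T x y = 0"
    using finite_propagationE[OF assms] by metis
  \<comment> \<open>Entries at distance exactly \<open>R\<close> may survive, hence the separation
    \<open>R + 1\<close>.\<close>
  have "cinner (T v) u = 0" if "separated (R + 1) u v" for u v
  proof (rule has_sum_unique[OF cinner_ell2_has_sum])
    have "cinner (ell2_apply (T v) x) (ell2_apply u x) = 0" for x
    proof (cases "ell2_apply u x = 0")
      case False
      have "ell2_apply (T v) x = 0"
      proof (rule has_sum_unique[OF operator_has_sum])
        have "matrix_entry T x y (ell2_apply v y) = 0" for y
          using that False R[of x y] by (cases "ell2_apply v y = 0")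
            (fastforce simp: separated_def blinfun.zero_right ell2_simps simp del: matrix_entry_apply)+
        thus "((\<lambda>y. matrix_entry T x y (ell2_apply v y)) has_sum 0) UNIV" by (simp add: has_sum_0)
      qed
      thus ?thesis by (simp add: cinner.zero_left)
    qed (simp add: cinner.zero_right)
    thus "((\<lambda>x. cinner (ell2_apply (T v) x) (ell2_apply u x)) has_sum 0) UNIV"
      by (simp add: has_sum_0)
  qed
  thus ?thesis
    unfolding quasi_local_def by (intro allI impI exI[of _ "R + 1"]) simp
qed

lemma quasi_local_closure:
  assumes "T \<in> closure S" and "\<And>T. T \<in> S \<Longrightarrow> quasi_local T"
  shows "quasi_local T"
  unfolding quasi_local_def
proof (intro allI impI)
  fix e :: real assume e: "e > 0"
  obtain T' where T': "T' \<in> S" "norm (T - T') < e / 2"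
    using assms(1) e unfolding closure_approachable by (metis dist_norm half_gt_zero norm_minus_commute)
  then obtain s where s: "\<And>u v. norm u \<le> 1 \<Longrightarrow> norm v \<le> 1 \<Longrightarrow> separated s u v \<Longrightarrow>
      cmod (cinner (T' v) u) \<le> e / 2"
    using assms(2)[OF T'(1)] e unfolding quasi_local_def by (meson half_gt_zero)
  have "cmod (cinner (T v) u) \<le> e" if uv: "norm u \<le> 1" "norm v \<le> 1" "separated s u v" for u v
  proof -
    have "norm ((T - T') v) \<le> e / 2 * 1"
      by (rule order_trans[OF norm_blinfun mult_mono]) (use T' uv e in auto)
    hence "cmod (cinner ((T - T') v) u) \<le> e / 2 * 1"
      by (intro order_trans[OF norm_cinner_le mult_mono]) (use uv e in auto)
    moreover have "cinner (T v) u = cinner ((T - T') v) u + cinner (T' v) u"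
      by (simp add: blinfun.diff_left cinner_diff_left)
    ultimately show ?thesis
      using s[OF uv] norm_triangle_ineq[of "cinner ((T - T') v) u" "cinner (T' v) u"] by simp
  qed
  thus "\<exists>s. \<forall>u v. norm u \<le> 1 \<longrightarrow> norm v \<le> 1 \<longrightarrow> separated s u v \<longrightarrow> cmod (cinner (T v) u) \<le> e"
    by blast
qed

section \<open>A gliding hump\<close>

text \<open>The first argument of \<open>Q\<close> is the position in the subsequence, for
  tolerances that shrink with the position. The next index only has to satisfy finitely many
  eventual conditions, one for each index up to the current one.\<close>

lemma eventually_subsequence:
  fixes Q :: "nat \<Rightarrow> nat \<Rightarrow> nat \<Rightarrow> bool"
  assumes "\<And>n i. \<forall>\<^sub>F m in sequentially. Q n i m"
  obtains k :: "nat \<Rightarrow> nat" where "strict_mono k" "\<And>i j. i < j \<Longrightarrow> Q j (k i) (k j)"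
proof -
  have "\<exists>k. \<forall>n. True \<and> (k n < k (Suc n) \<and> (\<forall>i\<le>k n. Q (Suc n) i (k (Suc n))))"
  proof (rule dependent_nat_choice)
    fix x n :: nat
    have "\<forall>\<^sub>F m in sequentially. \<forall>i\<in>{..x}. Q (Suc n) i m"
      using assms by (intro eventually_ball_finite) auto
    hence "\<forall>\<^sub>F m in sequentially. x < m \<and> (\<forall>i\<in>{..x}. Q (Suc n) i m)"
      using eventually_gt_at_top by (rule eventually_conj[rotated])
    then obtain m where "x < m \<and> (\<forall>i\<in>{..x}. Q (Suc n) i m)"
      using eventually_happens trivial_limit_sequentially by blast
    thus "\<exists>y. True \<and> x < y \<and> (\<forall>i\<le>x. Q (Suc n) i y)" by auto
  qed simp
  then obtain k where k: "\<And>n. k n < k (Suc n)" "\<And>n i. i \<le> k n \<Longrightarrow> Q (Suc n) i (k (Suc n))" by metis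
  have "strict_mono k" using k(1) by (simp add: strict_mono_Suc_iff)
  moreover have "Q j (k i) (k j)" if "i < j" for i j
    using k(2)[of "k i" "j - 1"] that \<open>strict_mono k\<close>
    by (cases j) (auto simp: strict_mono_less_eq)
  ultimately show ?thesis by (rule that)
qed

text \<open>Pairing \<open>T i\<close> with \<open>u m\<close>, \<open>v m\<close> tends to 0 in
  \<open>m\<close> because \<open>T i\<close> is quasi-local, and pairing \<open>T m\<close> with
  \<open>u i\<close>, \<open>v i\<close> tends to 0 because the series converges. Along a sparse
  subsequence the diagonal pairings therefore dominate the sum \<open>S\<close>, which stays large
  on ever more separated vectors and so is not quasi-local.\<close>

lemma gliding_hump:
  fixes T :: "nat \<Rightarrow> (('x::metric_space, 'h::chilbert_space) ell2_op)"
  assumes ql: "\<And>n. quasi_local (T n)"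
    and sub: "\<And>k. strict_mono k \<Longrightarrow> \<exists>S. quasi_local S \<and>
      (\<forall>u v. (\<lambda>n. cinner (T (k n) v) u) sums cinner (blinfun_apply S v) u)"
    and u: "\<And>n. norm (u n) \<le> 1" and v: "\<And>n. norm (v n) \<le> 1"
    and sep: "\<And>n. separated (real n) (u n) (v n)"
    and d: "d > 0" "\<And>n. d \<le> cmod (cinner (T n (v n)) (u n))"
  shows False
proof -
  \<comment> \<open>With tolerance \<open>d / 2 ^ (n + 3)\<close> the off-diagonal terms add up to
    at most \<open>d / 4\<close>, which leaves \<open>3 * d / 4\<close>, more than the
    \<open>d / 2\<close> used for the contradiction.\<close>
  define Q where "Q n i m \<longleftrightarrow> cmod (cinner (T i (v m)) (u m)) \<le> d / 2 ^ (n + 3) \<and>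
    cmod (cinner (T m (v i)) (u i)) \<le> d / 2 ^ (n + 3)" for n i m
  have "\<forall>\<^sub>F m in sequentially. Q n i m" for n i
    unfolding Q_def
  proof (rule eventually_conj)
    have e: "d / 2 ^ (n + 3) > 0" using d by simp
    then obtain s where "\<And>u v. norm u \<le> 1 \<Longrightarrow> norm v \<le> 1 \<Longrightarrow> separated s u v \<Longrightarrow>
        cmod (cinner (T i v) u) \<le> d / 2 ^ (n + 3)"
      using ql[of i] unfolding quasi_local_def by meson
    hence "cmod (cinner (T i (v m)) (u m)) \<le> d / 2 ^ (n + 3)" if "real m \<ge> s" for m
      using separated_mono[OF sep that] u v by blast
    thus "\<forall>\<^sub>F m in sequentially. cmod (cinner (T i (v m)) (u m)) \<le> d / 2 ^ (n + 3)"
      using eventually_ge_at_top[of "nat \<lceil>s\<rceil>"] by (rule eventually_mono[rotated]) linarith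
    \<comment> \<open>The whole sequence is one of the admissible subsequences, and the terms of a
      convergent series tend to 0.\<close>
    obtain S where "(\<lambda>m. cinner (T m (v i)) (u i)) sums cinner (blinfun_apply S (v i)) (u i)"
      using sub[of id] by (auto simp: strict_mono_id)
    hence "(\<lambda>m. cinner (T m (v i)) (u i)) \<longlonglongrightarrow> 0"
      using sums_summable summable_LIMSEQ_zero by blast
    hence "\<forall>\<^sub>F m in sequentially. dist (cinner (T m (v i)) (u i)) 0 < d / 2 ^ (n + 3)"
      using e by (rule tendstoD)
    thus "\<forall>\<^sub>F m in sequentially. cmod (cinner (T m (v i)) (u i)) \<le> d / 2 ^ (n + 3)"
      by (rule eventually_mono) simp
  qed
  then obtain k where k: "strict_mono k" "\<And>i j. i < j \<Longrightarrow> Q j (k i) (k j)"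
    using eventually_subsequence[of Q] by metis
  obtain S where S: "quasi_local S"
    "\<And>u v. (\<lambda>n. cinner (T (k n) v) u) sums cinner (blinfun_apply S v) u"
    using sub[OF k(1)] by blast
  have large: "3 * d / 4 \<le> cmod (cinner (S (v (k j))) (u (k j)))" for j
  proof -
    define g where "g n = cinner (T (k n) (v (k j))) (u (k j))" for n
    define h where "h n = g n - (if n = j then g n else 0)" for n
    have h: "h sums (cinner (S (v (k j))) (u (k j)) - g j)"
      unfolding h_def by (intro sums_diff sums_single) (simp add: g_def S)
    have "cmod (h n) \<le> d / 8 * (1 / 2) ^ n" for n
    proof (cases n j rule: linorder_cases)
      case less
      have "cmod (h n) \<le> d / 2 ^ (j + 3)" using k(2)[OF less] less by (simp add: h_def g_def Q_def)
      also have "\<dots> \<le> d / 2 ^ (n + 3)"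
        using less d by (intro divide_left_mono power_increasing) auto
      finally show ?thesis by (simp add: power_add power_divide mult.commute)
    next
      case greater
      have "cmod (h n) \<le> d / 2 ^ (n + 3)" using k(2)[OF greater] greater by (simp add: h_def g_def Q_def)
      thus ?thesis by (simp add: power_add power_divide mult.commute)
    qed (use d in \<open>simp add: h_def\<close>)
    moreover have geo: "(\<lambda>n. d / 8 * (1 / 2) ^ n) sums (d / 8 * 2)"
      using sums_mult[OF geometric_sums[of "1 / 2 :: real"], of "d / 8"] by simp
    ultimately have "cmod (suminf h) \<le> (\<Sum>n. d / 8 * (1 / 2) ^ n)"
      by (intro norm_suminf_le) (auto simp: sums_iff)
    hence "cmod (cinner (S (v (k j))) (u (k j)) - g j) \<le> d / 4"
      using sums_unique[OF h] sums_unique[OF geo] by simp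
    moreover have "d \<le> cmod (g j)" using d(2)[of "k j"] by (simp add: g_def)
    ultimately show ?thesis
      using norm_triangle_ineq2[of "g j" "cinner (S (v (k j))) (u (k j))"]
      by (simp add: norm_minus_commute)
  qed
  obtain s where s: "\<And>u v. norm u \<le> 1 \<Longrightarrow> norm v \<le> 1 \<Longrightarrow> separated s u v \<Longrightarrow>
      cmod (cinner (S v) u) \<le> d / 2"
    using S(1) d unfolding quasi_local_def by (meson half_gt_zero)
  define j where "j = nat \<lceil>s\<rceil>"
  have "s \<le> real j" by (simp add: j_def) linarith
  also have "\<dots> \<le> real (k j)" using strict_mono_imp_increasing[OF k(1)] by simp
  finally have "cmod (cinner (S (v (k j))) (u (k j))) \<le> d / 2"
    using s u v separated_mono[OF sep] by blast
  thus False using large[of j] d(1) by simp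
qed

section \<open>Isomorphisms are implemented by unitaries\<close>

text \<open>Keeping the adjoint inverse \<open>V\<close> as a second argument makes the notion
  symmetric, so that results for \<open>U\<close> apply to \<open>V\<close> with the spaces
  exchanged.\<close>

definition unitary_pair :: "('a::chilbert_space \<Rightarrow>\<^sub>L 'b::chilbert_space) \<Rightarrow> ('b \<Rightarrow>\<^sub>L 'a) \<Rightarrow> bool"
  where "unitary_pair U V \<longleftrightarrow> clinear_op U \<and> clinear_op V \<and>
    (\<forall>x y. cinner (blinfun_apply U x) y = cinner x (blinfun_apply V y)) \<and>
    (\<forall>y. U (V y) = y) \<and> (\<forall>x. V (U x) = x)"

lemma unitary_pair_sym: "unitary_pair U V \<Longrightarrow> unitary_pair V U"
  unfolding unitary_pair_def by (metis cinner_commute)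

lemma norm_unitary: "unitary_pair U V \<Longrightarrow> norm (U x) = norm x"
  unfolding unitary_pair_def norm_eq_sqrt_cinner by metis

text \<open>The algebra sees vectors through rank-one operators. With \<open>e'\<close> a unit
  vector in the range of the image of \<open>p = |e><e|\<close>, put
  \<open>f x = \<phi> (rank_one x e) e'\<close>. It is isometric because \<open>rank_one e y\<close>
  composed with \<open>rank_one x e\<close> is \<open>cinner x y\<close> times \<open>p\<close>, and
  it intertwines because \<open>T\<close> composed with \<open>rank_one x e\<close> is
  \<open>rank_one (T x) e\<close>.\<close>

lemma star_isomorphic_unitary:
  fixes A :: "('a::chilbert_space \<Rightarrow>\<^sub>L 'a) set" and B :: "('b::chilbert_space \<Rightarrow>\<^sub>L 'b) set"
  assumes iso: "star_isomorphic A B"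
    and rA: "\<And>u v. rank_one u v \<in> A" and rB: "\<And>u v. rank_one u v \<in> B"
    and cA: "\<And>T. T \<in> A \<Longrightarrow> clinear_op T" and cB: "\<And>T. T \<in> B \<Longrightarrow> clinear_op T"
    and e: "norm (e :: 'a) = 1"
  obtains U V where "unitary_pair U V" "\<And>T. T \<in> A \<Longrightarrow> U o\<^sub>L T o\<^sub>L V \<in> B"
    "\<And>S. S \<in> B \<Longrightarrow> V o\<^sub>L S o\<^sub>L U \<in> A"
proof -
  obtain \<phi> where bij: "bij_betw \<phi> A B"
    and add: "\<And>S T. S \<in> A \<Longrightarrow> T \<in> A \<Longrightarrow> \<phi> (S + T) = \<phi> S + \<phi> T"
    and scale: "\<And>a T. T \<in> A \<Longrightarrow> \<phi> (a *\<^sub>C T) = a *\<^sub>C \<phi> T"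
    and comp: "\<And>S T. S \<in> A \<Longrightarrow> T \<in> A \<Longrightarrow> \<phi> (S o\<^sub>L T) = \<phi> S o\<^sub>L \<phi> T"
    and star: "\<And>T. T \<in> A \<Longrightarrow> \<phi> (adj T) = adj (\<phi> T)"
    using iso unfolding star_isomorphic_def by blast
  have ee: "cinner e e = 1" using e by (simp add: cinner_self)
  define p where "p = rank_one e e"
  have pA: "p \<in> A" by (simp add: p_def rA)
  have \<phi>B: "T \<in> A \<Longrightarrow> \<phi> T \<in> B" for T using bij by (auto simp: bij_betw_def)
  have pp: "p o\<^sub>L p = p" by (simp add: p_def compose_rank_one clinear_rank_one ee)
  have "\<phi> p \<noteq> 0"
  proof
    assume "\<phi> p = 0"
    hence "\<phi> (0 *\<^sub>C p) = \<phi> p" using scale[OF pA, of 0] by simp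
    moreover have "0 *\<^sub>C p = rank_one 0 0" by (rule blinfun_eqI) simp
    ultimately have "rank_one 0 0 = p"
      using bij pA rA by (metis bij_betw_imp_inj_on inj_on_eq_iff)
    hence "p e = 0" by (metis rank_one_apply scaleC.zero_right)
    thus False using e by (auto simp: p_def ee)
  qed
  then obtain w where w: "\<phi> p w \<noteq> 0" by (metis blinfun_eqI blinfun.zero_left)
  define e' where "e' = (1 / norm (\<phi> p w)) *\<^sub>R \<phi> p w"
  have e': "norm e' = 1" "\<phi> p e' = e'"
    using w comp[OF pA pA] by (simp_all add: e'_def pp blinfun.scaleR_right flip: blinfun_apply_blinfun_compose)
  hence ee': "cinner e' e' = 1" by (simp add: cinner_self)
  define f where "f x = \<phi> (rank_one x e) e'" for x
  have f_cinner: "cinner (f x) (f y) = cinner x y" for x y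
  proof -
    have "rank_one e y o\<^sub>L rank_one x e = cinner x y *\<^sub>C p"
      by (rule blinfun_eqI) (simp add: p_def scaleC_blinfun.rep_eq cinner_scaleC_left scaleC_scaleC mult.commute)
    moreover have "\<phi> (rank_one e y) (f x) = \<phi> (rank_one e y o\<^sub>L rank_one x e) e'"
      by (simp add: f_def comp[OF rA rA])
    ultimately have "\<phi> (rank_one e y) (f x) = cinner x y *\<^sub>C e'"
      using scale[OF pA, of "cinner x y"] e' by (simp add: scaleC_blinfun.rep_eq)
    moreover have "\<phi> (rank_one e y) = adj (\<phi> (rank_one y e))"
      using star[OF rA, of y e] by (simp add: adj_rank_one)
    ultimately show ?thesis
      using cinner_adj'[OF cB[OF \<phi>B[OF rA]], of "f x" y e e']
      by (simp add: f_def[of y] cinner_scaleC_left ee')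
  qed
  have f_intertwine: "f (T x) = \<phi> T (f x)" if "T \<in> A" for T x
    using comp[OF that rA, of x e]
    by (simp add: f_def compose_rank_one[OF cA[OF that], symmetric] flip: blinfun_apply_blinfun_compose)
  have f_add: "f (x + y) = f x + f y" for x y
  proof -
    have "rank_one (x + y) e = rank_one x e + rank_one y e"
      by (rule blinfun_eqI) (simp add: blinfun.add_left scaleC_add_right)
    thus ?thesis using add[OF rA rA] by (simp add: f_def blinfun.add_left)
  qed
  have f_scale: "f (a *\<^sub>C x) = a *\<^sub>C f x" for a x
  proof -
    have "rank_one (a *\<^sub>C x) e = a *\<^sub>C rank_one x e"
      by (rule blinfun_eqI) (simp add: scaleC_blinfun.rep_eq scaleC_scaleC mult.commute)
    thus ?thesis using scale[OF rA] by (simp add: f_def scaleC_blinfun.rep_eq)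
  qed
  \<comment> \<open>The preimage \<open>S\<close> of \<open>rank_one y e'\<close> gives
    \<open>f (S e) = \<phi> S (f e) = \<phi> S e' = y\<close>.\<close>
  have f_surj: "\<exists>x. f x = y" for y
  proof -
    obtain S where S: "S \<in> A" "\<phi> S = rank_one y e'"
      using rB bij unfolding bij_betw_def by (metis imageE)
    have "f (S e) = \<phi> S (f e)" by (rule f_intertwine[OF S(1)])
    also have "f e = e'" using e' by (simp add: f_def p_def)
    finally show ?thesis by (auto simp: S ee' intro: exI[of _ "S e"])
  qed
  have "bounded_linear f"
  proof (rule bounded_linear_intro[where K = 1])
    show "norm (f x) \<le> norm x * 1" for x by (simp add: norm_eq_sqrt_cinner f_cinner)
  qed (simp_all add: f_add f_scale scaleR_scaleC)
  define U where "U = Blinfun f"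
  have U: "U x = f x" for x using \<open>bounded_linear f\<close> by (simp add: U_def bounded_linear_Blinfun_apply)
  have cU: "clinear_op U" by (simp add: clinear_op_def U f_scale)
  define V where "V = adj U"
  have UV: "cinner (U x) y = cinner x (V y)" for x y unfolding V_def by (rule cinner_adj[OF cU])
  have VU: "V (U x) = x" for x
    by (rule cinner_eqI) (metis UV U f_cinner)
  have UV': "U (V y) = y" for y using f_surj[of y] VU by (metis U)
  have cV: "clinear_op V"
    unfolding clinear_op_def by (metis VU UV' clinear_opD[OF cU])
  have eq: "U o\<^sub>L T o\<^sub>L V = \<phi> T" if "T \<in> A" for T
    by (rule blinfun_eqI) (metis U UV' f_intertwine[OF that] blinfun_apply_blinfun_compose)
  show ?thesis
  proof (rule that)
    show "unitary_pair U V" unfolding unitary_pair_def using cU cV UV VU UV' by blast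
    show "U o\<^sub>L T o\<^sub>L V \<in> B" if "T \<in> A" for T using eq[OF that] \<phi>B[OF that] by simp
    show "V o\<^sub>L S o\<^sub>L U \<in> A" if S: "S \<in> B" for S
    proof -
      obtain T where T: "T \<in> A" "\<phi> T = S" using S bij unfolding bij_betw_def by blast
      have "V o\<^sub>L S o\<^sub>L U = T"
        using eq[OF T(1)] T(2) by (intro blinfun_eqI) (metis VU blinfun_apply_blinfun_compose)
      thus ?thesis using T by simp
    qed
  qed
qed

section \<open>Roe-type algebras\<close>

text \<open>Both algebras of the theorem are closures of a set of the following form: the Roe algebra
  for \<open>\<P> = {1}\<close>, and the stabilised uniform Roe algebra for \<open>\<P>\<close> the projections onto the spans
  of the initial segments of an orthonormal basis.\<close>

definition roe_core :: "('h::chilbert_space \<Rightarrow>\<^sub>L 'h) set \<Rightarrow>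
    ('x::metric_space, 'h) ell2_op set"
  where "roe_core \<P> = {T. clinear_op T \<and> finite_propagation T \<and> locally_compact_op T \<and>
    (\<exists>p\<in>\<P>. amp p o\<^sub>L T o\<^sub>L amp p = T)}"

lemma matrix_entry_amp: "matrix_entry (amp q) x y = (if x = y then q else 0)"
  by (rule blinfun_eqI) simp

lemma matrix_entry_add: "matrix_entry (S + T) x y = matrix_entry S x y + matrix_entry T x y"
  by (rule blinfun_eqI) (simp add: blinfun.add_left ell2_simps)

lemma matrix_entry_scaleC: "matrix_entry (a *\<^sub>C T) x y = a *\<^sub>C matrix_entry T x y"
  by (rule blinfun_eqI) (simp add: scaleC_blinfun.rep_eq ell2_simps)

lemma clinear_matrix_entry: "clinear_op T \<Longrightarrow> clinear_op (matrix_entry T x y)"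
  unfolding matrix_entry_def by (intro clinear_op_compose clinear_ell2_coord clinear_ell2_single)

lemma finite_propagation_add:
  assumes "finite_propagation S" "finite_propagation T"
  shows "finite_propagation (S + T)"
proof -
  obtain R R' where R: "\<And>x y. R < dist x y \<Longrightarrow> matrix_entry S x y = 0"
    "\<And>x y. R' < dist x y \<Longrightarrow> matrix_entry T x y = 0"
    using finite_propagationE[OF assms(1)] finite_propagationE[OF assms(2)] by metis
  show ?thesis
  proof (rule finite_propagationI)
    fix x y assume "matrix_entry (S + T) x y \<noteq> 0"
    hence "\<not> (R < dist x y \<and> R' < dist x y)" using R by (auto simp: matrix_entry_add simp del: matrix_entry_apply)
    thus "dist x y \<le> max R R'" by auto
  qed
qed

lemma compact_op_scaleC: "compact_op (a *\<^sub>C T)" if "compact_op T"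
  for T :: "'a::chilbert_space \<Rightarrow>\<^sub>L 'b::chilbert_space"
proof -
  have "bounded_linear (\<lambda>x :: 'b. a *\<^sub>C x)" by (rule scaleC.bounded_linear_right)
  hence "a *\<^sub>C T = Blinfun (\<lambda>x. a *\<^sub>C x) o\<^sub>L T"
    by (auto intro!: blinfun_eqI simp: bounded_linear_Blinfun_apply scaleC_blinfun.rep_eq)
  thus ?thesis using compact_op_compose_left[OF that] by simp
qed

lemma weakly_null_operator:
  assumes "(\<And>w. (\<lambda>n. cinner (v n) w) \<longlonglongrightarrow> 0)"
  shows "(\<lambda>n. cinner (ell2_apply (v n) x) h) \<longlonglongrightarrow> 0"
  using assms[of "ell2_single x h"] by (simp add: cinner_ell2_single)

text \<open>An upward directed family of orthogonal projections converging strongly to the identity,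
  where \<open>directed\<close> expresses inclusion of ranges. Both the singleton of the identity
  and an increasing sequence of finite-rank projections are instances.\<close>

locale exhausting_projections =
  fixes \<P> :: "('h::chilbert_space \<Rightarrow>\<^sub>L 'h) set"
  assumes clinear_proj: "p \<in> \<P> \<Longrightarrow> clinear_op p"
    and proj_sym: "p \<in> \<P> \<Longrightarrow> cinner (blinfun_apply p u) v = cinner u (blinfun_apply p v)"
    and proj_idem: "p \<in> \<P> \<Longrightarrow> blinfun_apply p (blinfun_apply p v) = blinfun_apply p v"
    and directed: "p \<in> \<P> \<Longrightarrow> q \<in> \<P> \<Longrightarrow>
      \<exists>r\<in>\<P>. (\<forall>v. blinfun_apply r (p v) = p v) \<and> (\<forall>v. blinfun_apply r (q v) = q v)"
    and dense: "0 < \<epsilon> \<Longrightarrow> \<exists>p\<in>\<P>. norm (blinfun_apply p v - v) < \<epsilon>"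
begin

abbreviation core :: "('x::metric_space, 'h) ell2_op set"
  where "core \<equiv> roe_core \<P>"

text \<open>The adjoint of the equation \<open>r p = p\<close>.\<close>

lemma absorb_right:
  assumes "p \<in> \<P>" "r \<in> \<P>" "\<And>v. blinfun_apply r (p v) = p v"
  shows "p (r v) = p v"
  by (rule cinner_eqI) (metis assms proj_sym)

lemma proj_norm_square:
  assumes "p \<in> \<P>"
  shows "(norm v)\<^sup>2 = (norm (p v))\<^sup>2 + (norm (v - p v))\<^sup>2"
proof -
  have "cinner (p v) (v - p v) = 0"
    by (simp add: proj_sym[OF assms] blinfun.diff_right proj_idem[OF assms] cinner.zero_right)
  thus ?thesis using norm_add_square[of "p v" "v - p v"] by simp
qed

lemma norm_proj_le: "p \<in> \<P> \<Longrightarrow> norm (p v) \<le> norm v"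
  and norm_coproj_le: "p \<in> \<P> \<Longrightarrow> norm (v - p v) \<le> norm v"
  using proj_norm_square[of p v] by (simp_all add: power2_le_imp_le)

lemma norm_amp_le: "p \<in> \<P> \<Longrightarrow> norm (amp p f) \<le> norm f"
  using norm_amp_apply_le[of p 1 f] norm_proj_le by simp

text \<open>Enlarging a projection does not worsen an approximation: if \<open>r\<close> absorbs
  \<open>s\<close>, then \<open>v - r v\<close> is the image of \<open>v - s v\<close> under the
  projection complementary to \<open>r\<close>.\<close>

lemma dense_finite:
  assumes "finite V" "e > 0"
  shows "\<exists>p\<in>\<P>. \<forall>v\<in>V. norm (blinfun_apply p v - v) < e"
  using assms(1)
proof (induction V rule: finite_induct)
  case empty
  thus ?case using dense[OF \<open>e > 0\<close>] by auto
next
  case (insert w V)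
  obtain p where p: "p \<in> \<P>" "\<forall>v\<in>V. norm (p v - v) < e" using insert by blast
  obtain q where q: "q \<in> \<P>" "norm (q w - w) < e" using dense[OF \<open>e > 0\<close>] by blast
  obtain r where r: "r \<in> \<P>" "\<And>v. r (p v) = p v" "\<And>v. r (q v) = q v"
    using directed[OF p(1) q(1)] by blast
  have "norm (r v - v) \<le> norm (s v - v)" if "\<And>v. r (blinfun_apply s v) = s v" for s v
    using norm_coproj_le[OF r(1), of "v - s v"] that
    by (simp add: blinfun.diff_right norm_minus_commute)
  thus ?case using p q r by (intro bexI[of _ r]) (auto intro: le_less_trans)
qed

lemma core_cutdown:
  fixes T :: "('x, 'h) ell2_op"
  assumes "amp p o\<^sub>L T o\<^sub>L amp p = T" "p \<in> \<P>" "r \<in> \<P>" "\<And>v. blinfun_apply r (p v) = p v"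
  shows "amp r o\<^sub>L T o\<^sub>L amp r = T"
proof -
  have "amp p (amp r v) = amp p v" "amp r (amp p v) = amp p v" for v :: "('x, 'h) ell2"
    using assms absorb_right[OF assms(2-4)] by (auto intro: ell2_eqI)
  thus ?thesis by (subst (1 2) assms(1)[symmetric]) (auto intro!: blinfun_eqI)
qed

lemma core_common:
  assumes "S \<in> core" "T \<in> core"
  obtains p where "p \<in> \<P>" "amp p o\<^sub>L S o\<^sub>L amp p = S" "amp p o\<^sub>L T o\<^sub>L amp p = T"
  using assms directed core_cutdown unfolding roe_core_def by (smt (verit) mem_Collect_eq)

lemma core_add:
  assumes "S \<in> core" "T \<in> core" shows "S + T \<in> core"
proof -
  obtain p where p: "p \<in> \<P>" "amp p o\<^sub>L S o\<^sub>L amp p = S" "amp p o\<^sub>L T o\<^sub>L amp p = T"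
    using core_common[OF assms] .
  have "amp p o\<^sub>L (S + T) o\<^sub>L amp p = (amp p o\<^sub>L S o\<^sub>L amp p) + (amp p o\<^sub>L T o\<^sub>L amp p)"
    by (rule blinfun_eqI) (simp add: blinfun.add_left blinfun.add_right)
  thus ?thesis
    using assms p unfolding roe_core_def locally_compact_op_def
    by (auto simp: clinear_op_add finite_propagation_add compact_op_add matrix_entry_add
        simp del: matrix_entry_apply)
qed

lemma core_scaleC:
  assumes "T \<in> core" shows "a *\<^sub>C T \<in> core"
proof -
  obtain p where p: "p \<in> \<P>" "amp p o\<^sub>L T o\<^sub>L amp p = T" using assms by (auto simp: roe_core_def)
  have "amp p o\<^sub>L (a *\<^sub>C T) o\<^sub>L amp p = a *\<^sub>C (amp p o\<^sub>L T o\<^sub>L amp p)"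
    by (rule blinfun_eqI)
      (simp add: scaleC_blinfun.rep_eq clinear_opD[OF clinear_amp[OF clinear_proj[OF p(1)]]])
  moreover have "finite_propagation (a *\<^sub>C T)"
  proof -
    obtain R where "\<And>x y. R < dist x y \<Longrightarrow> matrix_entry T x y = 0"
      using assms finite_propagationE unfolding roe_core_def by blast
    hence "R < dist x y \<Longrightarrow> matrix_entry (a *\<^sub>C T) x y = 0" for x y
      by (simp add: matrix_entry_scaleC cvec.scale_zero_right)
    thus ?thesis by (intro finite_propagationI[of _ R]) (meson not_less)
  qed
  ultimately show ?thesis
    using assms p unfolding roe_core_def locally_compact_op_def
    by (auto simp: clinear_op_scaleC compact_op_scaleC matrix_entry_scaleC)
qed

lemma clinear_closure_core: "T \<in> closure core \<Longrightarrow> clinear_op T"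
  using closure_minimal[OF _ closed_clinear_op, of core] by (auto simp: roe_core_def)

lemma quasi_local_closure_core: "T \<in> closure core \<Longrightarrow> quasi_local T"
  by (erule quasi_local_closure) (auto simp: roe_core_def finite_propagation_quasi_local)

lemma closure_core_approx:
  assumes "T \<in> closure core" "e > 0"
  obtains T' where "T' \<in> core" "norm (T - T') < e"
  using assms unfolding closure_approachable by (metis dist_norm norm_minus_commute)

text \<open>Disjointness of the supports of the \<open>a n\<close> leaves at most one summand in
  each row, so every matrix entry has rank at most one and is compact; \<open>near\<close> bounds
  the propagation, and the common \<open>p\<close> cuts down the whole series. Thus an infinite
  strong sum lies in the core itself.\<close>

lemma core_orthogonal_sum:
  fixes a b :: "nat \<Rightarrow> ('x::metric_space, 'h) ell2"
  assumes p: "p \<in> \<P>" and a: "\<And>n. amp p (a n) = a n" "\<And>n. norm (a n) \<le> 1"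
    and b: "\<And>n. amp p (b n) = b n" "\<And>n. norm (b n) \<le> 1"
    and disj: "\<And>i j z. i \<noteq> j \<Longrightarrow> ell2_apply (a i) z = 0 \<or> ell2_apply (a j) z = 0"
      "\<And>i j z. i \<noteq> j \<Longrightarrow> ell2_apply (b i) z = 0 \<or> ell2_apply (b j) z = 0"
    and near: "\<And>n y z. ell2_apply (a n) y \<noteq> 0 \<Longrightarrow> ell2_apply (b n) z \<noteq> 0 \<Longrightarrow> dist y z \<le> R"
  obtains T where "T \<in> core" "\<And>v. (\<lambda>n. cinner v (b n) *\<^sub>C a n) sums T v"
proof -
  have orth: "cinner (c i) (c j) = 0"
    if "i \<noteq> j" "\<And>z. ell2_apply (c i) z = 0 \<or> ell2_apply (c j) z = 0"
    for c :: "nat \<Rightarrow> ('x, 'h) ell2" and i j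
  proof (rule has_sum_unique[OF cinner_ell2_has_sum])
    have "cinner (ell2_apply (c i) z) (ell2_apply (c j) z) = 0" for z
      using that(2)[of z] by (auto simp: cinner.zero_left cinner.zero_right)
    thus "((\<lambda>z. cinner (ell2_apply (c i) z) (ell2_apply (c j) z)) has_sum 0) UNIV"
      by (simp add: has_sum_0)
  qed
  obtain T :: "('x, 'h) ell2_op"
    where cT: "clinear_op T" and T: "\<And>v. (\<lambda>n. cinner v (b n) *\<^sub>C a n) sums T v"
    by (rule orthogonal_sum_operator[of a b]) (use orth disj a b in auto)
  have entry: "\<exists>n. matrix_entry T y z = rank_one (ell2_apply (a n) y) (ell2_apply (b n) z)" for y z
  proof -
    \<comment> \<open>If all \<open>a m\<close> vanish at \<open>y\<close>, any \<open>n\<close>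
      will do and the entry is 0.\<close>
    obtain n where n: "\<And>m. m \<noteq> n \<Longrightarrow> ell2_apply (a m) y = 0" using disj(1) by metis
    have "matrix_entry T y z h = rank_one (ell2_apply (a n) y) (ell2_apply (b n) z) h" for h
    proof (rule sums_unique2)
      show "(\<lambda>m. cinner h (ell2_apply (b m) z) *\<^sub>C ell2_apply (a m) y) sums matrix_entry T y z h"
        using bounded_linear.sums[OF blinfun.bounded_linear_right[of "ell2_coord y"] T, of "ell2_single z h"]
        by (simp add: cinner_ell2_single' ell2_simps)
      have "(\<lambda>m. cinner h (ell2_apply (b m) z) *\<^sub>C ell2_apply (a m) y)
          = (\<lambda>m. if m = n then cinner h (ell2_apply (b m) z) *\<^sub>C ell2_apply (a m) y else 0)"
        using n by auto
      thus "(\<lambda>m. cinner h (ell2_apply (b m) z) *\<^sub>C ell2_apply (a m) y)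
          sums rank_one (ell2_apply (a n) y) (ell2_apply (b n) z) h"
        using sums_single[of n "\<lambda>m. cinner h (ell2_apply (b m) z) *\<^sub>C ell2_apply (a m) y"] by simp
    qed
    thus ?thesis by (metis blinfun_eqI)
  qed
  have "finite_propagation T"
  proof (rule finite_propagationI)
    fix y z assume nz: "matrix_entry T y z \<noteq> 0"
    obtain n where n: "matrix_entry T y z = rank_one (ell2_apply (a n) y) (ell2_apply (b n) z)"
      using entry by blast
    have "ell2_apply (a n) y \<noteq> 0" "ell2_apply (b n) z \<noteq> 0"
      using nz unfolding n by (auto intro!: blinfun_eqI simp: cinner.zero_right)
    thus "dist y z \<le> R" by (rule near)
  qed
  moreover have "locally_compact_op T"
    unfolding locally_compact_op_def using entry compact_op_rank_one by metis
  moreover have "amp p o\<^sub>L T o\<^sub>L amp p = T"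
  proof (rule blinfun_eqI, rule sums_unique2)
    fix v
    have "cinner (amp p v) (b n) = cinner v (b n)" for n
      using cinner_amp[OF proj_sym[OF p], of v "b n"] b(1) by simp
    thus "(\<lambda>n. cinner v (b n) *\<^sub>C a n) sums (amp p o\<^sub>L T o\<^sub>L amp p) v"
      using bounded_linear.sums[OF blinfun.bounded_linear_right[of "amp p"] T[of "amp p v"]]
      by (simp add: clinear_opD[OF clinear_amp[OF clinear_proj[OF p]]] a(1))
  qed (rule T)
  ultimately show ?thesis using that cT T p unfolding roe_core_def by blast
qed

lemma finite_support_dense:
  fixes u :: "('x, 'h) ell2"
  assumes e: "e > 0"
  obtains u' p F where "finite F" "p \<in> \<P>" "amp p u' = u'" "ell2_restrict F u' = u'"
    "norm (u - u') < e" "norm u' \<le> norm u"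
proof -
  obtain F where F: "finite F" "norm (u - ell2_restrict F u) < e / 2"
    using ell2_finite_approx[of "e / 2" u] e by auto
  \<comment> \<open>Chosen so that \<open>card F\<close> errors of size \<open>d\<close> stay below
    \<open>e / 2\<close>; the added 1 covers an empty \<open>F\<close>.\<close>
  define d where "d = e / (2 * (real (card F) + 1))"
  have d: "d > 0" using e by (simp add: d_def)
  obtain p where p: "p \<in> \<P>" "\<And>x. x \<in> F \<Longrightarrow> norm (p (ell2_apply u x) - ell2_apply u x) < d"
    using dense_finite[of "ell2_apply u ` F" d] F d by auto
  define u' where "u' = amp p (ell2_restrict F u)"
  have "ell2_restrict F u - u' = (\<Sum>x\<in>F. ell2_single x (ell2_apply u x - p (ell2_apply u x)))"
    using F(1) by (auto intro!: ell2_eqI simp: u'_def ell2_apply_sum ell2_simps blinfun.zero_right)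
  also have "norm \<dots> \<le> of_nat (card F) * d"
    by (rule sum_norm_bound) (use p in \<open>simp add: norm_minus_commute less_imp_le\<close>)
  also have "\<dots> < e / 2" using e by (simp add: d_def field_simps)
  finally have "norm (ell2_restrict F u - u') < e / 2" .
  hence "norm (u - u') < e" using F(2) norm_triangle_lt[of "u - ell2_restrict F u" "ell2_restrict F u - u'" e] by simp
  moreover have "norm u' \<le> norm u"
    unfolding u'_def by (rule order_trans[OF norm_amp_le[OF p(1)] norm_ell2_restrict_le])
  moreover have "amp p u' = u'" "ell2_restrict F u' = u'"
    by (auto intro!: ell2_eqI simp: u'_def proj_idem[OF p(1)] blinfun.zero_right)
  ultimately show ?thesis using that F(1) p(1) by blast
qed

lemma rank_one_core:
  fixes u v :: "('x::metric_space, 'h) ell2"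
  assumes "finite F" "finite G" "ell2_restrict F u = u" "ell2_restrict G v = v"
    and "p \<in> \<P>" "amp p u = u" "q \<in> \<P>" "amp q v = v"
  shows "rank_one u v \<in> core"
proof -
  have entry: "matrix_entry (rank_one u v) x y = rank_one (ell2_apply u x) (ell2_apply v y)" for x y
    by (rule blinfun_eqI) (simp add: cinner_ell2_single' ell2_simps)
  have fp: "finite_propagation (rank_one u v)"
  proof (rule finite_propagationI)
    fix x y assume "matrix_entry (rank_one u v) x y \<noteq> 0"
    hence "ell2_apply u x \<noteq> 0" "ell2_apply v y \<noteq> 0"
      unfolding entry by (auto intro!: blinfun_eqI simp: cinner.zero_right)
    hence "x \<in> F" "y \<in> G" using assms(3,4) by (metis ell2_restrict_apply)+
    thus "dist x y \<le> Max ((\<lambda>(x, y). dist x y) ` (F \<times> G))"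
      using assms(1,2) by (intro Max_ge) auto
  qed
  have lc: "locally_compact_op (rank_one u v)"
    unfolding locally_compact_op_def entry by (simp add: compact_op_rank_one)
  obtain r where r: "r \<in> \<P>" "\<And>v. r (p v) = p v" "\<And>v. r (q v) = q v"
    using directed[OF assms(5,7)] by blast
  have "amp r u = u" "amp r v = v"
    using r(2,3) assms(6,8) by (metis amp_apply ell2_eqI)+
  moreover from this have "cinner (amp r w) v = cinner w v" for w
    using cinner_amp[OF proj_sym[OF r(1)], of w v] by simp
  ultimately have "amp r o\<^sub>L rank_one u v o\<^sub>L amp r = rank_one u v"
    by (auto intro!: blinfun_eqI simp: clinear_opD[OF clinear_amp[OF clinear_proj[OF r(1)]]])
  thus ?thesis using fp lc r(1) clinear_rank_one unfolding roe_core_def by blast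
qed

text \<open>Makes \<open>star_isomorphic_unitary\<close> applicable to the algebras, and makes the
  single summands of the gliding hump quasi-local.\<close>

lemma rank_one_closure_core: "rank_one u v \<in> closure core"
  for u v :: "('x::metric_space, 'h) ell2"
  unfolding closure_approachable
proof (intro allI impI)
  fix e :: real assume e: "e > 0"
  define d where "d = e / (norm u + norm v + 1)"
  have d: "d > 0" using e by (simp add: d_def add_nonneg_pos)
  obtain u' p F where u': "finite F" "p \<in> \<P>" "amp p u' = u'" "ell2_restrict F u' = u'"
    "norm (u - u') < d" "norm u' \<le> norm u" using finite_support_dense[OF d] by metis
  obtain v' q G where v': "finite G" "q \<in> \<P>" "amp q v' = v'" "ell2_restrict G v' = v'"
    "norm (v - v') < d" using finite_support_dense[OF d] by metis
  have "norm (rank_one u v - rank_one u' v') \<le> norm (u - u') * norm v + norm u' * norm (v - v')"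
    unfolding rank_one_diff by (intro norm_triangle_le add_mono norm_rank_one_le)
  also have "\<dots> \<le> d * norm v + norm u * d"
    using u' v' d by (intro add_mono mult_mono) auto
  also have "\<dots> < e"
  proof -
    have "d * (norm u + norm v + 1) = e"
      using add_nonneg_pos[of "norm u + norm v" 1] by (simp add: d_def)
    thus ?thesis using d by (simp add: algebra_simps)
  qed
  finally show "\<exists>y\<in>core. dist y (rank_one u v) < e"
    using rank_one_core[OF u'(1) v'(1) u'(4) v'(4) u'(2,3) v'(2,3)]
    by (intro bexI[of _ "rank_one u' v'"]) (auto simp: dist_norm norm_minus_commute)
qed

text \<open>Provides one element of the core that fixes \<open>ell2_single x e\<close> for all
  \<open>x\<close> at once when \<open>e\<close> is a unit vector.\<close>

lemma amp_rank_one_core: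
  assumes "p \<in> \<P>" "p e = e"
  shows "amp (rank_one e e) \<in> core"
proof -
  have "amp p o\<^sub>L amp (rank_one e e) o\<^sub>L amp p = amp (rank_one e e)"
    using assms proj_sym[OF assms(1), of _ e]
    by (auto intro!: blinfun_eqI ell2_eqI simp: clinear_opD[OF clinear_proj[OF assms(1)]])
  moreover have "finite_propagation (amp (rank_one e e))"
    by (rule finite_propagationI[of _ 0]) (simp add: matrix_entry_amp split: if_splits)
  ultimately show ?thesis
    using assms clinear_amp[OF clinear_rank_one] unfolding roe_core_def locally_compact_op_def
    by (auto simp: matrix_entry_amp compact_op_rank_one compact_op_zero)
qed

text \<open>A finite propagation approximant has only finitely many entries in row \<open>x\<close>,
  each of them compact and hence sending weakly null sequences to norm null ones.\<close>

lemma closure_core_weakly_null: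
  fixes v :: "nat \<Rightarrow> ('x::metric_space, 'h) ell2"
  assumes fin: "\<And>x :: 'x. \<And>r. finite (cball x r)" and T: "T \<in> closure core"
    and v: "\<And>n. norm (v n) \<le> 1" "\<And>w. (\<lambda>n. cinner (v n) w) \<longlonglongrightarrow> 0"
  shows "(\<lambda>n. ell2_apply (T (v n)) x) \<longlonglongrightarrow> 0"
proof (rule LIMSEQ_I)
  fix e :: real assume e: "e > 0"
  obtain T' where T': "T' \<in> core" "norm (T - T') < e / 2"
    using closure_core_approx[OF T] e by (metis half_gt_zero)
  obtain R where R: "\<And>x y. R < dist x y \<Longrightarrow> matrix_entry T' x y = 0"
    using T'(1) finite_propagationE unfolding roe_core_def by blast
  have eq: "ell2_apply (T' w) x = (\<Sum>y\<in>cball x R. matrix_entry T' x y (ell2_apply w y))" for w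
    by (rule has_sum_unique[OF operator_has_sum], rule has_sum_finite_neutralI)
      (use R fin in \<open>auto simp: not_le simp del: matrix_entry_apply\<close>)
  have "(\<lambda>n. \<Sum>y\<in>cball x R. matrix_entry T' x y (ell2_apply (v n) y)) \<longlonglongrightarrow> (\<Sum>y\<in>cball x R. 0)"
  proof (intro tendsto_sum compact_op_weakly_null)
    show "compact_op (matrix_entry T' x y)" "clinear_op (matrix_entry T' x y)" for y
      using T'(1) clinear_matrix_entry by (auto simp: roe_core_def locally_compact_op_def simp del: matrix_entry_apply)
    show "norm (ell2_apply (v n) y) \<le> 1" for n y
      by (rule order_trans[OF norm_ell2_apply_le v(1)])
  qed (rule weakly_null_operator[OF v(2)])
  hence "(\<lambda>n. ell2_apply (T' (v n)) x) \<longlonglongrightarrow> 0" by (simp only: eq sum.neutral_const)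
  then obtain N where N: "\<And>n. n \<ge> N \<Longrightarrow> norm (ell2_apply (T' (v n)) x) < e / 2"
    using LIMSEQ_D[of _ 0 "e / 2"] e by auto
  have "norm (ell2_apply (T (v n)) x - 0) < e" if "n \<ge> N" for n
  proof -
    have "norm (ell2_apply ((T - T') (v n)) x) \<le> norm ((T - T') (v n))" by (rule norm_ell2_apply_le)
    also have "\<dots> \<le> e / 2 * 1"
      by (rule order_trans[OF norm_blinfun mult_mono]) (use T' v e in auto)
    finally have "norm (ell2_apply (T (v n)) x - ell2_apply (T' (v n)) x) \<le> e / 2"
      by (simp add: blinfun.diff_left ell2_simps)
    thus ?thesis using N[OF that] norm_triangle_sub[of "ell2_apply (T (v n)) x" "ell2_apply (T' (v n)) x"] by simp
  qed
  thus "\<exists>N. \<forall>n\<ge>N. norm (ell2_apply (T (v n)) x - 0) < e" by blast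
qed

end

section \<open>Rigidity\<close>

lemma ell2_apply_inj_tendsto_0:
  fixes g :: "('x, 'h::chilbert_space) ell2" and s :: "nat \<Rightarrow> 'x"
  assumes "inj s"
  shows "(\<lambda>n. ell2_apply g (s n)) \<longlonglongrightarrow> 0"
proof (rule LIMSEQ_I)
  fix e :: real assume "e > 0"
  then obtain F where F: "finite F" "norm (g - ell2_restrict F g) < e"
    using ell2_finite_approx by blast
  have "finite {n. s n \<in> F}" using finite_vimageI[OF F(1) assms] by (simp add: vimage_def)
  then obtain N where "\<forall>n\<in>{n. s n \<in> F}. n < N" by (metis finite_nat_set_iff_bounded)
  hence "s n \<notin> F" if "n \<ge> N" for n using that by (metis linorder_not_le mem_Collect_eq)
  hence "norm (ell2_apply g (s n) - 0) < e" if "n \<ge> N" for n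
    using norm_ell2_apply_le[of "g - ell2_restrict F g" "s n"] F(2) that by (simp add: ell2_simps)
  thus "\<exists>N. \<forall>n\<ge>N. norm (ell2_apply g (s n) - 0) < e" by blast
qed

lemma infinite_nat_real_ge:
  assumes "infinite S" obtains n where "n \<in> S" "t \<le> real n"
proof -
  obtain n where "n \<ge> nat \<lceil>t\<rceil>" "n \<in> S"
    using assms unfolding infinite_nat_iff_unbounded_le by blast
  thus ?thesis using that by (meson le_nat_iff nat_ceiling_le_eq)
qed

lemma cmod_cinner_restrict:
  "cmod (cinner u (ell2_restrict B u)) = (norm (ell2_restrict B u))\<^sup>2"
  "cmod (cinner (ell2_restrict B u) u) = (norm (ell2_restrict B u))\<^sup>2"
  by (simp_all add: cinner_ell2_restrict cinner_ell2_restrict_self norm_power)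

lemma finite_dist_bound:
  assumes "finite G"
  obtains N :: nat where "\<And>x y. x \<in> G \<Longrightarrow> y \<in> G \<Longrightarrow> dist x y < real N"
proof -
  have "bounded G" using assms by (rule finite_imp_bounded)
  then obtain e where "\<And>x y. x \<in> G \<Longrightarrow> y \<in> G \<Longrightarrow> dist x y \<le> e"
    unfolding bounded_two_points by blast
  thus ?thesis using that reals_Archimedean2[of e] by (metis le_less_trans)
qed

context exhausting_projections
begin

definition roe_unitary ::
    "(('x::metric_space, 'h) ell2 \<Rightarrow>\<^sub>L ('y::metric_space, 'h) ell2) \<Rightarrow>
      (('y, 'h) ell2 \<Rightarrow>\<^sub>L ('x, 'h) ell2) \<Rightarrow> bool"
  where "roe_unitary U V \<longleftrightarrow> unitary_pair U V \<and>
    (\<forall>T\<in>closure core. U o\<^sub>L T o\<^sub>L V \<in> closure core) \<and>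
    (\<forall>S\<in>closure core. V o\<^sub>L S o\<^sub>L U \<in> closure core)"

lemma roe_unitary_sym: "roe_unitary U V \<Longrightarrow> roe_unitary V U"
  unfolding roe_unitary_def using unitary_pair_sym by blast

lemma roe_unitaryD:
  assumes "roe_unitary U V"
  shows "unitary_pair U V" "clinear_op U" "cinner (U x) y = cinner x (V y)" "U (V y) = y" "V (U x) = x"
    "norm (U x) = norm x" "norm (V y) = norm y"
  using assms norm_unitary unitary_pair_sym unfolding roe_unitary_def unitary_pair_def by blast+

text \<open>The operators \<open>\<bar>a n\<rangle>\<langle>b n\<bar>\<close> sum up to an element of the
  algebra of \<open>X\<close>, along suitable subsequences, and so do their images, which must be quasi-local
  over \<open>Y\<close>.\<close>

lemma separated_images_contradiction:
  fixes x x' :: "nat \<Rightarrow> 'x::metric_space" and w w' :: "nat \<Rightarrow> ('y::metric_space, 'h) ell2"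
  assumes fin: "\<And>z :: 'x. \<And>r. finite (cball z r)" and UV: "roe_unitary U V"
    and fto: "\<And>z. finite {n. x n = z}" and near: "\<And>n. dist (x n) (x' n) \<le> R"
    and D: "D \<in> closure core" "D' \<in> closure core"
    and z: "\<And>n. norm (\<zeta> n) \<le> 1" "\<And>n. norm (\<zeta>' n) \<le> 1"
    and AB: "\<And>n. A n \<subseteq> cball (x n) r" "\<And>n. B n \<subseteq> cball (x' n) r"
    and w: "\<And>n. norm (w n) \<le> 1" "\<And>n. norm (w' n) \<le> 1"
    and sep: "\<And>n. separated (real n) (w n) (w' n)" and d: "d > 0"
    and large: "\<And>n. d \<le> cmod (cinner (blinfun_apply U (ell2_restrict (A n) (blinfun_apply D (\<zeta> n)))) (w n))"
      "\<And>n. d \<le> cmod (cinner (blinfun_apply U (ell2_restrict (B n) (blinfun_apply D' (\<zeta>' n)))) (w' n))"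
  shows False
proof -
  note U = roe_unitaryD[OF UV]
  \<comment> \<open>Replacing an algebra element by a nearby one costs at most half of the lower
    bound, uniformly in the test vectors.\<close>
  have half: "d / 2 \<le> cmod (cinner (U (ell2_restrict C (E0 z))) u)"
    if "norm (E - E0) < d / 2" "norm z \<le> 1" "norm u \<le> 1"
      "d \<le> cmod (cinner (U (ell2_restrict C (blinfun_apply E z))) u)"
    for C u z and E E0 :: "('x, 'h) ell2_op"
  proof -
    have "ell2_restrict C (E z) - ell2_restrict C (E0 z) = ell2_restrict C ((E - E0) z)"
      by (rule ell2_eqI) (auto simp: ell2_simps blinfun.diff_left)
    hence "norm (U (ell2_restrict C (E z)) - U (ell2_restrict C (E0 z))) \<le> norm ((E - E0) z)"
      by (metis blinfun.diff_right U(6) norm_ell2_restrict_le)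
    also have "\<dots> \<le> d / 2 * 1"
      by (rule order_trans[OF norm_blinfun mult_mono]) (use that d in auto)
    finally have "cmod (cinner (U (ell2_restrict C (E z)) - U (ell2_restrict C (E0 z))) u) \<le> d / 2 * 1"
      by (intro order_trans[OF norm_cinner_le mult_mono]) (use that d in auto)
    thus ?thesis
      using that(4) norm_triangle_ineq2[of "cinner (U (ell2_restrict C (E z))) u"
          "cinner (U (ell2_restrict C (E0 z))) u"] by (simp add: cinner_diff_left)
  qed
  \<comment> \<open>The ranges of \<open>D\<close> and \<open>D'\<close> need not lie in the range
    of a single \<open>amp p\<close>. Those of core approximants do, as
    \<open>core_orthogonal_sum\<close> requires.\<close>
  obtain D0 where D0: "D0 \<in> core" "norm (D - D0) < d / 2"
    using closure_core_approx[OF D(1)] d by (metis half_gt_zero)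
  obtain D0' where D0': "D0' \<in> core" "norm (D' - D0') < d / 2"
    using closure_core_approx[OF D(2)] d by (metis half_gt_zero)
  obtain p where p: "p \<in> \<P>" "amp p o\<^sub>L D0 o\<^sub>L amp p = D0" "amp p o\<^sub>L D0' o\<^sub>L amp p = D0'"
    using core_common[OF D0(1) D0'(1)] .
  \<comment> \<open>Dividing by \<open>M\<close> makes all cut-down vectors at most unit length; the
    added 1 keeps \<open>M\<close> positive.\<close>
  define M where "M = norm D0 + norm D0' + 1"
  have M: "M > 0" "norm D0 \<le> M" "norm D0' \<le> M" by (simp_all add: M_def add_nonneg_pos)
  define a where "a n = (1 / M) *\<^sub>R ell2_restrict (A n) (D0 (\<zeta> n))" for n
  define b where "b n = (1 / M) *\<^sub>R ell2_restrict (B n) (D0' (\<zeta>' n))" for n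
  have norm1: "norm ((1 / M) *\<^sub>R ell2_restrict C (E z)) \<le> 1"
    if "norm E \<le> M" "norm z \<le> 1" for C z and E :: "('x, 'h) ell2_op"
  proof -
    have "norm (ell2_restrict C (E z)) \<le> norm E * norm z"
      by (rule order_trans[OF norm_ell2_restrict_le norm_blinfun])
    also have "\<dots> \<le> M * 1" using that M by (intro mult_mono) auto
    finally show ?thesis using M by (simp add: field_simps)
  qed
  have na: "norm (a n) \<le> 1" and nb: "norm (b n) \<le> 1" for n
    unfolding a_def b_def using norm1 M z by auto
  have pfix: "amp p ((1 / M) *\<^sub>R ell2_restrict C (E z)) = (1 / M) *\<^sub>R ell2_restrict C (E z)"
    if "amp p o\<^sub>L E o\<^sub>L amp p = E" for C z and E :: "('x, 'h) ell2_op"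
  proof -
    have "amp p (E z) = E z"
      by (subst (1 2) that[symmetric]) (auto intro!: ell2_eqI simp: proj_idem[OF p(1)])
    thus ?thesis by (simp add: blinfun.scaleR_right amp_restrict)
  qed
  have pa: "amp p (a n) = a n" and pb: "amp p (b n) = b n" for n
    unfolding a_def b_def using pfix p by auto
  have la: "d / (2 * M) \<le> cmod (cinner (U (a n)) (w n))" for n
    using half[OF D0(2) z(1) w(1) large(1), of n] M
    by (simp add: a_def blinfun.scaleR_right cinner_scaleR_left norm_divide field_simps)
  have lb: "d / (2 * M) \<le> cmod (cinner (U (b n)) (w' n))" for n
    using half[OF D0'(2) z(2) w(2) large(2), of n] M
    by (simp add: b_def blinfun.scaleR_right cinner_scaleR_left norm_divide field_simps)
  define Q where "Q n i m \<longleftrightarrow> 2 * r < dist (x i) (x m) \<and> 2 * r < dist (x' i) (x' m)" for n i m :: nat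
  \<comment> \<open>The sequence takes each value finitely often and balls are finite, so it leaves
    every ball.\<close>
  have ev: "\<forall>\<^sub>F m in sequentially. t < dist y (x m)" for t y
  proof -
    have "{m. \<not> t < dist y (x m)} \<subseteq> (\<Union>z\<in>cball y t. {m. x m = z})" by auto
    hence "finite {m. \<not> t < dist y (x m)}" by (rule finite_subset) (simp add: fin fto)
    thus ?thesis by (simp add: eventually_cofinite flip: cofinite_eq_sequentially)
  qed
  have "\<forall>\<^sub>F m in sequentially. Q n i m" for n i
  proof -
    \<comment> \<open>The extra \<open>R\<close> pays for passing from \<open>x m\<close> to
      \<open>x' m\<close>.\<close>
    have "\<forall>\<^sub>F m in sequentially. 2 * r < dist (x i) (x m) \<and> 2 * r + R < dist (x' i) (x m)"
      using ev by (intro eventually_conj)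
    thus ?thesis
    proof (rule eventually_mono)
      fix m assume *: "2 * r < dist (x i) (x m) \<and> 2 * r + R < dist (x' i) (x m)"
      thus "Q n i m"
        using dist_triangle[of "x' i" "x m" "x' m"] near[of m] by (auto simp: Q_def dist_commute)
    qed
  qed
  then obtain k where k: "strict_mono k" "\<And>i j. i < j \<Longrightarrow> Q j (k i) (k j)"
    using eventually_subsequence[of Q] by metis
  have far: "2 * r < dist (x (k i)) (x (k j))" "2 * r < dist (x' (k i)) (x' (k j))" if "i \<noteq> j" for i j
    using that k(2)[of i j] k(2)[of j i] by (auto simp: Q_def dist_commute neq_iff)
  have a_supp: "dist (x n) y \<le> r" if "ell2_apply (a n) y \<noteq> 0" for n y
    using that AB(1)[of n] by (auto simp: a_def ell2_simps split: if_splits)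
  have b_supp: "dist (x' n) y \<le> r" if "ell2_apply (b n) y \<noteq> 0" for n y
    using that AB(2)[of n] by (auto simp: b_def ell2_simps split: if_splits)
  have disj: "ell2_apply (a (k i)) y = 0 \<or> ell2_apply (a (k j)) y = 0"
    "ell2_apply (b (k i)) y = 0 \<or> ell2_apply (b (k j)) y = 0" if "i \<noteq> j" for i j y
    using far[OF that] a_supp[of "k i" y] a_supp[of "k j" y] b_supp[of "k i" y] b_supp[of "k j" y]
      dist_triangle2[of "x (k i)" "x (k j)" y] dist_triangle2[of "x' (k i)" "x' (k j)" y]
    by argo+
  have near': "dist y z \<le> 2 * r + R" if "ell2_apply (a n) y \<noteq> 0" "ell2_apply (b n) z \<noteq> 0" for n y z
    using a_supp[OF that(1)] b_supp[OF that(2)] near[of n] dist_triangle[of y z "x n"]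
      dist_triangle[of "x n" z "x' n"] by (simp add: dist_commute)
  define T where "T n = rank_one (U (a (k n))) (U (b (k n)))" for n
  \<comment> \<open>The pairing factorises, so the two lower bounds multiply to the constant handed
    to \<open>gliding_hump\<close>.\<close>
  have T_eq: "cinner (T n v) u = cinner v (U (b (k n))) * cinner (U (a (k n))) u" for n u v
    by (simp add: T_def cinner_scaleC_left)
  show False
  proof (rule gliding_hump[of T "\<lambda>n. w (k n)" "\<lambda>n. w' (k n)" "(d / (2 * M)) * (d / (2 * M))"])
    show "quasi_local (T n)" for n
      unfolding T_def by (intro quasi_local_closure_core rank_one_closure_core)
    fix l :: "nat \<Rightarrow> nat" assume l: "strict_mono l"
    have inj: "i \<noteq> j \<Longrightarrow> l i \<noteq> l j" for i j using l by (simp add: strict_mono_eq)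
    obtain S0 where S0: "S0 \<in> core" "\<And>v. (\<lambda>n. cinner v (b (k (l n))) *\<^sub>C a (k (l n))) sums S0 v"
      using core_orthogonal_sum[of p "\<lambda>n. a (k (l n))" "\<lambda>n. b (k (l n))" "2 * r + R"]
        p(1) pa pb na nb disj[OF inj] near' by blast
    define S where "S = U o\<^sub>L S0 o\<^sub>L V"
    have "S \<in> closure core"
      using UV S0(1) closure_subset unfolding S_def roe_unitary_def by blast
    moreover have "(\<lambda>n. cinner (T (l n) v) u) sums cinner (S v) u" for u v
    proof -
      have "bounded_linear (\<lambda>z. cinner (U z) u)"
        using bounded_linear_compose[OF cinner.bounded_linear_left blinfun.bounded_linear_right] .
      from bounded_linear.sums[OF this S0(2)[of "V v"]] show ?thesis
        using roe_unitaryD(3)[OF roe_unitary_sym[OF UV]]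
        by (simp add: S_def T_eq clinear_opD[OF U(2)] cinner_scaleC_left)
    qed
    ultimately show "\<exists>S. quasi_local S \<and>
        (\<forall>u v. (\<lambda>n. cinner (T (l n) v) u) sums cinner (blinfun_apply S v) u)"
      using quasi_local_closure_core by blast
  next
    show "separated (real n) (w (k n)) (w' (k n))" for n
      using separated_mono[OF sep] strict_mono_imp_increasing[OF k(1)] by simp
    show "d / (2 * M) * (d / (2 * M)) \<le> cmod (cinner (T n (w' (k n))) (w (k n)))" for n
      unfolding T_eq norm_mult using la[of "k n"] lb[of "k n"] M d
      by (intro mult_mono) (auto simp: cmod_cinner_commute[of "w' (k n)"])
  qed (use w M d in auto)
qed

end

text \<open>That \<open>e\<close> lies in the range of some \<open>p0\<close> places
  \<open>E\<close> in the core over every space. This element plays the role of \<open>D\<close> for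
  the vectors \<open>ell2_single x e\<close>.\<close>

locale roe_rigidity = exhausting_projections \<P>
  for \<P> :: "('h::chilbert_space \<Rightarrow>\<^sub>L 'h) set" +
  fixes e :: 'h and p0 :: "'h \<Rightarrow>\<^sub>L 'h"
  assumes e: "norm e = 1" and p0: "p0 \<in> \<P>" "p0 e = e"
begin

abbreviation "E \<equiv> amp (rank_one e e)"

lemma E_core: "E \<in> closure core"
  using amp_rank_one_core[OF p0] closure_subset by blast

lemma E_single: "E (ell2_single x e) = ell2_single x e"
  using e by (simp add: cinner_self)

lemma restrict_single: "x \<in> A \<Longrightarrow> ell2_restrict A (ell2_single x h) = ell2_single x h"
  by (rule ell2_eqI) auto

text \<open>Counterexamples at every separation \<open>n\<close> are of two kinds. If each point
  occurs finitely often, the blocks \<open>|\<delta>><\<delta>|\<close> at these points sum in the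
  algebra while each image joins two far-apart pieces of the same vector. If a point
  \<open>z\<close> recurs, the single operator \<open>rank_one (\<xi> z) (\<xi> z)\<close> already
  fails to be quasi-local.\<close>

lemma concentration:
  fixes U :: "('x::metric_space, 'h) ell2 \<Rightarrow>\<^sub>L ('y::metric_space, 'h) ell2"
  assumes fin: "\<And>z :: 'x. \<And>r. finite (cball z r)" and UV: "roe_unitary U V" and \<epsilon>: "\<epsilon> > 0"
  shows "\<exists>s. \<forall>x A B. (\<forall>a\<in>A. \<forall>b\<in>B. s \<le> dist a b) \<longrightarrow>
    norm (ell2_restrict A (U (ell2_single x e))) * norm (ell2_restrict B (U (ell2_single x e))) \<le> \<epsilon>"
proof (rule ccontr)
  assume neg: "\<not> ?thesis"
  have "\<forall>n::nat. \<exists>x A B. (\<forall>a\<in>A. \<forall>b\<in>B. real n \<le> dist a b) \<and>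
    \<epsilon> < norm (ell2_restrict A (U (ell2_single x e))) * norm (ell2_restrict B (U (ell2_single x e)))"
    using neg by (meson not_le)
  then obtain x A B where sep: "\<And>n::nat. \<forall>a\<in>A n. \<forall>b\<in>B n. real n \<le> dist a b"
    and prod: "\<And>n. \<epsilon> < norm (ell2_restrict (A n) (U (ell2_single (x n) e)))
      * norm (ell2_restrict (B n) (U (ell2_single (x n) e)))"
    by metis
  note U = roe_unitaryD[OF UV]
  define \<xi> where "\<xi> z = U (ell2_single z e)" for z
  have n\<xi>: "norm (\<xi> z) = 1" for z using e by (simp add: \<xi>_def U)
  define w where "w n = ell2_restrict (A n) (\<xi> (x n))" for n
  define w' where "w' n = ell2_restrict (B n) (\<xi> (x n))" for n
  have nw: "norm (w n) \<le> 1" "norm (w' n) \<le> 1" for n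
    using norm_ell2_restrict_le n\<xi> unfolding w_def w'_def by metis+
  have prod: "\<epsilon> < norm (w n) * norm (w' n)" for n
    using prod[of n] by (simp add: w_def w'_def \<xi>_def)
  have sep: "separated (real n) (w n) (w' n)" for n
    unfolding w_def w'_def by (rule separated_restrict) (use sep in auto)
  \<comment> \<open>The other factor is at most 1, so each factor alone is at least as large as the
    product.\<close>
  have large: "\<epsilon> \<le> norm (w n)" "\<epsilon> \<le> norm (w' n)" for n
    using prod[of n] mult_left_le[OF nw(1)[of n] norm_ge_zero[of "w' n"]]
      mult_left_le[OF nw(2)[of n] norm_ge_zero[of "w n"]] by (simp_all add: mult.commute)
  have self: "cinner (\<xi> (x n)) (w n) = of_real ((norm (w n))\<^sup>2)"
    "cinner (\<xi> (x n)) (w' n) = of_real ((norm (w' n))\<^sup>2)" for n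
    by (simp_all add: w_def w'_def cinner_ell2_restrict_self)
  show False
  proof (cases "\<forall>z. finite {n. x n = z}")
    case True
    have eq: "U (ell2_restrict {x n} (E (ell2_single (x n) e))) = \<xi> (x n)" for n
      unfolding E_single \<xi>_def by (simp add: restrict_single)
    have big: "\<epsilon>\<^sup>2 \<le> (norm (w n))\<^sup>2" "\<epsilon>\<^sup>2 \<le> (norm (w' n))\<^sup>2" for n
      using large \<epsilon> by (simp_all add: power_mono)
    show False
    proof (rule separated_images_contradiction[OF fin UV, where D = E and D' = E and x = x and x' = x
          and R = 0 and r = 0 and \<zeta> = "\<lambda>n. ell2_single (x n) e" and \<zeta>' = "\<lambda>n. ell2_single (x n) e"
          and A = "\<lambda>n. {x n}" and B = "\<lambda>n. {x n}" and w = w and w' = w' and d = "\<epsilon>\<^sup>2"])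
    qed (use True E_core e nw sep \<epsilon> big in \<open>auto simp only: eq self norm_of_real norm_ell2_single
        dist_self abs_power2 order_refl zero_less_power centre_in_cball insert_subset empty_subsetI\<close>)
  next
    case False
    then obtain z where z: "infinite {n. x n = z}" by blast
    have "quasi_local (rank_one (\<xi> z) (\<xi> z))"
      by (intro quasi_local_closure_core rank_one_closure_core)
    then obtain s where s: "\<And>u v. norm u \<le> 1 \<Longrightarrow> norm v \<le> 1 \<Longrightarrow> separated s u v \<Longrightarrow>
        cmod (cinner (rank_one (\<xi> z) (\<xi> z) v) u) \<le> \<epsilon>\<^sup>2"
      using \<epsilon> unfolding quasi_local_def by (meson zero_less_power)
    obtain n where n: "s \<le> real n" "x n = z" using infinite_nat_real_ge[OF z] by blast
    have "separated s (w n) (w' n)" using n by (intro separated_mono[OF sep])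
    hence "cmod (cinner (rank_one (\<xi> z) (\<xi> z) (w' n)) (w n)) \<le> \<epsilon>\<^sup>2" by (intro s nw)
    hence "(norm (w n) * norm (w' n))\<^sup>2 \<le> \<epsilon>\<^sup>2"
      using self[of n] cmod_cinner_commute[of "w' n" "\<xi> z"] n(2)
      by (simp add: cinner_scaleC_left norm_mult norm_power power_mult_distrib mult.commute)
    thus False using prod[of n] \<epsilon> by (simp add: power2_le_iff_abs_le abs_mult)
  qed
qed

section \<open>Coarse properties of maps that follow the mass of the images of basis vectors\<close>

definition localizes ::
    "(('x::metric_space, 'h) ell2 \<Rightarrow>\<^sub>L ('y::metric_space, 'h) ell2) \<Rightarrow> real \<Rightarrow> real \<Rightarrow> ('x \<Rightarrow> 'y) \<Rightarrow> bool"
  where "localizes U d r f \<longleftrightarrow> d > 0 \<and>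
    (\<forall>x. d \<le> norm (ell2_restrict (cball (f x) r) (blinfun_apply U (ell2_single x e))))"

text \<open>If \<open>x n\<close> and \<open>x' n\<close> stay close, the rank-one blocks from one
  to the other have bounded propagation, while their images would link balls around
  \<open>f (x n)\<close> and \<open>f (x' n)\<close> that drift apart.\<close>

lemma localizes_bornologous:
  fixes U :: "('x::metric_space, 'h) ell2 \<Rightarrow>\<^sub>L ('y::metric_space, 'h) ell2"
  assumes fin: "\<And>z :: 'x. \<And>r. finite (cball z r)" and UV: "roe_unitary U V"
    and f: "localizes U d r f"
  shows "\<exists>S. \<forall>x x'. dist x x' \<le> R \<longrightarrow> dist (f x) (f x') \<le> S"
proof (rule ccontr)
  assume "\<not> ?thesis"
  \<comment> \<open>The slack \<open>2 * r\<close> leaves distance at least \<open>n\<close> between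
    the balls of radius \<open>r\<close>.\<close>
  hence "\<forall>n::nat. \<exists>x x'. dist x x' \<le> R \<and> real n + 2 * r < dist (f x) (f x')" by (meson not_le)
  then obtain x x' where near: "\<And>n::nat. dist (x n) (x' n) \<le> R"
    and far: "\<And>n::nat. real n + 2 * r < dist (f (x n)) (f (x' n))" by metis
  note U = roe_unitaryD[OF UV]
  have d: "d > 0" "\<And>x. d \<le> norm (ell2_restrict (cball (f x) r) (U (ell2_single x e)))"
    using f by (auto simp: localizes_def)
  define w where "w z = ell2_restrict (cball (f z) r) (U (ell2_single z e))" for z
  have nw: "norm (w z) \<le> 1" for z
    using norm_ell2_restrict_le[of "cball (f z) r" "U (ell2_single z e)"] e by (simp add: w_def U)
  \<comment> \<open>For a recurring \<open>z\<close> all \<open>x' n\<close> lie in the finite ball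
    around \<open>z\<close>, on which \<open>f\<close> has bounded image.\<close>
  have fto: "finite {n. x n = z}" for z
  proof (rule ccontr)
    assume inf: "infinite {n. x n = z}"
    obtain N where N: "\<And>y y'. y \<in> f ` insert z (cball z R) \<Longrightarrow> y' \<in> f ` insert z (cball z R) \<Longrightarrow>
        dist y y' < real N"
      using finite_dist_bound[of "f ` insert z (cball z R)"] fin by blast
    obtain n where n: "real N - 2 * r \<le> real n" "x n = z"
      using infinite_nat_real_ge[OF inf] by blast
    have "dist (f z) (f (x' n)) < real N" using near[of n] n(2) by (intro N) auto
    thus False using far[of n, unfolded n(2)] n(1) by linarith
  qed
  have eq: "U (ell2_restrict {z} (E (ell2_single z e))) = U (ell2_single z e)" for z
    unfolding E_single by (simp add: restrict_single)
  have large: "d\<^sup>2 \<le> cmod (cinner (U (ell2_single z e)) (w z))" for z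
    using d(1) d(2)[of z] by (simp add: w_def cmod_cinner_restrict power_mono)
  show False
  proof (rule separated_images_contradiction[OF fin UV, where D = E and D' = E and x = x and x' = x'
        and R = R and r = 0 and \<zeta> = "\<lambda>n. ell2_single (x n) e" and \<zeta>' = "\<lambda>n. ell2_single (x' n) e"
        and A = "\<lambda>n. {x n}" and B = "\<lambda>n. {x' n}" and w = "\<lambda>n. w (x n)" and w' = "\<lambda>n. w (x' n)"
        and d = "d\<^sup>2"])
    show "separated (real n) (w (x n)) (w (x' n))" for n
      unfolding w_def
    proof (rule separated_restrict)
      fix y y' assume "y \<in> cball (f (x n)) r" "y' \<in> cball (f (x' n)) r"
      thus "real n \<le> dist y y'"
        using far[of n] dist_triangle[of "f (x n)" "f (x' n)" y] dist_triangle[of y "f (x' n)" y']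
        by (simp add: dist_commute)
    qed
  qed (use fto near E_core e nw d large in \<open>auto simp only: eq norm_ell2_single
        zero_less_power centre_in_cball insert_subset empty_subsetI order_refl\<close>)
qed

text \<open>Substitute for \<open>E\<close> over the target space: one element of the algebra there
  that fixes all the vectors \<open>U (ell2_single x e)\<close>.\<close>

lemma conjugate_E:
  assumes "roe_unitary U V"
  shows "U o\<^sub>L E o\<^sub>L V \<in> closure core"
    and "(U o\<^sub>L E o\<^sub>L V) (U (ell2_single x e)) = U (ell2_single x e)"
  using assms E_core roe_unitaryD[OF assms]
  by (auto simp: roe_unitary_def E_single simp del: amp_single)

text \<open>Infinitely many points over \<open>y\<close> give a weakly null sequence of images with
  mass at least \<open>d\<close> squared in one ball. All are fixed by the conjugate of
  \<open>E\<close>, so by \<open>closure_core_weakly_null\<close> their coordinates tend to 0 in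
  norm, and the ball is finite.\<close>

lemma localizes_finite_fibres:
  fixes U :: "('x::metric_space, 'h) ell2 \<Rightarrow>\<^sub>L ('y::metric_space, 'h) ell2"
  assumes fin: "\<And>z :: 'y. \<And>r. finite (cball z r)" and UV: "roe_unitary U V"
    and f: "localizes U d r f"
  shows "finite {x. f x = y}"
proof (rule ccontr)
  assume "infinite {x. f x = y}"
  then obtain s :: "nat \<Rightarrow> 'x" where s: "inj s" "range s \<subseteq> {x. f x = y}"
    using infinite_countable_subset by blast
  note U = roe_unitaryD[OF UV]
  define v where "v n = U (ell2_single (s n) e)" for n
  have "(\<lambda>n. ell2_apply ((U o\<^sub>L E o\<^sub>L V) (v n)) z) \<longlonglongrightarrow> 0" for z
  proof (rule closure_core_weakly_null[OF fin conjugate_E(1)[OF UV]])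
    show "norm (v n) \<le> 1" for n using e by (simp add: v_def U)
    show "(\<lambda>n. cinner (v n) w) \<longlonglongrightarrow> 0" for w
      using cinner.tendsto[OF tendsto_const[of e] ell2_apply_inj_tendsto_0[OF s(1), of "V w"]]
      by (simp add: v_def U cinner_ell2_single' cinner.zero_right)
  qed
  hence v0: "(\<lambda>n. ell2_apply (v n) z) \<longlonglongrightarrow> 0" for z
    unfolding v_def conjugate_E(2)[OF UV] .
  have "(\<lambda>n. \<Sum>z\<in>cball y r. (norm (ell2_apply (v n) z))\<^sup>2) \<longlonglongrightarrow> (\<Sum>z\<in>cball y r. (norm (0::'h))\<^sup>2)"
    by (intro tendsto_intros v0)
  hence lim: "(\<lambda>n. (norm (ell2_restrict (cball y r) (v n)))\<^sup>2) \<longlonglongrightarrow> 0"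
    by (simp add: norm_ell2_restrict_finite[OF fin])
  have d: "d > 0" "d\<^sup>2 \<le> (norm (ell2_restrict (cball y r) (v n)))\<^sup>2" for n
  proof -
    have "f (s n) = y" using s(2) by auto
    thus "d > 0" "d\<^sup>2 \<le> (norm (ell2_restrict (cball y r) (v n)))\<^sup>2"
      using f by (auto simp: localizes_def v_def intro!: power_mono)
  qed
  have "d\<^sup>2 \<le> 0" by (rule LIMSEQ_le_const[OF lim]) (use d in auto)
  thus False using d(1) by simp
qed

text \<open>The argument for \<open>localizes_bornologous\<close> run backwards through
  \<open>V\<close>: the part of \<open>U (ell2_single x e)\<close> in the ball around
  \<open>f x\<close> is sent by \<open>V\<close> to a vector with a definite component along
  \<open>ell2_single x e\<close>, so nearby balls with far-apart origins contradict quasi-locality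
  over the source.\<close>

lemma localizes_expansive:
  fixes U :: "('x::metric_space, 'h) ell2 \<Rightarrow>\<^sub>L ('y::metric_space, 'h) ell2"
  assumes fin: "\<And>z :: 'y. \<And>r. finite (cball z r)" and UV: "roe_unitary U V"
    and f: "localizes U d r f"
  shows "\<exists>S. \<forall>x x'. dist (f x) (f x') \<le> R \<longrightarrow> dist x x' \<le> S"
proof (rule ccontr)
  assume "\<not> ?thesis"
  hence "\<forall>n::nat. \<exists>x x'. dist (f x) (f x') \<le> R \<and> real n < dist x x'" by (meson not_le)
  then obtain x x' where near: "\<And>n::nat. dist (f (x n)) (f (x' n)) \<le> R"
    and far: "\<And>n::nat. real n < dist (x n) (x' n)" by metis
  note U = roe_unitaryD[OF UV]
  have d: "d > 0" "\<And>x. d \<le> norm (ell2_restrict (cball (f x) r) (U (ell2_single x e)))"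
    using f by (auto simp: localizes_def)
  have fto: "finite {n. f (x n) = y}" for y
  proof (rule ccontr)
    assume inf: "infinite {n. f (x n) = y}"
    \<comment> \<open>For a recurring value \<open>y\<close>, all \<open>x n\<close> and
      \<open>x' n\<close> concerned lie in the preimage of a finite set, which is finite by the
      preceding lemma.\<close>
    define G where "G = (\<Union>z\<in>insert y (cball y R). {x. f x = z})"
    have "finite G"
      unfolding G_def using fin localizes_finite_fibres[OF fin UV f] by blast
    then obtain N where N: "\<And>z z'. z \<in> G \<Longrightarrow> z' \<in> G \<Longrightarrow> dist z z' < real N"
      using finite_dist_bound by blast
    obtain n where n: "n \<ge> N" "f (x n) = y" using inf by (auto simp: infinite_nat_iff_unbounded_le)
    have "dist (x n) (x' n) < real N" using near[of n] n(2) by (intro N) (auto simp: G_def)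
    thus False using far[of n] n by linarith
  qed
  define \<zeta> where "\<zeta> z = U (ell2_single z e)" for z
  have n\<zeta>: "norm (\<zeta> z) \<le> 1" for z using e by (simp add: \<zeta>_def U)
  have large: "d\<^sup>2 \<le> cmod (cinner (V (ell2_restrict (cball (f z) r) ((U o\<^sub>L E o\<^sub>L V) (\<zeta> z)))) (ell2_single z e))" for z
  proof -
    have "cinner (V (ell2_restrict (cball (f z) r) (\<zeta> z))) (ell2_single z e)
        = cinner (ell2_restrict (cball (f z) r) (\<zeta> z)) (\<zeta> z)"
      using roe_unitaryD(3)[OF roe_unitary_sym[OF UV]] by (simp add: \<zeta>_def)
    moreover have "d\<^sup>2 \<le> cmod (cinner (ell2_restrict (cball (f z) r) (\<zeta> z)) (\<zeta> z))"
      using d(1) d(2)[of z] unfolding cmod_cinner_restrict by (intro power_mono) (auto simp: \<zeta>_def)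
    ultimately show ?thesis using conjugate_E(2)[OF UV, of z] by (simp only: \<zeta>_def)
  qed
  show False
  proof (rule separated_images_contradiction[OF fin roe_unitary_sym[OF UV],
        where D = "U o\<^sub>L E o\<^sub>L V" and D' = "U o\<^sub>L E o\<^sub>L V" and x = "\<lambda>n. f (x n)" and x' = "\<lambda>n. f (x' n)"
        and R = R and r = r and \<zeta> = "\<lambda>n. \<zeta> (x n)" and \<zeta>' = "\<lambda>n. \<zeta> (x' n)"
        and A = "\<lambda>n. cball (f (x n)) r" and B = "\<lambda>n. cball (f (x' n)) r"
        and w = "\<lambda>n. ell2_single (x n) e" and w' = "\<lambda>n. ell2_single (x' n) e" and d = "d\<^sup>2"])
    show "separated (real n) (ell2_single (x n) e) (ell2_single (x' n) e)" for n
      using far[of n] by (auto simp: separated_def split: if_splits)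
  qed (use fto near conjugate_E(1)[OF UV] e n\<zeta> d large in \<open>auto simp only: norm_ell2_single
        zero_less_power order_refl\<close>)
qed

text \<open>Both \<open>ell2_single (g y) e\<close> and the part of
  \<open>V (ell2_single y e)\<close> in the ball around \<open>g y\<close> live near
  \<open>g y\<close>. Under \<open>U\<close> the first has mass near \<open>f (g y)\<close> and the
  second overlaps \<open>ell2_single y e\<close>, so \<open>y\<close> cannot be far from
  \<open>f (g y)\<close>.\<close>

lemma localizes_almost_inverse:
  fixes U :: "('x::metric_space, 'h) ell2 \<Rightarrow>\<^sub>L ('y::metric_space, 'h) ell2"
  assumes fin: "\<And>z :: 'x. \<And>r. finite (cball z r)" and UV: "roe_unitary U V"
    and f: "localizes U d r f" and g: "localizes V d' r' g"
  shows "\<exists>S. \<forall>y. dist y (f (g y)) \<le> S"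
proof (rule ccontr)
  assume "\<not> ?thesis"
  hence "\<forall>n::nat. \<exists>y. real n + r < dist y (f (g y))" by (meson not_le)
  then obtain y where far: "\<And>n::nat. real n + r < dist (y n) (f (g (y n)))" by metis
  note VU = roe_unitary_sym[OF UV]
  note U = roe_unitaryD[OF UV] and V = roe_unitaryD[OF VU]
  have d: "d > 0" "\<And>x. d \<le> norm (ell2_restrict (cball (f x) r) (U (ell2_single x e)))"
    using f by (auto simp: localizes_def)
  have d': "d' > 0" "\<And>y. d' \<le> norm (ell2_restrict (cball (g y) r') (V (ell2_single y e)))"
    using g by (auto simp: localizes_def)
  have fto: "finite {n. g (y n) = z}" for z
  proof (rule ccontr)
    assume inf: "infinite {n. g (y n) = z}"
    have "finite (insert (f z) {y. g y = z})"
      using localizes_finite_fibres[OF fin VU g] by simp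
    then obtain N where N: "\<And>u u'. u \<in> insert (f z) {y. g y = z} \<Longrightarrow>
        u' \<in> insert (f z) {y. g y = z} \<Longrightarrow> dist u u' < real N"
      using finite_dist_bound by blast
    obtain n where n: "real N - r \<le> real n" "g (y n) = z"
      using infinite_nat_real_ge[OF inf] by blast
    have "dist (y n) (f z) < real N" using n(2) by (intro N) auto
    thus False using far[of n, unfolded n(2)] n(1) by linarith
  qed
  define w where "w z = ell2_restrict (cball (f z) r) (U (ell2_single z e))" for z
  have nw: "norm (w z) \<le> 1" for z
    using norm_ell2_restrict_le[of "cball (f z) r" "U (ell2_single z e)"] e by (simp add: w_def U)
  define c where "c = min (d\<^sup>2) (d'\<^sup>2)"
  have c: "c > 0" using d(1) d'(1) by (simp add: c_def)
  have eq: "U (ell2_restrict {z} (E (ell2_single z e))) = U (ell2_single z e)" for z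
    unfolding E_single by (simp add: restrict_single)
  have large: "c \<le> cmod (cinner (U (ell2_single z e)) (w z))" for z
  proof -
    have "d\<^sup>2 \<le> cmod (cinner (U (ell2_single z e)) (w z))"
      using d(1) d(2)[of z] by (simp add: w_def cmod_cinner_restrict power_mono)
    thus ?thesis by (simp add: c_def)
  qed
  define \<zeta> where "\<zeta> u = V (ell2_single u e)" for u
  have n\<zeta>: "norm (\<zeta> u) \<le> 1" for u using e by (simp add: \<zeta>_def V)
  have large': "c \<le> cmod (cinner (U (ell2_restrict (cball (g u) r') ((V o\<^sub>L E o\<^sub>L U) (\<zeta> u)))) (ell2_single u e))" for u
  proof -
    have "cinner (U (ell2_restrict (cball (g u) r') (\<zeta> u))) (ell2_single u e)
        = cinner (ell2_restrict (cball (g u) r') (\<zeta> u)) (\<zeta> u)"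
      by (simp add: \<zeta>_def U(3))
    moreover have "d'\<^sup>2 \<le> cmod (cinner (ell2_restrict (cball (g u) r') (\<zeta> u)) (\<zeta> u))"
      using d'(1) d'(2)[of u] unfolding cmod_cinner_restrict by (intro power_mono) (auto simp: \<zeta>_def)
    ultimately show ?thesis using conjugate_E(2)[OF VU, of u] by (simp only: \<zeta>_def c_def)
  qed
  show False
  \<comment> \<open>The radius \<open>max 0 r'\<close> must also admit the singleton supports, even
    if \<open>r'\<close> is negative.\<close>
  proof (rule separated_images_contradiction[OF fin UV, where D = E and D' = "V o\<^sub>L E o\<^sub>L U"
        and x = "\<lambda>n. g (y n)" and x' = "\<lambda>n. g (y n)" and R = 0 and r = "max 0 r'"
        and \<zeta> = "\<lambda>n. ell2_single (g (y n)) e" and \<zeta>' = "\<lambda>n. \<zeta> (y n)"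
        and A = "\<lambda>n. {g (y n)}" and B = "\<lambda>n. cball (g (y n)) r'"
        and w = "\<lambda>n. w (g (y n))" and w' = "\<lambda>n. ell2_single (y n) e" and d = c])
    show "separated (real n) (w (g (y n))) (ell2_single (y n) e)" for n
      unfolding separated_def
    proof (intro allI impI)
      fix u u' assume "ell2_apply (w (g (y n))) u \<noteq> 0" "ell2_apply (ell2_single (y n) e) u' \<noteq> 0"
      hence "dist (f (g (y n))) u \<le> r" "u' = y n" by (auto simp: w_def split: if_splits)
      thus "real n \<le> dist u u'"
        using far[of n] dist_triangle[of "y n" "f (g (y n))" u] by (simp add: dist_commute)
    qed
    show "{g (y n)} \<subseteq> cball (g (y n)) (max 0 r')" "cball (g (y n)) r' \<subseteq> cball (g (y n)) (max 0 r')" for n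
      by auto
  qed (use fto E_core conjugate_E(1)[OF VU] e nw n\<zeta> c large large' in \<open>auto simp only: eq norm_ell2_single
        dist_self order_refl\<close>)
qed

end

section \<open>Concentrated weights and maps into \<open>L\<^sup>p\<close>\<close>

text \<open>The coefficient of the main term is arbitrarily close to 1. With \<theta> = 1/20 the
  excess can be absorbed after multiplication by the isoperimetric constant 10.\<close>

lemma powr_add_le:
  fixes p \<theta> :: real
  assumes "1 \<le> p" "0 < \<theta>"
  obtains C where "0 \<le> C"
    "\<And>u t. 0 \<le> u \<Longrightarrow> 0 \<le> t \<Longrightarrow> (u + t) powr p \<le> (1 + \<theta>) * u powr p + C * t powr p"
proof -
  \<comment> \<open>The solution of \<open>(1 + k) powr p = 1 + \<theta>\<close>; it separates the
    regime where \<open>u\<close> dominates from that where \<open>t\<close> does.\<close>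
  define k where "k = (1 + \<theta>) powr (1 / p) - 1"
  have "1 < (1 + \<theta>) powr (1 / p)" using assms by (intro gr_one_powr) auto
  hence k: "k > 0" by (simp add: k_def)
  have kp: "(1 + k) powr p = 1 + \<theta>" using assms by (simp add: k_def powr_powr)
  show ?thesis
  proof (rule that[of "(1 + 1 / k) powr p"])
    fix u t :: real assume u: "0 \<le> u" and t: "0 \<le> t"
    show "(u + t) powr p \<le> (1 + \<theta>) * u powr p + (1 + 1 / k) powr p * t powr p"
    proof (cases "t \<le> k * u")
      case True
      have "(u + t) powr p \<le> ((1 + k) * u) powr p"
        using True u t assms by (intro powr_mono2) (auto simp: algebra_simps)
      also have "\<dots> = (1 + \<theta>) * u powr p" using u k by (simp add: powr_mult kp)
      finally show ?thesis by (simp add: add_increasing2)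
    next
      case False
      hence "u \<le> t / k" using k by (simp add: field_simps)
      hence "(u + t) powr p \<le> ((1 + 1 / k) * t) powr p"
        using u t assms by (intro powr_mono2) (auto simp: algebra_simps)
      also have "\<dots> = (1 + 1 / k) powr p * t powr p" using t k by (simp add: powr_mult)
      finally show ?thesis using assms by (simp add: add_increasing)
    qed
  qed simp
qed

lemma powr_add_le_two:
  fixes a b p :: real
  assumes "0 \<le> a" "0 \<le> b" "0 \<le> p"
  shows "(a + b) powr p \<le> 2 powr p * (a powr p + b powr p)"
proof -
  have "(a + b) powr p \<le> (2 * max a b) powr p" using assms by (intro powr_mono2) auto
  also have "\<dots> = 2 powr p * max a b powr p" using assms by (simp add: powr_mult)
  also have "\<dots> \<le> 2 powr p * (a powr p + b powr p)" by (simp add: max_def)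
  finally show ?thesis .
qed

text \<open>Remove a set \<open>A0\<close> of largest mass among those of mass at most 7/10 whose
  \<open>s\<close>-boundary has at most a tenth of their mass. If \<open>A0\<close> had mass at
  least 1/10, the part \<open>B\<close> at distance at least \<open>s\<close> from it would by
  concentration have mass at most 1/10, and 7/10 + 7/100 + 1/10 falls short of 9/10. A violating
  \<open>A\<close> in the rest could then be added to \<open>A0\<close>, the union having mass at
  most 1/10 + 1/2, against maximality.\<close>

lemma concentrated_isoperimetric_subset:
  fixes m :: "'y::metric_space \<Rightarrow> real"
  assumes F: "finite F" and m: "\<And>y. 0 \<le> m y" and M: "9 / 10 \<le> sum m F" "sum m F \<le> 1"
    and conc: "\<And>A B. A \<subseteq> F \<Longrightarrow> B \<subseteq> F \<Longrightarrow> (\<forall>a\<in>A. \<forall>b\<in>B. s \<le> dist a b) \<Longrightarrow>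
      sum m A * sum m B \<le> 1 / 100"
  shows "\<exists>Z\<subseteq>F. 8 / 10 \<le> sum m Z \<and> (\<forall>A\<subseteq>Z. sum m A \<le> sum m Z / 2 \<longrightarrow>
    sum m A \<le> 10 * sum m {z \<in> Z - A. \<exists>a\<in>A. dist a z < s})"
proof -
  define bd where "bd A = {z \<in> F - A. \<exists>a\<in>A. dist a z < s}" for A
  define \<A> where "\<A> = {A. A \<subseteq> F \<and> sum m A \<le> 7 / 10 \<and> 10 * sum m (bd A) \<le> sum m A}"
  have "{} \<in> \<A>" by (simp add: \<A>_def bd_def)
  moreover have fA: "finite \<A>" using F by (simp add: \<A>_def)
  ultimately have "Max (sum m ` \<A>) \<in> sum m ` \<A>" by (intro Max_in) auto
  then obtain A0 where A0: "A0 \<in> \<A>" "sum m A0 = Max (sum m ` \<A>)" by auto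
  have max: "sum m A \<le> sum m A0" if "A \<in> \<A>" for A
    using that fA by (simp add: A0(2))
  have A0F: "A0 \<subseteq> F" and A0m: "sum m A0 \<le> 7 / 10" and A0b: "10 * sum m (bd A0) \<le> sum m A0"
    using A0(1) by (auto simp: \<A>_def)
  have fin: "finite A" if "A \<subseteq> F" for A using that F finite_subset by blast
  have small: "sum m A0 < 1 / 10"
  proof (rule ccontr)
    assume "\<not> ?thesis"
    hence big: "1 / 10 \<le> sum m A0" by simp
    define B where "B = F - A0 - bd A0"
    have "sum m A0 * sum m B \<le> 1 / 100"
      using A0F by (intro conc) (auto simp: B_def bd_def, meson not_le)
    moreover have "1 / 10 * sum m B \<le> sum m A0 * sum m B"
      using big m by (intro mult_right_mono sum_nonneg) auto
    ultimately have "sum m B \<le> 1 / 10" by linarith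
    moreover have "sum m F = sum m A0 + (sum m (bd A0) + sum m B)"
    proof -
      have "sum m F = sum m (A0 \<union> (bd A0 \<union> B))"
        using A0F by (intro arg_cong[of _ _ "sum m"]) (auto simp: B_def bd_def)
      also have "\<dots> = sum m A0 + sum m (bd A0 \<union> B)"
        using A0F F by (intro sum.union_disjoint) (auto simp: B_def bd_def intro: fin)
      also have "sum m (bd A0 \<union> B) = sum m (bd A0) + sum m B"
        using F by (intro sum.union_disjoint) (auto simp: B_def bd_def)
      finally show ?thesis .
    qed
    ultimately show False using M(1) A0m A0b by linarith
  qed
  define Z where "Z = F - A0"
  have mZ: "sum m Z = sum m F - sum m A0"
    unfolding Z_def using A0F F by (simp add: sum_diff)
  show ?thesis
  proof (intro exI[of _ Z] conjI allI impI)
    show "Z \<subseteq> F" by (auto simp: Z_def)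
    show "8 / 10 \<le> sum m Z" using mZ small M by linarith
    fix A assume A: "A \<subseteq> Z" "sum m A \<le> sum m Z / 2"
    define b where "b = {z \<in> Z - A. \<exists>a\<in>A. dist a z < s}"
    have fb: "finite b" "finite A" "finite (bd A0)"
      using A F by (auto simp: b_def Z_def bd_def intro: fin)
    show "sum m A \<le> 10 * sum m {z \<in> Z - A. \<exists>a\<in>A. dist a z < s}"
    proof (rule ccontr)
      assume neg: "\<not> ?thesis"
      have un: "sum m (A0 \<union> A) = sum m A0 + sum m A"
        using A A0F F by (intro sum.union_disjoint) (auto simp: Z_def intro: fin)
      \<comment> \<open>A boundary point of the union is adjacent to \<open>A0\<close>, or is
        adjacent to \<open>A\<close> and lies in \<open>Z\<close>.\<close>
      have "sum m (bd (A0 \<union> A)) \<le> sum m (bd A0 \<union> b)"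
        using fb m by (intro sum_mono2) (auto simp: bd_def b_def Z_def)
      also have "\<dots> \<le> sum m (bd A0) + sum m b"
        using sum.union_inter[OF fb(3,1), of m] m sum_nonneg[of "bd A0 \<inter> b" m] by simp
      finally have "10 * sum m (bd (A0 \<union> A)) \<le> sum m (A0 \<union> A)" using A0b neg[folded b_def] un by linarith
      moreover have "sum m (A0 \<union> A) \<le> 7 / 10"
      proof -
        have "sum m A \<le> 1 / 2" using A(2) mZ M(2) sum_nonneg[of A0 m] m by fastforce
        thus ?thesis using un small by linarith
      qed
      ultimately have "A0 \<union> A \<in> \<A>" using A A0F by (auto simp: \<A>_def Z_def)
      hence "sum m A \<le> 0" using max[of "A0 \<union> A"] un by linarith
      thus False using neg[folded b_def] sum_nonneg[of b m] m by fastforce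
    qed
  qed
qed

section \<open>From isoperimetry to Poincare inequalities\<close>

lemma has_integral_Ico: "a \<le> b \<Longrightarrow> has_bochner_integral lborel (indicator {a..<b} :: real \<Rightarrow> real) (b - a)"
  using has_bochner_integral_real_indicator[of "{a..<b}" lborel] by (simp add: emeasure_lborel_Ico)

locale isoperimetric =
  fixes Z :: "'y::metric_space set" and m :: "'y \<Rightarrow> real" and s :: real
  assumes Z: "finite Z" and m: "\<And>y. 0 \<le> m y" and mZ: "sum m Z \<le> 1"
    and iso: "\<And>A. A \<subseteq> Z \<Longrightarrow> sum m A \<le> sum m Z / 2 \<Longrightarrow>
      sum m A \<le> 10 * sum m {z \<in> Z - A. \<exists>a\<in>A. dist a z < s}"
begin

text \<open>Layer cake: the left side is the integral over \<open>t\<close> of the mass of the level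
  set \<open>u > t\<close>. The boundary of that set lies where \<open>u \<le> t < v\<close>, and
  the mass of this region integrates to the sum on the right. So \<open>v - u\<close> takes the
  place of a gradient.\<close>

lemma coarea:
  assumes u: "\<And>z. 0 \<le> u z" and half: "sum m {z \<in> Z. 0 < u z} \<le> sum m Z / 2"
    and uv: "\<And>z. u z \<le> v z" and nb: "\<And>z z'. z \<in> Z \<Longrightarrow> z' \<in> Z \<Longrightarrow> dist z z' < s \<Longrightarrow> u z' \<le> v z"
  shows "(\<Sum>z\<in>Z. m z * u z) \<le> 10 * (\<Sum>z\<in>Z. m z * (v z - u z))"
proof -
  let ?f = "\<lambda>t::real. \<Sum>z\<in>Z. m z * indicator {0..<u z} t"
  let ?g = "\<lambda>t::real. \<Sum>z\<in>Z. m z * indicator {u z..<v z} t"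
  have f: "has_bochner_integral lborel ?f (\<Sum>z\<in>Z. m z * (u z - 0))"
    by (intro has_bochner_integral_sum has_bochner_integral_mult_right has_integral_Ico u)
  have g: "has_bochner_integral lborel (\<lambda>t. 10 * ?g t) (10 * (\<Sum>z\<in>Z. m z * (v z - u z)))"
    by (intro has_bochner_integral_sum has_bochner_integral_mult_right has_integral_Ico uv)
  have "?f t \<le> 10 * ?g t" for t
  proof (cases "t \<ge> 0")
    case True
    define A where "A = {z \<in> Z. t < u z}"
    have sub: "A \<subseteq> {z \<in> Z. 0 < u z}" using True by (auto simp: A_def)
    have "sum m A \<le> sum m {z \<in> Z. 0 < u z}" using Z m sub by (intro sum_mono2) auto
    hence "sum m A \<le> sum m Z / 2" using half by linarith
    hence "sum m A \<le> 10 * sum m {z \<in> Z - A. \<exists>a\<in>A. dist a z < s}"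
      by (intro iso) (auto simp: A_def)
    also have "sum m {z \<in> Z - A. \<exists>a\<in>A. dist a z < s} \<le> sum m {z \<in> Z. u z \<le> t \<and> t < v z}"
    proof (intro sum_mono2 subsetI)
      fix z assume "z \<in> {z \<in> Z - A. \<exists>a\<in>A. dist a z < s}"
      then obtain a where a: "z \<in> Z" "u z \<le> t" "a \<in> Z" "t < u a" "dist z a < s"
        by (auto simp: A_def dist_commute not_less)
      thus "z \<in> {z \<in> Z. u z \<le> t \<and> t < v z}" using nb[OF a(1,3,5)] by auto
    qed (use Z m in auto)
    also have "sum m A = ?f t"
      unfolding A_def using True Z by (intro sum.mono_neutral_cong_left) (auto simp: indicator_def)
    also have "sum m {z \<in> Z. u z \<le> t \<and> t < v z} = ?g t"
      using Z by (intro sum.mono_neutral_cong_left) (auto simp: indicator_def)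
    finally show ?thesis by simp
  next
    case False
    hence "?f t = 0" by (intro sum.neutral) auto
    moreover have "0 \<le> ?g t" by (intro sum_nonneg mult_nonneg_nonneg m) auto
    ultimately show ?thesis by simp
  qed
  hence "integral\<^sup>L lborel ?f \<le> (\<integral>t. 10 * ?g t \<partial>lborel)"
    by (intro integral_mono integrable.intros[OF f] integrable.intros[OF g])
  thus ?thesis using has_bochner_integral_integral_eq[OF f] has_bochner_integral_integral_eq[OF g] by simp
qed

text \<open>Take the least value of \<open>g\<close> with at most half of the mass strictly above
  it. Were more than half strictly below, the largest value below would also qualify.\<close>

lemma median:
  fixes g :: "'y \<Rightarrow> real"
  assumes "Z \<noteq> {}"
  obtains k where "sum m {z \<in> Z. k < g z} \<le> sum m Z / 2" "sum m {z \<in> Z. g z < k} \<le> sum m Z / 2"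
proof -
  define K where "K = {k \<in> g ` Z. sum m {z \<in> Z. k < g z} \<le> sum m Z / 2}"
  have max: "{z \<in> Z. Max (g ` Z) < g z} = {}" using Z by (auto simp: not_less)
  have "sum m {z \<in> Z. Max (g ` Z) < g z} \<le> sum m Z / 2"
    unfolding max using m by (simp add: sum_nonneg)
  moreover have "Max (g ` Z) \<in> g ` Z" using Z assms by (intro Max_in) auto
  ultimately have "Max (g ` Z) \<in> K" unfolding K_def by blast
  moreover have "finite K" using Z by (auto simp: K_def)
  ultimately have k: "Min K \<in> K" "\<And>k. k \<in> K \<Longrightarrow> Min K \<le> k" by (auto intro: Min_in)
  have "sum m {z \<in> Z. g z < Min K} \<le> sum m Z / 2"
  proof (rule ccontr)
    assume neg: "\<not> ?thesis"
    define L where "L = {z \<in> Z. g z < Min K}"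
    have "sum m L \<noteq> 0" using neg m sum_nonneg[of Z m] by (auto simp: L_def)
    hence "L \<noteq> {}" by (metis sum.empty)
    hence "Max (g ` L) \<in> g ` L" using Z by (intro Max_in) (auto simp: L_def)
    hence l: "Max (g ` L) \<in> g ` Z" "Max (g ` L) < Min K" by (auto simp: L_def)
    hence "Max (g ` L) \<notin> K" using k(2) by force
    hence "sum m Z / 2 < sum m {z \<in> Z. Max (g ` L) < g z}" using l(1) by (auto simp: K_def)
    also have "\<dots> \<le> sum m (Z - L)"
    proof (intro sum_mono2)
      have "g z \<le> Max (g ` L)" if "z \<in> L" for z
        using that Z by (intro Max_ge) (auto simp: L_def)
      thus "{z \<in> Z. Max (g ` L) < g z} \<subseteq> Z - L" by fastforce
    qed (use Z m in auto)
    also have "\<dots> = sum m Z - sum m L" using Z by (intro sum_diff) (auto simp: L_def)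
    finally show False using neg by (simp add: L_def)
  qed
  thus ?thesis using that k(1) by (auto simp: K_def)
qed

text \<open>A discrete \<open>p\<close>-Dirichlet energy at scale \<open>s\<close>. Only the centre
  \<open>z\<close> is weighted, so boundedly many neighbours and bounded increments bound the energy
  by the total mass.\<close>

definition local_energy :: "real \<Rightarrow> ('y \<Rightarrow> 'b::real_normed_vector) \<Rightarrow> real"
  where "local_energy p g =
    (\<Sum>z\<in>Z. m z * (\<Sum>z'\<in>{z' \<in> Z. dist z z' < s}. norm (g z' - g z) powr p))"

text \<open>The isoperimetric inequality gives the Poincare inequality for \<open>p = 1\<close>; the general case
  follows by applying it to the \<open>p\<close>-th power of the positive part of \<open>g - k\<close> (Matousek's
  extrapolation).\<close>

lemma poincare_positive_part:
  fixes g :: "'y \<Rightarrow> real"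
  assumes p: "1 \<le> p" and C: "0 \<le> C"
    "\<And>u t. 0 \<le> u \<Longrightarrow> 0 \<le> t \<Longrightarrow> (u + t) powr p \<le> (1 + 1 / 20) * u powr p + C * t powr p"
    and k: "sum m {z \<in> Z. k < g z} \<le> sum m Z / 2"
  shows "(\<Sum>z\<in>Z. m z * max 0 (g z - k) powr p) \<le> 20 * C * local_energy p g"
proof -
  define D where "D z = (\<Sum>z'\<in>{z' \<in> Z. dist z z' < s}. norm (g z' - g z) powr p)" for z
  \<comment> \<open>\<open>t z\<close> dominates all increments of \<open>g\<close> from
    \<open>z\<close> to its \<open>s\<close>-neighbours, so the \<open>p\<close>-th power of
    \<open>u + t\<close> can serve as \<open>v\<close> in \<open>coarea\<close>.\<close>
  define t where "t z = D z powr (1 / p)" for z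
  define u where "u z = max 0 (g z - k)" for z
  have D0: "0 \<le> D z" for z by (simp add: D_def sum_nonneg)
  have tp: "t z powr p = D z" for z using p D0 by (simp add: t_def powr_powr)
  have u0: "0 \<le> u z" and t0: "0 \<le> t z" for z by (simp_all add: u_def t_def)
  have step: "u z' \<le> u z + t z" if "z \<in> Z" "z' \<in> Z" "dist z z' < s" for z z'
  proof -
    have "norm (g z' - g z) powr p \<le> D z"
      unfolding D_def using Z that by (intro member_le_sum) auto
    hence "(norm (g z' - g z) powr p) powr (1 / p) \<le> t z"
      unfolding t_def using p by (intro powr_mono2) auto
    hence "\<bar>g z' - g z\<bar> \<le> t z" using p by (simp add: powr_powr)
    thus ?thesis using t0[of z] by (auto simp: u_def)
  qed
  have "(\<Sum>z\<in>Z. m z * u z powr p) \<le> 10 * (\<Sum>z\<in>Z. m z * ((u z + t z) powr p - u z powr p))"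
  proof (rule coarea)
    have "{z \<in> Z. 0 < u z powr p} \<subseteq> {z \<in> Z. k < g z}" by (auto simp: u_def)
    hence "sum m {z \<in> Z. 0 < u z powr p} \<le> sum m {z \<in> Z. k < g z}"
      using Z m by (intro sum_mono2) auto
    thus "sum m {z \<in> Z. 0 < u z powr p} \<le> sum m Z / 2" using k by linarith
    show "u z powr p \<le> (u z + t z) powr p" for z using p u0 t0 by (intro powr_mono2) auto
    show "u z' powr p \<le> (u z + t z) powr p" if "z \<in> Z" "z' \<in> Z" "dist z z' < s" for z z'
      using p u0 step[OF that] by (intro powr_mono2) auto
  qed simp
  also have "\<dots> \<le> 10 * (\<Sum>z\<in>Z. m z * (1 / 20 * u z powr p + C * D z))"
  proof (intro mult_left_mono sum_mono m)
    show "(u z + t z) powr p - u z powr p \<le> 1 / 20 * u z powr p + C * D z" for z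
      using C(2)[OF u0 t0, of z z] by (simp add: tp algebra_simps)
  qed simp
  \<comment> \<open>The factor 10 * 1/20 = 1/2 lets this term be absorbed into the left
    side.\<close>
  also have "\<dots> = (\<Sum>z\<in>Z. m z * u z powr p) / 2 + 10 * C * local_energy p g"
    unfolding local_energy_def D_def[symmetric]
    by (simp add: sum_distrib_left sum.distrib sum_divide_distrib algebra_simps)
  finally show ?thesis by (simp add: u_def)
qed

text \<open>Comparison through the median \<open>k\<close>: the positive parts of
  \<open>g - k\<close> and of its negative both have support of at most half the mass, and the
  double sum reduces to distances from \<open>k\<close> by the triangle inequality.\<close>

lemma poincare_real:
  fixes g :: "'y \<Rightarrow> real"
  assumes p: "1 \<le> p" and C: "0 \<le> C"
    "\<And>u t. 0 \<le> u \<Longrightarrow> 0 \<le> t \<Longrightarrow> (u + t) powr p \<le> (1 + 1 / 20) * u powr p + C * t powr p"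
  shows "(\<Sum>a\<in>Z. \<Sum>b\<in>Z. m a * m b * \<bar>g a - g b\<bar> powr p) \<le> 2 powr p * 80 * C * local_energy p g"
proof (cases "Z = {}")
  case False
  obtain k where k: "sum m {z \<in> Z. k < g z} \<le> sum m Z / 2" "sum m {z \<in> Z. g z < k} \<le> sum m Z / 2"
    using median[OF False] .
  define S where "S = (\<Sum>z\<in>Z. m z * \<bar>g z - k\<bar> powr p)"
  have "S \<le> (\<Sum>z\<in>Z. m z * max 0 (g z - k) powr p) + (\<Sum>z\<in>Z. m z * max 0 (- g z - (- k)) powr p)"
    unfolding S_def sum.distrib[symmetric] distrib_left[symmetric]
    by (intro sum_mono mult_left_mono m) (auto simp: max_def abs_if)
  also have "\<dots> \<le> 20 * C * local_energy p g + 20 * C * local_energy p (\<lambda>z. - g z)"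
    using k by (intro add_mono poincare_positive_part p C) auto
  also have "local_energy p (\<lambda>z. - g z) = local_energy p g"
    by (simp add: local_energy_def abs_minus_commute)
  finally have S: "S \<le> 40 * C * local_energy p g" by simp
  have S0: "0 \<le> S" by (auto simp: S_def intro!: sum_nonneg mult_nonneg_nonneg m)
  have "(\<Sum>a\<in>Z. \<Sum>b\<in>Z. m a * m b * \<bar>g a - g b\<bar> powr p)
      \<le> (\<Sum>a\<in>Z. \<Sum>b\<in>Z. m a * m b * (2 powr p * (\<bar>g a - k\<bar> powr p + \<bar>g b - k\<bar> powr p)))"
  proof (intro sum_mono mult_left_mono mult_nonneg_nonneg m)
    fix a b
    have "\<bar>g a - g b\<bar> powr p \<le> (\<bar>g a - k\<bar> + \<bar>g b - k\<bar>) powr p"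
      using p by (intro powr_mono2) auto
    also have "\<dots> \<le> 2 powr p * (\<bar>g a - k\<bar> powr p + \<bar>g b - k\<bar> powr p)"
      using p by (intro powr_add_le_two) auto
    finally show "\<bar>g a - g b\<bar> powr p \<le> 2 powr p * (\<bar>g a - k\<bar> powr p + \<bar>g b - k\<bar> powr p)" .
  qed
  also have "\<dots> = (\<Sum>a\<in>Z. \<Sum>b\<in>Z. 2 powr p * ((m a * \<bar>g a - k\<bar> powr p) * m b))
      + (\<Sum>a\<in>Z. \<Sum>b\<in>Z. 2 powr p * (m a * (m b * \<bar>g b - k\<bar> powr p)))"
    by (simp add: sum.distrib[symmetric] algebra_simps)
  also have "\<dots> = 2 powr p * (S * sum m Z) + 2 powr p * (sum m Z * S)"
    unfolding S_def sum_product by (simp add: sum_distrib_left)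
  also have "\<dots> = 2 * 2 powr p * S * sum m Z" by simp
  also have "\<dots> \<le> 2 * 2 powr p * S * 1"
    using S0 mZ by (intro mult_left_mono) auto
  also have "\<dots> \<le> 2 * 2 powr p * (40 * C * local_energy p g)"
    using S by simp
  finally show ?thesis by simp
next
  case True
  thus ?thesis unfolding local_energy_def by simp
qed

lemma poincare_complex:
  fixes g :: "'y \<Rightarrow> complex"
  assumes p: "1 \<le> p" and C: "0 \<le> C"
    "\<And>u t. 0 \<le> u \<Longrightarrow> 0 \<le> t \<Longrightarrow> (u + t) powr p \<le> (1 + 1 / 20) * u powr p + C * t powr p"
  shows "(\<Sum>a\<in>Z. \<Sum>b\<in>Z. m a * m b * cmod (g a - g b) powr p)
    \<le> 2 powr p * (2 * (2 powr p * 80 * C * local_energy p g))"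
proof -
  let ?S = "\<lambda>h :: 'y \<Rightarrow> real. (\<Sum>a\<in>Z. \<Sum>b\<in>Z. m a * m b * \<bar>h a - h b\<bar> powr p)"
  have le: "?S h \<le> 2 powr p * 80 * C * local_energy p g"
    if "\<And>a b. \<bar>h a - h b\<bar> \<le> cmod (g a - g b)" for h
  proof -
    have "local_energy p h \<le> local_energy p g"
      unfolding local_energy_def
      by (intro sum_mono mult_left_mono m powr_mono2) (use p that in auto)
    hence "2 powr p * 80 * C * local_energy p h \<le> 2 powr p * 80 * C * local_energy p g"
      using C(1) by (intro mult_left_mono) auto
    thus ?thesis using poincare_real[OF p C, of h] by linarith
  qed
  have "(\<Sum>a\<in>Z. \<Sum>b\<in>Z. m a * m b * cmod (g a - g b) powr p)
    \<le> (\<Sum>a\<in>Z. \<Sum>b\<in>Z. m a * m b *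
        (2 powr p * (\<bar>Re (g a) - Re (g b)\<bar> powr p + \<bar>Im (g a) - Im (g b)\<bar> powr p)))"
  proof (intro sum_mono mult_left_mono mult_nonneg_nonneg m)
    fix a b
    have "cmod (g a - g b) powr p \<le> (\<bar>Re (g a) - Re (g b)\<bar> + \<bar>Im (g a) - Im (g b)\<bar>) powr p"
      using p cmod_le[of "g a - g b"] by (intro powr_mono2) auto
    also have "\<dots> \<le> 2 powr p * (\<bar>Re (g a) - Re (g b)\<bar> powr p + \<bar>Im (g a) - Im (g b)\<bar> powr p)"
      using p by (intro powr_add_le_two) auto
    finally show "cmod (g a - g b) powr p
      \<le> 2 powr p * (\<bar>Re (g a) - Re (g b)\<bar> powr p + \<bar>Im (g a) - Im (g b)\<bar> powr p)" .
  qed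
  also have "\<dots> = 2 powr p * (?S (\<lambda>z. Re (g z)) + ?S (\<lambda>z. Im (g z)))"
    by (simp add: sum.distrib[symmetric] sum_distrib_left algebra_simps)
  also have "\<dots> \<le> 2 powr p * (2 * (2 powr p * 80 * C * local_energy p g))"
    using le[of "\<lambda>z. Re (g z)"] le[of "\<lambda>z. Im (g z)"]
      abs_Re_le_cmod[of "g _ - g _"] abs_Im_le_cmod[of "g _ - g _"]
    by (intro mult_left_mono) auto
  finally show ?thesis .
qed

end

lemma integrable_Lp_diff:
  assumes p: "1 \<le> p" and f: "f \<in> Lp p \<nu>" and g: "g \<in> Lp p \<nu>"
  shows "integrable \<nu> (\<lambda>z. cmod (f z - g z) powr p)"
proof (rule Bochner_Integration.integrable_bound)
  show "integrable \<nu> (\<lambda>z. 2 powr p * (cmod (f z) powr p + cmod (g z) powr p))"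
    using f g by (intro integrable_mult_right integrable_add) (auto simp: Lp_def)
  show "(\<lambda>z. cmod (f z - g z) powr p) \<in> borel_measurable \<nu>"
    using f g by (auto simp: Lp_def)
  have "cmod (f z - g z) powr p \<le> 2 powr p * (cmod (f z) powr p + cmod (g z) powr p)" for z
  proof -
    have "cmod (f z - g z) powr p \<le> (cmod (f z) + cmod (g z)) powr p"
      using p norm_triangle_ineq4[of "f z" "g z"] by (intro powr_mono2) auto
    also have "\<dots> \<le> 2 powr p * (cmod (f z) powr p + cmod (g z) powr p)"
      using p by (intro powr_add_le_two) auto
    finally show ?thesis .
  qed
  thus "AE z in \<nu>. norm (cmod (f z - g z) powr p)
      \<le> norm (2 powr p * (cmod (f z) powr p + cmod (g z) powr p))"
    by (auto intro!: AE_I2)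
qed

text \<open>Integrating the scalar Poincare inequality over \<open>\<nu>\<close> bounds the mean of
  \<open>L a b\<close>, the \<open>p\<close>-th power of the distance between \<open>f a\<close> and
  \<open>f b\<close>, by a constant \<open>K\<close> that depends on \<open>s\<close> and
  \<open>f\<close> but not on the weight. Two Markov estimates then give a centre and a large set of
  points at bounded distance from it. This is where bounded geometry enters, through the number of
  \<open>s\<close>-neighbours.\<close>

lemma mass_in_ball:
  fixes f :: "'y::metric_space \<Rightarrow> 'z \<Rightarrow> complex" and \<nu> :: "'z measure"
  assumes bg: "bounded_geometry TYPE('y)" and p: "1 \<le> p" and f: "range f \<subseteq> Lp p \<nu>"
    and born: "\<And>R. \<exists>S. \<forall>x y. dist x y \<le> R \<longrightarrow> Lp_dist p \<nu> (f x) (f y) \<le> S"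
    and expd: "\<And>R. \<exists>S. \<forall>x y. Lp_dist p \<nu> (f x) (f y) \<le> R \<longrightarrow> dist x y \<le> S"
  obtains r where "\<And>F (m :: 'y \<Rightarrow> real). finite F \<Longrightarrow> (\<And>y. 0 \<le> m y) \<Longrightarrow> 9 / 10 \<le> sum m F \<Longrightarrow> sum m F \<le> 1 \<Longrightarrow>
    (\<And>A B. A \<subseteq> F \<Longrightarrow> B \<subseteq> F \<Longrightarrow> (\<forall>a\<in>A. \<forall>b\<in>B. s \<le> dist a b) \<Longrightarrow>
      sum m A * sum m B \<le> 1 / 100) \<Longrightarrow> \<exists>y. 3 / 10 \<le> sum m (F \<inter> cball y r)"
proof -
  define L where "L a b = (\<integral>z. cmod (f a z - f b z) powr p \<partial>\<nu>)" for a b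
  have L0: "0 \<le> L a b" for a b by (simp add: L_def)
  have LD: "Lp_dist p \<nu> (f a) (f b) = L a b powr (1 / p)" for a b by (simp add: Lp_dist_def L_def)
  have L_eq: "L a b = Lp_dist p \<nu> (f a) (f b) powr p" for a b
    using p L0 by (simp add: LD powr_powr)
  have int: "integrable \<nu> (\<lambda>z. cmod (f a z - f b z) powr p)" for a b
    using f by (intro integrable_Lp_diff p) auto
  obtain C where C: "0 \<le> C"
    "\<And>u t. 0 \<le> u \<Longrightarrow> 0 \<le> t \<Longrightarrow> (u + t) powr p \<le> (1 + 1 / 20) * u powr p + C * t powr p"
    using powr_add_le[OF p, of "1 / 20"] by auto
  obtain N where N: "\<And>x :: 'y. finite (cball x (max s 1)) \<and> card (cball x (max s 1)) \<le> N"
    using bg unfolding bounded_geometry_def by (metis less_max_iff_disj zero_less_one)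
  obtain S where S: "\<And>x y. dist x y \<le> s \<Longrightarrow> Lp_dist p \<nu> (f x) (f y) \<le> S" using born by blast
  define C' where "C' = 2 powr p * (2 * (2 powr p * 80 * C))"
  have C': "0 \<le> C'" using C by (simp add: C'_def)
  define K where "K = C' * (real N * \<bar>S\<bar> powr p) + 1"
  have K: "K > 0" using C' by (auto simp: K_def intro: add_nonneg_pos)
  \<comment> \<open>Points with \<open>L a b \<le> 4 * K\<close>, which the second Markov estimate
    keeps, are within \<open>r\<close> of \<open>a\<close>.\<close>
  obtain r where r: "\<And>x y. Lp_dist p \<nu> (f x) (f y) \<le> (4 * K) powr (1 / p) \<Longrightarrow> dist x y \<le> r"
    using expd by blast
  show ?thesis
  proof (rule that[of r])
    fix F and m :: "'y \<Rightarrow> real"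
    assume F: "finite F" and m: "\<And>y. 0 \<le> m y" and M: "9 / 10 \<le> sum m F" "sum m F \<le> 1"
      and conc: "\<And>A B. A \<subseteq> F \<Longrightarrow> B \<subseteq> F \<Longrightarrow> (\<forall>a\<in>A. \<forall>b\<in>B. s \<le> dist a b) \<Longrightarrow>
        sum m A * sum m B \<le> 1 / 100"
    have "\<exists>Z\<subseteq>F. 8 / 10 \<le> sum m Z \<and> (\<forall>A\<subseteq>Z. sum m A \<le> sum m Z / 2 \<longrightarrow>
        sum m A \<le> 10 * sum m {z \<in> Z - A. \<exists>a\<in>A. dist a z < s})"
      by (rule concentrated_isoperimetric_subset) (fact F m M conc)+
    then obtain Z where ZF: "Z \<subseteq> F" and Z8: "8 / 10 \<le> sum m Z"
      and iso: "\<And>A. A \<subseteq> Z \<Longrightarrow> sum m A \<le> sum m Z / 2 \<Longrightarrow>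
        sum m A \<le> 10 * sum m {z \<in> Z - A. \<exists>a\<in>A. dist a z < s}"
      by blast
    have fZ: "finite Z" using ZF F finite_subset by blast
    have mZ: "sum m Z \<le> 1" using sum_mono2[OF F ZF, of m] m M(2) by simp
    interpret isoperimetric Z m s by standard (use fZ m mZ iso in auto)
    have "(\<Sum>a\<in>Z. \<Sum>b\<in>Z. m a * m b * L a b)
      = (\<integral>w. (\<Sum>a\<in>Z. \<Sum>b\<in>Z. m a * m b * cmod (f a w - f b w) powr p) \<partial>\<nu>)"
      unfolding L_def by (simp add: int)
    also have "\<dots> \<le> (\<integral>w. C' * (\<Sum>z\<in>Z. m z * (\<Sum>z'\<in>{z' \<in> Z. dist z z' < s}.
        cmod (f z' w - f z w) powr p)) \<partial>\<nu>)"
    proof (intro integral_mono)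
      show "(\<Sum>a\<in>Z. \<Sum>b\<in>Z. m a * m b * cmod (f a w - f b w) powr p)
          \<le> C' * (\<Sum>z\<in>Z. m z * (\<Sum>z'\<in>{z' \<in> Z. dist z z' < s}. cmod (f z' w - f z w) powr p))" for w
        using poincare_complex[OF p C, of "\<lambda>a. f a w"] by (simp add: C'_def local_energy_def mult.assoc)
    qed (auto intro!: Bochner_Integration.integrable_sum integrable_mult_right int)
    also have "\<dots> = C' * (\<Sum>z\<in>Z. m z * (\<Sum>z'\<in>{z' \<in> Z. dist z z' < s}. L z' z))"
      unfolding L_def by (simp add: int)
    also have "\<dots> \<le> C' * (\<Sum>z\<in>Z. m z * (real N * \<bar>S\<bar> powr p))"
    proof (intro mult_left_mono sum_mono m C')
      fix z
      have "(\<Sum>z'\<in>{z' \<in> Z. dist z z' < s}. L z' z) \<le> of_nat (card {z' \<in> Z. dist z z' < s}) * \<bar>S\<bar> powr p"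
      proof (rule sum_bounded_above)
        fix z' assume "z' \<in> {z' \<in> Z. dist z z' < s}"
        hence "Lp_dist p \<nu> (f z') (f z) \<le> \<bar>S\<bar>"
          using S[of z' z] by (simp add: dist_commute)
        moreover have "0 \<le> Lp_dist p \<nu> (f z') (f z)" by (simp add: LD)
        ultimately show "L z' z \<le> \<bar>S\<bar> powr p" unfolding L_eq using p by (intro powr_mono2) auto
      qed
      also have "card {z' \<in> Z. dist z z' < s} \<le> card (cball z (max s 1))"
        using N by (intro card_mono) auto
      also have "\<dots> \<le> N" using N by simp
      finally show "(\<Sum>z'\<in>{z' \<in> Z. dist z z' < s}. L z' z) \<le> real N * \<bar>S\<bar> powr p"
        by (simp add: mult_right_mono)
    qed
    also have "\<dots> = sum m Z * (C' * (real N * \<bar>S\<bar> powr p))"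
      by (simp add: sum_distrib_right[symmetric])
    also have "\<dots> \<le> 1 * (C' * (real N * \<bar>S\<bar> powr p))"
      using mZ C' by (intro mult_right_mono) auto
    finally have total: "(\<Sum>a\<in>Z. \<Sum>b\<in>Z. m a * m b * L a b) < K" by (simp add: K_def)
    \<comment> \<open>Otherwise the double sum would be at least 8/10 * 2 K, exceeding
      \<open>K\<close>. Points with \<open>L a b > 4 * K\<close> then have mass at most 1/2, and
      8/10 - 1/2 = 3/10 remains.\<close>
    have "\<exists>a\<in>Z. (\<Sum>b\<in>Z. m b * L a b) \<le> 2 * K"
    proof (rule ccontr)
      assume neg: "\<not> ?thesis"
      have "8 / 10 * (2 * K) \<le> sum m Z * (2 * K)" using Z8 K by (intro mult_right_mono) auto
      also have "\<dots> = (\<Sum>a\<in>Z. m a * (2 * K))" by (simp add: sum_distrib_right)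
      also have "\<dots> \<le> (\<Sum>a\<in>Z. m a * (\<Sum>b\<in>Z. m b * L a b))"
        using neg by (intro sum_mono mult_left_mono m) auto
      also have "\<dots> = (\<Sum>a\<in>Z. \<Sum>b\<in>Z. m a * m b * L a b)" by (simp add: sum_distrib_left mult.assoc)
      finally show False using total K by linarith
    qed
    then obtain a where a: "(\<Sum>b\<in>Z. m b * L a b) \<le> 2 * K" by blast
    define B where "B = {b \<in> Z. L a b \<le> 4 * K}"
    have "sum m (Z - B) * (4 * K) = (\<Sum>b\<in>Z - B. m b * (4 * K))" by (simp add: sum_distrib_right)
    also have "\<dots> \<le> (\<Sum>b\<in>Z - B. m b * L a b)"
      by (intro sum_mono mult_left_mono m) (auto simp: B_def)
    also have "\<dots> \<le> (\<Sum>b\<in>Z. m b * L a b)"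
      using fZ by (intro sum_mono2) (auto intro: mult_nonneg_nonneg m L0)
    finally have "sum m (Z - B) * (4 * K) \<le> 2 * K" using a by linarith
    hence "sum m (Z - B) * 2 * (2 * K) \<le> 1 * (2 * K)" by (simp add: mult.commute mult.left_commute)
    hence "sum m (Z - B) * 2 \<le> 1" using K by (subst (asm) mult_le_cancel_right) auto
    moreover have "sum m (Z - B) = sum m Z - sum m B" using fZ by (intro sum_diff) (auto simp: B_def)
    ultimately have "3 / 10 \<le> sum m B" using Z8 by linarith
    also have "sum m B \<le> sum m (F \<inter> cball a r)"
    proof (intro sum_mono2 subsetI)
      fix b assume b: "b \<in> B"
      hence "L a b powr (1 / p) \<le> (4 * K) powr (1 / p)"
        using p L0 by (intro powr_mono2) (auto simp: B_def)
      thus "b \<in> F \<inter> cball a r" using r[of a b] b ZF by (auto simp: LD B_def)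
    qed (use F m in auto)
    finally show "\<exists>y. 3 / 10 \<le> sum m (F \<inter> cball y r)" by blast
  qed
qed

section \<open>Coarse embeddings\<close>

text \<open>Replaces control functions by two bounds, one at each scale. The distances are arbitrary
  nonnegative functions so that \<open>Lp_dist\<close> is covered.\<close>

lemma coarse_embeddingI:
  assumes d: "\<And>x y. 0 \<le> d x y" and d': "\<And>x y. 0 \<le> d' x y"
    and born: "\<And>R. \<exists>S. \<forall>x y. d x y \<le> R \<longrightarrow> d' (f x) (f y) \<le> S"
    and expd: "\<And>R. \<exists>S. \<forall>x y. d' (f x) (f y) \<le> R \<longrightarrow> d x y \<le> S"
  shows "coarse_embedding d d' f"
proof -
  \<comment> \<open>Inserting \<open>t\<close> keeps both sets nonempty and makes the control
    functions unbounded even when the distances are bounded.\<close>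
  define up where "up t = insert t {d' (f x) (f y) |x y. d x y \<le> t}" for t
  define lo where "lo t = insert t {d' (f x) (f y) |x y. t \<le> d x y}" for t
  have bu: "bdd_above (up t)" for t
  proof -
    obtain S where "\<And>x y. d x y \<le> t \<Longrightarrow> d' (f x) (f y) \<le> S" using born by blast
    thus ?thesis by (intro bdd_aboveI[of _ "max t S"]) (auto simp: up_def le_max_iff_disj)
  qed
  have bl: "bdd_below (lo t)" for t
    using d' by (intro bdd_belowI[of _ "min t 0"]) (auto simp: lo_def min_le_iff_disj)
  have "control_function (\<lambda>t. Sup (up t))"
    unfolding control_function_def
  proof (intro conjI)
    show "mono_on {0..} (\<lambda>t. Sup (up t))"
    proof (rule mono_onI)
      fix s t :: real assume "s \<le> t"
      show "Sup (up s) \<le> Sup (up t)"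
      proof (rule cSup_mono[OF _ bu])
        fix b assume "b \<in> up s"
        thus "\<exists>a\<in>up t. b \<le> a" using \<open>s \<le> t\<close> by (force simp: up_def)
      qed (simp add: up_def)
    qed
    have ge: "t \<le> Sup (up t)" for t by (rule cSup_upper[OF _ bu]) (simp add: up_def)
    show "(\<lambda>t. Sup (up t)) ` {0..} \<subseteq> {0..}" by (auto intro: order_trans[OF _ ge])
    show "\<not> bdd_above ((\<lambda>t. Sup (up t)) ` {0..})"
    proof
      assume "bdd_above ((\<lambda>t. Sup (up t)) ` {0..})"
      then obtain M where "\<And>t. t \<ge> 0 \<Longrightarrow> Sup (up t) \<le> M" by (auto simp: bdd_above_def)
      from this[of "\<bar>M\<bar> + 1"] ge[of "\<bar>M\<bar> + 1"] show False by simp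
    qed
  qed
  moreover have "control_function (\<lambda>t. Inf (lo t))"
    unfolding control_function_def
  proof (intro conjI)
    show "mono_on {0..} (\<lambda>t. Inf (lo t))"
    proof (rule mono_onI)
      fix s t :: real assume "s \<le> t"
      show "Inf (lo s) \<le> Inf (lo t)"
      proof (rule cInf_mono[OF _ bl])
        fix b assume "b \<in> lo t"
        thus "\<exists>a\<in>lo s. a \<le> b" using \<open>s \<le> t\<close> by (force simp: lo_def)
      qed (simp add: lo_def)
    qed
    show "(\<lambda>t. Inf (lo t)) ` {0..} \<subseteq> {0..}"
      using d' by (auto intro!: cInf_greatest simp: lo_def)
    show "\<not> bdd_above ((\<lambda>t. Inf (lo t)) ` {0..})"
    proof
      assume "bdd_above ((\<lambda>t. Inf (lo t)) ` {0..})"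
      then obtain M where M: "\<And>t. t \<ge> 0 \<Longrightarrow> Inf (lo t) \<le> M" by (auto simp: bdd_above_def)
      obtain S where S: "\<And>x y. d' (f x) (f y) \<le> M + 1 \<Longrightarrow> d x y \<le> S" using expd by blast
      define t where "t = \<bar>S\<bar> + \<bar>M\<bar> + 1"
      have "M + 1 \<le> Inf (lo t)"
      proof (rule cInf_greatest)
        fix b assume "b \<in> lo t"
        then consider "b = t" | x y where "b = d' (f x) (f y)" "t \<le> d x y" by (auto simp: lo_def)
        thus "M + 1 \<le> b"
        proof cases
          case 2
          thus ?thesis using S[of x y] by (force simp: t_def)
        qed (simp add: t_def)
      qed (simp add: lo_def)
      thus False using M[of t] by (simp add: t_def)
    qed
  qed
  moreover have "d' (f x) (f y) \<le> Sup (up (d x y))" for x y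
    by (rule cSup_upper[OF _ bu]) (auto simp: up_def)
  moreover have "Inf (lo (d x y)) \<le> d' (f x) (f y)" for x y
    by (rule cInf_lower[OF _ bl]) (auto simp: lo_def)
  ultimately show ?thesis unfolding coarse_embedding_def by blast
qed

lemma coarse_embeddingD:
  assumes f: "coarse_embedding d d' f" and d: "\<And>x y. 0 \<le> d x y"
  shows "\<exists>S. \<forall>x y. d x y \<le> R \<longrightarrow> d' (f x) (f y) \<le> S"
    and "\<exists>S. \<forall>x y. d' (f x) (f y) \<le> R \<longrightarrow> d x y \<le> S"
proof -
  obtain \<rho> \<sigma> where c: "control_function \<rho>" "control_function \<sigma>"
    and b: "\<And>x y. \<rho> (d x y) \<le> d' (f x) (f y)" "\<And>x y. d' (f x) (f y) \<le> \<sigma> (d x y)"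
    using f unfolding coarse_embedding_def by blast
  \<comment> \<open>Control functions are monotone only on nonnegative reals, and \<open>R\<close>
    may be negative.\<close>
  have "d' (f x) (f y) \<le> \<sigma> (max 0 R)" if "d x y \<le> R" for x y
  proof -
    have "\<sigma> (d x y) \<le> \<sigma> (max 0 R)"
      using c(2) that d unfolding control_function_def by (intro mono_onD[of "{0..}" \<sigma>]) auto
    thus ?thesis using b(2)[of x y] by linarith
  qed
  thus "\<exists>S. \<forall>x y. d x y \<le> R \<longrightarrow> d' (f x) (f y) \<le> S" by blast
  obtain t where t: "t \<ge> 0" "R < \<rho> t"
    using c(1) unfolding control_function_def bdd_above_def by (auto simp: not_le)
  have "d x y \<le> t" if "d' (f x) (f y) \<le> R" for x y
  proof (rule ccontr)
    assume "\<not> d x y \<le> t"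
    hence "\<rho> t \<le> \<rho> (d x y)"
      using c(1) t unfolding control_function_def by (intro mono_onD[of "{0..}" \<rho>]) auto
    thus False using b(1)[of x y] that t(2) by linarith
  qed
  thus "\<exists>S. \<forall>x y. d' (f x) (f y) \<le> R \<longrightarrow> d x y \<le> S" by blast
qed

lemma bounded_geometry_finite_cball:
  assumes "bounded_geometry TYPE('x::metric_space)"
  shows "finite (cball (x :: 'x) r)"
proof (rule finite_subset)
  show "cball x r \<subseteq> cball x (max r 1)" by auto
  show "finite (cball x (max r 1))"
    using assms unfolding bounded_geometry_def by (metis less_max_iff_disj zero_less_one)
qed

context roe_rigidity
begin

text \<open>The weights are the squared fibre norms of \<open>\<xi> x\<close>. The bound 1/10 for
  norms in \<open>concentration\<close> squares to the 1/100 of \<open>mass_in_ball\<close>,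
  discarding a tail of norm below 1/10 leaves mass at least 99/100, and mass 3/10 exceeds the square
  of 1/2.\<close>

lemma localizes_exists:
  fixes U :: "('x::metric_space, 'h) ell2 \<Rightarrow>\<^sub>L ('y::metric_space, 'h) ell2"
    and F :: "'y \<Rightarrow> 'z \<Rightarrow> complex" and \<nu> :: "'z measure"
  assumes X: "bounded_geometry TYPE('x)" and Y: "bounded_geometry TYPE('y)"
    and UV: "roe_unitary U V" and p: "1 \<le> p" and F: "range F \<subseteq> Lp p \<nu>"
    and born: "\<And>R. \<exists>S. \<forall>x y. dist x y \<le> R \<longrightarrow> Lp_dist p \<nu> (F x) (F y) \<le> S"
    and expd: "\<And>R. \<exists>S. \<forall>x y. Lp_dist p \<nu> (F x) (F y) \<le> R \<longrightarrow> dist x y \<le> S"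
  shows "\<exists>d r f. localizes U d r f"
proof -
  define \<xi> where "\<xi> x = U (ell2_single x e)" for x
  have n\<xi>: "norm (\<xi> x) = 1" for x using e by (simp add: \<xi>_def roe_unitaryD[OF UV])
  obtain s where s: "\<And>x A B. (\<forall>a\<in>A. \<forall>b\<in>B. s \<le> dist a b) \<Longrightarrow>
      norm (ell2_restrict A (\<xi> x)) * norm (ell2_restrict B (\<xi> x)) \<le> 1 / 10"
    using concentration[OF bounded_geometry_finite_cball[OF X] UV, of "1 / 10"]
    unfolding \<xi>_def by auto
  obtain r where r: "\<And>G (m :: 'y \<Rightarrow> real). finite G \<Longrightarrow> (\<And>y. 0 \<le> m y) \<Longrightarrow> 9 / 10 \<le> sum m G \<Longrightarrow>
      sum m G \<le> 1 \<Longrightarrow> (\<And>A B. A \<subseteq> G \<Longrightarrow> B \<subseteq> G \<Longrightarrow> (\<forall>a\<in>A. \<forall>b\<in>B. s \<le> dist a b) \<Longrightarrow>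
      sum m A * sum m B \<le> 1 / 100) \<Longrightarrow> \<exists>y. 3 / 10 \<le> sum m (G \<inter> cball y r)"
    using mass_in_ball[OF Y p F born expd, where s = s] by blast
  have "\<exists>y. 1 / 2 \<le> norm (ell2_restrict (cball y r) (\<xi> x))" for x
  proof -
    define m where "m y = (norm (ell2_apply (\<xi> x) y))\<^sup>2" for y
    have m_sum: "sum m A = (norm (ell2_restrict A (\<xi> x)))\<^sup>2" if "finite A" for A
      unfolding m_def by (rule norm_ell2_restrict_finite[OF that, symmetric])
    obtain G where G: "finite G" "norm (\<xi> x - ell2_restrict G (\<xi> x)) < 1 / 10"
      using ell2_finite_approx[of "1 / 10" "\<xi> x"] by auto
    have "\<exists>y. 3 / 10 \<le> sum m (G \<inter> cball y r)"
    proof (rule r[OF G(1)])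
      have "(norm (\<xi> x - ell2_restrict G (\<xi> x)))\<^sup>2 \<le> (1 / 10)\<^sup>2"
        using G(2) by (intro power_mono) auto
      thus "9 / 10 \<le> sum m G"
        unfolding m_sum[OF G(1)] norm_ell2_diff_restrict by (simp add: n\<xi> power2_eq_square)
      show "sum m G \<le> 1"
        unfolding m_sum[OF G(1)] using norm_ell2_restrict_le[of G "\<xi> x"] n\<xi>
        by (simp add: power_le_one)
      show "0 \<le> m y" for y by (simp add: m_def)
      fix A B assume AB: "A \<subseteq> G" "B \<subseteq> G" "\<forall>a\<in>A. \<forall>b\<in>B. s \<le> dist a b"
      have "(norm (ell2_restrict A (\<xi> x)) * norm (ell2_restrict B (\<xi> x)))\<^sup>2 \<le> (1 / 10)\<^sup>2"
        by (intro power_mono s AB) auto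
      thus "sum m A * sum m B \<le> 1 / 100"
        using AB G(1) by (simp add: m_sum finite_subset power_mult_distrib power_divide)
    qed
    then obtain y where y: "3 / 10 \<le> sum m (G \<inter> cball y r)" by blast
    have "ell2_restrict (G \<inter> cball y r) (\<xi> x) = ell2_restrict G (ell2_restrict (cball y r) (\<xi> x))"
      by simp
    hence "norm (ell2_restrict (G \<inter> cball y r) (\<xi> x)) \<le> norm (ell2_restrict (cball y r) (\<xi> x))"
      by (metis norm_ell2_restrict_le)
    hence "(norm (ell2_restrict (G \<inter> cball y r) (\<xi> x)))\<^sup>2 \<le> (norm (ell2_restrict (cball y r) (\<xi> x)))\<^sup>2"
      by (intro power_mono) auto
    hence "(1 / 2)\<^sup>2 \<le> (norm (ell2_restrict (cball y r) (\<xi> x)))\<^sup>2"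
      using y G(1) by (simp add: m_sum power2_eq_square)
    hence "1 / 2 \<le> norm (ell2_restrict (cball y r) (\<xi> x))" by (rule power2_le_imp_le) simp
    thus ?thesis by blast
  qed
  then obtain f where "\<And>x. 1 / 2 \<le> norm (ell2_restrict (cball (f x) r) (\<xi> x))" by metis
  hence "localizes U (1 / 2) r f" by (simp add: localizes_def \<xi>_def)
  thus ?thesis by blast
qed

theorem roe_unitary_coarsely_equivalent:
  fixes U :: "('x::metric_space, 'h) ell2 \<Rightarrow>\<^sub>L ('y::metric_space, 'h) ell2" and \<nu> :: "'z measure"
  assumes X: "bounded_geometry TYPE('x)" and Y: "bounded_geometry TYPE('y)"
    and UV: "roe_unitary U V" and p: "1 \<le> p" and emb: "coarsely_embeds_into_Lp TYPE('y) p \<nu>"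
  shows "coarsely_equivalent TYPE('x) TYPE('y)"
proof -
  note finX = bounded_geometry_finite_cball[OF X] and finY = bounded_geometry_finite_cball[OF Y]
  note VU = roe_unitary_sym[OF UV]
  obtain F :: "'y \<Rightarrow> 'z \<Rightarrow> complex" where F: "range F \<subseteq> Lp p \<nu>" "coarse_embedding dist (Lp_dist p \<nu>) F"
    using emb unfolding coarsely_embeds_into_Lp_def by blast
  note FD = coarse_embeddingD[OF F(2) zero_le_dist]
  obtain d r f where f: "localizes U d r f" using localizes_exists[OF X Y UV p F(1) FD] by blast
  note born = localizes_bornologous[OF finX UV f] and expd = localizes_expansive[OF finY UV f]
  obtain d' r' g where g: "localizes V d' r' g"
  proof -
    have r: "range (\<lambda>x. F (f x)) \<subseteq> Lp p \<nu>" using F(1) by blast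
    have b: "\<exists>S. \<forall>x y. dist x y \<le> R \<longrightarrow> Lp_dist p \<nu> (F (f x)) (F (f y)) \<le> S" for R
      using born[of R] FD(1) by meson
    have x: "\<exists>S. \<forall>x y. Lp_dist p \<nu> (F (f x)) (F (f y)) \<le> R \<longrightarrow> dist x y \<le> S" for R
      using FD(2)[of R] expd by meson
    from localizes_exists[OF Y X VU p r b x] show ?thesis using that by blast
  qed
  obtain C where C: "\<And>y. dist y (f (g y)) \<le> C" using localizes_almost_inverse[OF finX UV f g] by blast
  have "coarse_embedding dist dist f" by (rule coarse_embeddingI) (use born expd in auto)
  moreover have "\<forall>y. \<exists>x. dist y (f x) \<le> max C 1" using C by (meson max.coboundedI1)
  ultimately show ?thesis unfolding coarsely_equivalent_def by (meson less_max_iff_disj zero_less_one)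
qed

end

lemma (in exhausting_projections) star_isomorphic_coarsely_equivalent:
  fixes \<nu> :: "'z measure"
  assumes X: "bounded_geometry TYPE('x::metric_space)" and Y: "bounded_geometry TYPE('y::metric_space)"
    and p: "1 \<le> p" and emb: "coarsely_embeds_into_Lp TYPE('y) p \<nu>" and h: "(h :: 'h) \<noteq> 0"
    and iso: "star_isomorphic (closure (core :: ('x, 'h) ell2_op set))
      (closure (core :: ('y, 'h) ell2_op set))"
  shows "coarsely_equivalent TYPE('x) TYPE('y)"
proof -
  \<comment> \<open>An error below \<open>norm h\<close> forces \<open>p0 h\<close> to be nonzero;
    normalised, it is the unit vector \<open>e\<close> fixed by \<open>p0\<close>.\<close>
  obtain p0 where p0: "p0 \<in> \<P>" "norm (p0 h - h) < norm h" using dense[of "norm h" h] h by auto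
  hence "p0 h \<noteq> 0" by auto
  define e where "e = (1 / norm (p0 h)) *\<^sub>R p0 h"
  have e: "norm e = 1" "p0 e = e"
    using \<open>p0 h \<noteq> 0\<close> by (simp_all add: e_def blinfun.scaleR_right proj_idem[OF p0(1)])
  interpret roe_rigidity \<P> e p0 by standard (use e p0 in auto)
  have "norm (ell2_single (undefined :: 'x) e) = 1" using e by simp
  then obtain U V where "unitary_pair U V"
    "\<And>T. T \<in> closure core \<Longrightarrow> U o\<^sub>L T o\<^sub>L V \<in> closure core"
    "\<And>S. S \<in> closure core \<Longrightarrow> V o\<^sub>L S o\<^sub>L (U :: ('x, 'h) ell2 \<Rightarrow>\<^sub>L ('y, 'h) ell2) \<in> closure core"
    using star_isomorphic_unitary[OF iso rank_one_closure_core rank_one_closure_core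
        clinear_closure_core clinear_closure_core] by blast
  hence "roe_unitary U V" unfolding roe_unitary_def by blast
  thus ?thesis by (rule roe_unitary_coarsely_equivalent[OF X Y _ p emb])
qed

section \<open>Orthonormal bases\<close>

definition onb :: "(nat \<Rightarrow> 'a::chilbert_space) \<Rightarrow> bool"
  where "onb b \<longleftrightarrow> (\<forall>i j. cinner (b i) (b j) = (if i = j then 1 else 0)) \<and>
    (\<forall>v. (\<lambda>n. cinner v (b n) *\<^sub>C b n) sums v)"

lemma onbI_total:
  fixes b :: "nat \<Rightarrow> 'a::chilbert_space"
  assumes orth: "\<And>i j. cinner (b i) (b j) = (if i = j then 1 else 0)"
    and total: "\<And>v. (\<And>n. cinner v (b n) = 0) \<Longrightarrow> v = 0"
  shows "onb b"
proof -
  have n: "norm (b i) \<le> 1" for i using orth[of i i] by (simp add: norm_eq_sqrt_cinner)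
  have o: "i \<noteq> j \<Longrightarrow> cinner (b i) (b j) = 0" for i j by (simp add: orth)
  obtain T :: "'a \<Rightarrow>\<^sub>L 'a" where T: "\<And>v. (\<lambda>n. cinner v (b n) *\<^sub>C b n) sums T v"
    by (rule orthogonal_sum_operator[of b b]) (use n o in auto)
  have "T v = v" for v
  proof -
    have "cinner (T v) (b j) = cinner v (b j)" for j
    proof (rule sums_unique2)
      show "(\<lambda>n. cinner (cinner v (b n) *\<^sub>C b n) (b j)) sums cinner (T v) (b j)"
        by (rule bounded_linear.sums[OF cinner.bounded_linear_left T])
      have "(\<lambda>n. cinner (cinner v (b n) *\<^sub>C b n) (b j)) = (\<lambda>n. if n = j then cinner v (b n) else 0)"
        by (auto simp: cinner_scaleC_left orth)
      thus "(\<lambda>n. cinner (cinner v (b n) *\<^sub>C b n) (b j)) sums cinner v (b j)"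
        using sums_single[of j "\<lambda>n. cinner v (b n)"] by simp
    qed
    hence "v - T v = 0" by (intro total) (simp add: cinner_diff_left)
    thus ?thesis by simp
  qed
  thus ?thesis using T orth unfolding onb_def by metis
qed

text \<open>Gram-Schmidt along a dense sequence \<open>d\<close>. When \<open>d n\<close> already
  lies in the span of the earlier vectors, any vector outside that span is taken instead; infinite
  dimension supplies one, so the recursion yields exactly one basis vector for each index.\<close>

lemma onb_exists:
  assumes "infinite_dimensional_separable TYPE('h::chilbert_space)"
  shows "\<exists>b :: nat \<Rightarrow> 'h. onb b"
proof -
  obtain C :: "'h set" where C: "countable C" "closure C = UNIV"
    using assms unfolding infinite_dimensional_separable_def separable_space_def by auto
  have fd: "finite B \<Longrightarrow> cvec.span B \<noteq> UNIV" for B :: "'h set"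
    using assms unfolding infinite_dimensional_separable_def by blast
  define d where "d = from_nat_into C"
  have "C \<noteq> {}" using C(2) by auto
  hence ran: "range d = C" using C(1) by (simp add: d_def)
  \<comment> \<open>The last conjunct puts \<open>d n\<close> into the span of the vectors up to
    index \<open>n\<close>, which makes the family total by density.\<close>
  define P where "P f n v \<longleftrightarrow> norm v = 1 \<and> (\<forall>i<n. cinner v (f i) = 0) \<and>
    d n = (\<Sum>i<n. cinner (d n) (f i) *\<^sub>C f i) + cinner (d n) v *\<^sub>C v" for f :: "nat \<Rightarrow> 'h" and n v
  have "\<exists>f. \<forall>n. P f n (f n)"
  proof (rule dependent_wellorder_choice)
    show "P f n v = P g n v" if "\<And>m. m < n \<Longrightarrow> f m = g m" for n v f g
      using that by (simp add: P_def)
    fix n f assume IH: "\<And>m. m < n \<Longrightarrow> P f m (f m)"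
    have orth: "cinner (f i) (f j) = (if i = j then 1 else 0)" if "i < n" "j < n" for i j
    proof (cases i j rule: linorder_cases)
      case less
      have "cinner (f j) (f i) = 0" using IH[OF that(2)] less by (simp add: P_def)
      thus ?thesis using less by (metis cinner_commute complex_cnj_zero less_irrefl)
    qed (use IH[of i] IH[of j] that in \<open>auto simp: P_def cinner_self\<close>)
    define q where "q v = v - (\<Sum>i<n. cinner v (f i) *\<^sub>C f i)" for v
    have q_orth: "cinner (q v) (f j) = 0" if "j < n" for v j
    proof -
      have "cinner (\<Sum>i<n. cinner v (f i) *\<^sub>C f i) (f j) = (\<Sum>i<n. if i = j then cinner v (f j) else 0)"
        unfolding cinner.sum_left cinner_scaleC_left using orth that by (intro sum.cong) auto
      thus ?thesis using that by (simp add: q_def cinner_diff_left)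
    qed
    have ex: "\<exists>w. q w \<noteq> 0 \<and> (q (d n) \<noteq> 0 \<longrightarrow> w = d n)"
    proof (cases "q (d n) = 0")
      case True
      obtain w where w: "w \<notin> cvec.span (f ` {..<n})" using fd[of "f ` {..<n}"] by auto
      have "q w \<noteq> 0"
      proof
        assume "q w = 0"
        hence "w = (\<Sum>i<n. cinner w (f i) *\<^sub>C f i)" by (simp add: q_def)
        also have "\<dots> \<in> cvec.span (f ` {..<n})"
          by (intro cvec.span_sum cvec.span_scale cvec.span_base) auto
        finally show False using w by blast
      qed
      thus ?thesis using True by blast
    qed blast
    then obtain w where w: "q w \<noteq> 0" "q (d n) \<noteq> 0 \<longrightarrow> w = d n" by blast
    define v where "v = (1 / norm (q w)) *\<^sub>R q w"
    have nv: "norm v = 1" using w by (simp add: v_def)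
    have vo: "cinner v (f i) = 0" if "i < n" for i using q_orth[OF that] by (simp add: v_def cinner_scaleR_left)
    have "cinner (d n) v *\<^sub>C v = q (d n)"
    proof -
      have "cinner (f i) v = 0" if "i < n" for i using vo[OF that] by (metis cinner_commute complex_cnj_zero)
      hence eq: "cinner (d n) v = cinner (q (d n)) v"
        by (simp add: q_def cinner_diff_left cinner.sum_left cinner_scaleC_left)
      show ?thesis
      proof (cases "q (d n) = 0")
        case False
        hence "w = d n" using w by blast
        hence "q (d n) = norm (q w) *\<^sub>R v" using w by (simp add: v_def)
        thus ?thesis unfolding eq using nv by (simp add: cinner_scaleC_left cinner_self scaleR_scaleC)
      qed (simp add: eq cinner.zero_left)
    qed
    hence "P f n v" using nv vo by (simp add: P_def q_def)
    thus "\<exists>v. P f n v" by blast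
  qed
  then obtain b where b: "\<And>n. P b n (b n)" by blast
  have orth: "cinner (b i) (b j) = (if i = j then 1 else 0)" for i j
  proof (cases i j rule: linorder_cases)
    case less
    have "cinner (b j) (b i) = 0" using b[of j] less by (simp add: P_def)
    thus ?thesis using less by (metis cinner_commute complex_cnj_zero less_irrefl)
  qed (use b[of i] in \<open>auto simp: P_def cinner_self\<close>)
  have "v = 0" if v: "\<And>n. cinner v (b n) = 0" for v
  proof -
    have "cinner v (d n) = 0" for n
    proof -
      have "d n = (\<Sum>i<n. cinner (d n) (b i) *\<^sub>C b i) + cinner (d n) (b n) *\<^sub>C b n"
        using b[of n] by (simp add: P_def)
      hence "cinner v (d n) = cinner v ((\<Sum>i<n. cinner (d n) (b i) *\<^sub>C b i) + cinner (d n) (b n) *\<^sub>C b n)"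
        by simp
      also have "\<dots> = 0"
        using v by (simp add: cinner_add_right cinner.sum_right cinner_scaleC_right)
      finally show ?thesis .
    qed
    hence "C \<subseteq> {u. cinner v u = 0}" using ran by auto
    moreover have "closed {u. cinner v u = 0}"
      by (intro closed_Collect_eq cinner.continuous_on continuous_intros)
    ultimately have "closure C \<subseteq> {u. cinner v u = 0}" by (rule closure_minimal)
    hence "cinner v v = 0" using C(2) by blast
    thus ?thesis by (simp add: cinner_self)
  qed
  thus ?thesis using onbI_total[of b] orth by blast
qed

lemma onb_sums: "onb b \<Longrightarrow> (\<lambda>n. cinner v (b n) *\<^sub>C b n) sums v"
  and onb_cinner: "onb b \<Longrightarrow> cinner (b i) (b j) = (if i = j then 1 else 0)"
  by (simp_all add: onb_def)

lemma onb_eq_0: "onb b \<Longrightarrow> (\<And>n. cinner v (b n) = 0) \<Longrightarrow> v = 0"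
  using onb_sums[of b v] sums_unique2[OF _ sums_zero] by simp

lemma norm_onb: "onb b \<Longrightarrow> norm (b i) = 1"
  by (simp add: norm_eq_sqrt_cinner onb_cinner)

definition onb_proj :: "(nat \<Rightarrow> 'h::chilbert_space) \<Rightarrow> nat \<Rightarrow> 'h \<Rightarrow>\<^sub>L 'h"
  where "onb_proj b m = (\<Sum>i<m. rank_one (b i) (b i))"

lemma onb_proj_apply: "onb_proj b m v = (\<Sum>i<m. cinner v (b i) *\<^sub>C b i)"
  by (simp add: onb_proj_def blinfun.sum_left)

lemma onb_proj_tendsto: "onb b \<Longrightarrow> (\<lambda>m. onb_proj b m v) \<longlonglongrightarrow> v"
  using onb_sums[of b v] by (simp add: onb_proj_apply sums_def)

lemma clinear_onb_proj: "clinear_op (onb_proj b m)"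
  unfolding onb_proj_def by (intro clinear_op_sum clinear_rank_one)

lemma onb_proj_basis: "onb b \<Longrightarrow> onb_proj b m (b i) = (if i < m then b i else 0)"
proof -
  assume b: "onb b"
  have "onb_proj b m (b i) = (\<Sum>j<m. if j = i then b j else 0)"
    unfolding onb_proj_apply using b by (intro sum.cong) (auto simp: onb_cinner)
  thus ?thesis by simp
qed

lemma onb_proj_absorb: "onb b \<Longrightarrow> m \<le> n \<Longrightarrow> onb_proj b n (onb_proj b m v) = onb_proj b m v"
  by (simp add: onb_proj_apply[of b m] blinfun.sum_right clinear_opD[OF clinear_onb_proj]
      onb_proj_basis)

lemma cinner_onb_proj: "cinner (onb_proj b m u) v = cinner u (onb_proj b m v)"
  by (simp add: onb_proj_apply cinner.sum_left cinner.sum_right cinner_scaleC_left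
      cinner_scaleC_right mult.commute)

lemma exhausting_onb_proj: "onb b \<Longrightarrow> exhausting_projections (range (onb_proj b))"
proof
  assume b: "onb b"
  fix \<epsilon> :: real and v assume "0 < \<epsilon>"
  hence "\<forall>\<^sub>F m in sequentially. dist (onb_proj b m v) v < \<epsilon>" using onb_proj_tendsto[OF b] by (rule tendstoD[rotated])
  thus "\<exists>p\<in>range (onb_proj b). norm (blinfun_apply p v - v) < \<epsilon>"
    by (auto simp: dist_norm dest: eventually_happens)
next
  fix p q assume b: "onb b" and "p \<in> range (onb_proj b)" "q \<in> range (onb_proj b)"
  then obtain m n where "p = onb_proj b m" "q = onb_proj b n" by blast
  thus "\<exists>r\<in>range (onb_proj b). (\<forall>v. blinfun_apply r (p v) = p v) \<and> (\<forall>v. blinfun_apply r (q v) = q v)"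
    using onb_proj_absorb[OF b, of _ "max m n"] by (intro bexI[of _ "onb_proj b (max m n)"]) auto
qed (auto simp: cinner_onb_proj clinear_onb_proj onb_proj_absorb)

lemma exhausting_id: "exhausting_projections {id_blinfun :: 'h::chilbert_space \<Rightarrow>\<^sub>L 'h}"
  by standard (auto simp: clinear_op_id)

section \<open>Finite-rank cutdowns of compact operators\<close>

lemma norm_blinfun_bound_unit:
  fixes T :: "'a::real_normed_vector \<Rightarrow>\<^sub>L 'b::real_normed_vector"
  assumes "\<And>v. norm v \<le> 1 \<Longrightarrow> norm (T v) \<le> e" "0 \<le> e"
  shows "norm T \<le> e"
proof (rule norm_blinfun_bound)
  fix v
  show "norm (T v) \<le> e * norm v"
  proof (cases "v = 0")
    case False
    have "norm (T ((1 / norm v) *\<^sub>R v)) \<le> e" by (rule assms(1)) simp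
    thus ?thesis using False by (simp add: blinfun.scaleR_right divide_le_eq)
  qed simp
qed (rule assms(2))

text \<open>On the right, vectors where the norm exceeds \<open>e\<close> become a weakly null
  sequence once the complementary projections are applied, because these move to the other side of
  the inner product; compactness finishes. On the left, strong convergence is uniform on the compact
  closure of the image of the ball.\<close>

lemma compact_op_onb_coproj:
  fixes k :: "'h::chilbert_space \<Rightarrow>\<^sub>L 'h"
  assumes b: "onb b" and k: "compact_op k" "clinear_op k" and e: "e > 0"
  shows "\<exists>m. norm (k o\<^sub>L (id_blinfun - onb_proj b m)) \<le> e \<and> norm ((id_blinfun - onb_proj b m) o\<^sub>L k) \<le> e"
proof -
  interpret exhausting_projections "range (onb_proj b)" by (rule exhausting_onb_proj[OF b])
  define q where "q m v = v - onb_proj b m v" for m v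
  have nq: "norm (q m v) \<le> norm v" for m v unfolding q_def by (rule norm_coproj_le) simp
  have q0: "(\<lambda>m. q m v) \<longlonglongrightarrow> 0" for v
    unfolding q_def using tendsto_diff[OF tendsto_const onb_proj_tendsto[OF b], of v v] by simp
  have right: "\<forall>\<^sub>F m in sequentially. norm (k o\<^sub>L (id_blinfun - onb_proj b m)) \<le> e"
  proof (rule ccontr)
    assume neg: "\<not> ?thesis"
    have "\<exists>v. norm v \<le> 1 \<and> (norm (k o\<^sub>L (id_blinfun - onb_proj b m)) > e \<longrightarrow> norm (k (q m v)) > e)" for m
    proof (cases "norm (k o\<^sub>L (id_blinfun - onb_proj b m)) > e")
      case True
      have "\<not> (\<forall>v. norm v \<le> 1 \<longrightarrow> norm ((k o\<^sub>L (id_blinfun - onb_proj b m)) v) \<le> e)"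
        using norm_blinfun_bound_unit[of "k o\<^sub>L (id_blinfun - onb_proj b m)" e] True e by force
      thus ?thesis by (auto simp: q_def blinfun.diff_left not_le)
    qed (auto intro: exI[of _ 0])
    then obtain v where v: "\<And>m. norm (v m) \<le> 1"
      "\<And>m. norm (k o\<^sub>L (id_blinfun - onb_proj b m)) > e \<Longrightarrow> norm (k (q m (v m))) > e" by metis
    have "(\<lambda>m. k (q m (v m))) \<longlonglongrightarrow> 0"
    proof (rule compact_op_weakly_null[OF k])
      show "norm (q m (v m)) \<le> 1" for m using nq v(1) order_trans by metis
      fix w
      show "(\<lambda>m. cinner (q m (v m)) w) \<longlonglongrightarrow> 0"
      proof (rule tendsto_norm_zero_cancel, rule tendsto_sandwich[OF _ _ tendsto_const tendsto_norm_zero[OF q0[of w]]])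
        have "cinner (q m (v m)) w = cinner (v m) (q m w)" for m
          by (simp add: q_def cinner_diff_left cinner_diff_right cinner_onb_proj)
        hence "cmod (cinner (q m (v m)) w) \<le> 1 * norm (q m w)" for m
          using order_trans[OF norm_cinner_le mult_right_mono[OF v(1)[of m] norm_ge_zero]] by simp
        thus "\<forall>\<^sub>F m in sequentially. cmod (cinner (q m (v m)) w) \<le> norm (q m w)" by simp
      qed simp
    qed
    hence "\<forall>\<^sub>F m in sequentially. dist (k (q m (v m))) 0 < e" using e by (rule tendstoD)
    hence "\<forall>\<^sub>F m in sequentially. norm (k o\<^sub>L (id_blinfun - onb_proj b m)) \<le> e"
      by (rule eventually_mono) (use v(2) in \<open>force simp: not_less[symmetric]\<close>)
    thus False using neg by blast
  qed
  have left: "\<forall>\<^sub>F m in sequentially. norm ((id_blinfun - onb_proj b m) o\<^sub>L k) \<le> e"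
  proof -
    have cK: "compact (closure (blinfun_apply k ` cball 0 1))" using k(1) by (simp add: compact_op_def)
    obtain G where G: "finite G"
      "closure (blinfun_apply k ` cball 0 1) \<subseteq> (\<Union>x\<in>G. ball x (e / 2))"
      by (rule compactE_image[OF cK, of "closure (blinfun_apply k ` cball 0 1)" "\<lambda>x. ball x (e / 2)"])
        (use e in auto)
    have "\<forall>\<^sub>F m in sequentially. \<forall>x\<in>G. norm (q m x) < e / 2"
    proof (intro eventually_ball_finite G ballI)
      fix x assume "x \<in> G"
      have "\<forall>\<^sub>F m in sequentially. dist (q m x) 0 < e / 2" using q0 e by (intro tendstoD) auto
      thus "\<forall>\<^sub>F m in sequentially. norm (q m x) < e / 2" by simp
    qed
    thus ?thesis
    proof (rule eventually_mono)
      fix m assume m: "\<forall>x\<in>G. norm (q m x) < e / 2"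
      have unit: "norm (q m (k v)) \<le> e" if "norm v \<le> 1" for v
      proof -
        have "k v \<in> closure (blinfun_apply k ` cball 0 1)"
          using that by (intro subsetD[OF closure_subset] imageI) simp
        then obtain x where x: "x \<in> G" "dist x (k v) < e / 2" using G(2) by auto
        have "q m (k v) = q m (k v - x) + q m x" by (simp add: q_def blinfun.diff_right)
        hence "norm (q m (k v)) \<le> norm (k v - x) + norm (q m x)"
          using norm_triangle_le[OF add_mono[OF nq[of m "k v - x"] order_refl[of "norm (q m x)"]]] by simp
        thus ?thesis using x m by (fastforce simp: dist_norm norm_minus_commute)
      qed
      show "norm ((id_blinfun - onb_proj b m) o\<^sub>L k) \<le> e"
        using unit e by (intro norm_blinfun_bound_unit) (auto simp: q_def blinfun.diff_left)
    qed
  qed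
  show ?thesis using eventually_happens[OF eventually_conj[OF right left]] by auto
qed

section \<open>The stabilised uniform Roe algebra\<close>

lift_definition ell2_slice_fun :: "'k::chilbert_space \<Rightarrow> ('x, 'k) ell2 \<Rightarrow> ('x, complex) ell2"
  is "\<lambda>h f x. cinner (f x) h"
proof -
  fix h :: 'k and f :: "'x \<Rightarrow> 'k"
  assume "(\<lambda>x. (norm (f x))\<^sup>2) summable_on UNIV"
  hence "(\<lambda>x. (norm (f x))\<^sup>2 * (norm h)\<^sup>2) summable_on UNIV" by (rule summable_on_cmult_left)
  thus "(\<lambda>x. (norm (cinner (f x) h))\<^sup>2) summable_on UNIV"
    by (rule summable_on_comparison_test)
      (auto simp: power_mult_distrib[symmetric] intro: power_mono norm_cinner_le)
qed

text \<open>This is \<open>1 \<otimes> <h|\<close>, and \<open>ell2_insert h\<close> is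
  \<open>1 \<otimes> |h>\<close>. For a basis \<open>b\<close>, inserting at \<open>b i\<close>
  after \<open>a\<close> after slicing at \<open>b j\<close> is \<open>a\<close> tensored with a
  matrix unit.\<close>

definition ell2_slice :: "'k::chilbert_space \<Rightarrow> ('x, 'k) ell2 \<Rightarrow>\<^sub>L ('x, complex) ell2"
  where "ell2_slice h = Blinfun (ell2_slice_fun h)"

lemma ell2_slice_apply [simp]: "ell2_apply (ell2_slice h f) x = cinner (ell2_apply f x) h"
proof -
  have "bounded_linear (ell2_slice_fun h :: ('a, 'b) ell2 \<Rightarrow> ('a, complex) ell2)"
  proof (rule bounded_linear_intro[where K = "norm h"])
    show "norm (ell2_slice_fun h f) \<le> norm f * norm h" for f :: "('a, 'b) ell2"
      using ell2_norm_le[of "ell2_slice_fun h f" "norm h" f] norm_cinner_le[of _ h]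
      by (simp add: ell2_slice_fun.rep_eq mult.commute[of "norm h"])
  qed (auto intro!: ell2_eqI simp: ell2_simps ell2_slice_fun.rep_eq cinner_add_left cinner.scaleR_left)
  thus ?thesis by (simp add: ell2_slice_def bounded_linear_Blinfun_apply ell2_slice_fun.rep_eq)
qed

definition ell2_insert :: "'k::chilbert_space \<Rightarrow> ('x, complex) ell2 \<Rightarrow>\<^sub>L ('x, 'k) ell2"
  where "ell2_insert h = Blinfun (\<lambda>\<xi>. ell2_tensor \<xi> h)"

lemma ell2_insert_eq [simp]:
  fixes \<xi> :: "('x, complex) ell2" and h :: "'k::chilbert_space"
  shows "ell2_insert h \<xi> = ell2_tensor \<xi> h"
proof -
  have "bounded_linear (\<lambda>\<xi> :: ('x, complex) ell2. ell2_tensor \<xi> h)"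
  proof (rule bounded_linear_intro[where K = "norm h"])
    show "norm (ell2_tensor \<xi> h) \<le> norm \<xi> * norm h" for \<xi> :: "('x, complex) ell2"
      using ell2_norm_le[of "ell2_tensor \<xi> h" "norm h" \<xi>]
      by (simp add: ell2_tensor.rep_eq mult.commute norm_scaleC)
  qed (auto intro!: ell2_eqI simp: ell2_simps ell2_tensor.rep_eq scaleC_add_left scaleC.scaleR_left)
  thus ?thesis by (simp add: ell2_insert_def bounded_linear_Blinfun_apply)
qed

lemma ell2_tensor_apply [simp]: "ell2_apply (ell2_tensor \<xi> h) x = ell2_apply \<xi> x *\<^sub>C h"
  by (simp add: ell2_tensor.rep_eq)

lemma scaleC_complex [simp]: "a *\<^sub>C (b :: complex) = a * b"
  by (simp add: scaleC_complex_def)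

lemma clinear_ell2_slice: "clinear_op (ell2_slice h)"
  and clinear_ell2_insert: "clinear_op (ell2_insert h)"
  by (auto simp: clinear_op_def ell2_simps cinner_scaleC_left scaleC_scaleC intro!: ell2_eqI)

lemma ell2_single_tensor: "ell2_single x h = ell2_tensor (ell2_single x 1) h"
  by (rule ell2_eqI) (auto simp: scaleC.zero_left cvec.scale_one)

lemma amp_tensor: "clinear_op p \<Longrightarrow> amp p (ell2_tensor \<xi> h) = ell2_tensor \<xi> (p h)"
  by (rule ell2_eqI) (simp add: clinear_opD)

lemma amp_onb_proj: "amp (onb_proj b m) f = (\<Sum>i<m. ell2_tensor (ell2_slice (b i) f) (b i))"
  by (rule ell2_eqI) (simp add: ell2_apply_sum onb_proj_apply)

lemma has_sum_finite_sum:
  fixes f :: "'i \<Rightarrow> 'a \<Rightarrow> 'b::topological_comm_monoid_add"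
  assumes "\<And>i. i \<in> I \<Longrightarrow> (f i has_sum s i) A"
  shows "((\<lambda>x. \<Sum>i\<in>I. f i x) has_sum (\<Sum>i\<in>I. s i)) A"
  using assms by (induction I rule: infinite_finite_induct) (auto intro: has_sum_add)

text \<open>Parseval in each fibre, summed over \<open>x\<close>; it reduces norms over the fibre
  space to scalar slices.\<close>

lemma norm_amp_onb_proj:
  assumes b: "onb b"
  shows "(norm (amp (onb_proj b m) f))\<^sup>2 = (\<Sum>i<m. (norm (ell2_slice (b i) f))\<^sup>2)"
proof (rule has_sum_unique[OF norm_ell2_has_sum])
  have "(norm (ell2_apply (amp (onb_proj b m) f) x))\<^sup>2 = (\<Sum>i<m. (norm (ell2_apply (ell2_slice (b i) f) x))\<^sup>2)" for x
    unfolding amp_apply onb_proj_apply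
    by (subst norm_sum_orthogonal) (use b in \<open>auto simp: onb_cinner norm_onb\<close>)
  thus "((\<lambda>x. (norm (ell2_apply (amp (onb_proj b m) f) x))\<^sup>2) has_sum
      (\<Sum>i<m. (norm (ell2_slice (b i) f))\<^sup>2)) UNIV"
    by (auto intro!: has_sum_finite_sum norm_ell2_has_sum simp del: ell2_slice_apply)
qed

context exhausting_projections
begin

lemma core_closure_image:
  assumes "bounded_linear f" "\<And>T. T \<in> S \<Longrightarrow> f T \<in> closure core" "T \<in> closure S"
  shows "f T \<in> closure core"
proof -
  have "f ` closure S \<subseteq> closure (f ` S)"
    by (rule closure_bounded_linear_image_subset[OF assms(1)])
  also have "\<dots> \<subseteq> closure core" using assms(2) by (intro closure_minimal) auto
  finally show ?thesis using assms(3) by blast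
qed

lemma closure_core_subspace: "cvec.subspace (closure core)"
proof (rule cvec.subspaceI)
  have "rank_one 0 0 = 0" by (rule blinfun_eqI) (simp add: scaleC.zero_right)
  thus "0 \<in> closure core" by (metis rank_one_closure_core)
next
  fix S T :: "('a, 'h) ell2_op" assume ST: "S \<in> closure core" "T \<in> closure core"
  then obtain s t where s: "\<And>n. s n \<in> core" "s \<longlonglongrightarrow> S" and t: "\<And>n. t n \<in> core" "t \<longlonglongrightarrow> T"
    unfolding closure_sequential by blast
  have "(\<lambda>n. s n + t n) \<longlonglongrightarrow> S + T" by (intro tendsto_add s t)
  thus "S + T \<in> closure core"
    unfolding closure_sequential
    by (intro exI[of _ "\<lambda>n. s n + t n"] conjI allI core_add s t)
next
  fix c and T :: "('a, 'h) ell2_op" assume T: "T \<in> closure core"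
  define m where "m = Blinfun (\<lambda>v :: ('a, 'h) ell2. c *\<^sub>C v)"
  have m: "c *\<^sub>C S = m o\<^sub>L S" for S :: "('a, 'h) ell2_op"
    by (rule blinfun_eqI)
      (simp add: m_def bounded_linear_Blinfun_apply scaleC.bounded_linear_right scaleC_blinfun.rep_eq)
  have "bounded_linear (\<lambda>S :: ('a, 'h) ell2_op. c *\<^sub>C S)"
    unfolding m by (rule bounded_bilinear.bounded_linear_right[OF bounded_bilinear_blinfun_compose])
  thus "c *\<^sub>C T \<in> closure core"
    by (rule core_closure_image[OF _ _ T]) (use core_scaleC closure_subset in blast)
qed

end

context
  fixes b :: "nat \<Rightarrow> 'k::chilbert_space"
  assumes b: "onb b"
begin

interpretation exhausting_projections "range (onb_proj b)"
  by (rule exhausting_onb_proj[OF b])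

lemma amp_onb_proj_tendsto:
  fixes f :: "('x, 'k) ell2"
  shows "(\<lambda>m. amp (onb_proj b m) f) \<longlonglongrightarrow> f"
proof (rule LIMSEQ_I)
  fix e :: real assume "e > 0"
  then obtain u p where u: "p \<in> range (onb_proj b)" "amp p u = u" "norm (f - u) < e / 2"
    using finite_support_dense[of "e / 2" f] by (metis half_gt_zero)
  then obtain N where N: "p = onb_proj b N" by blast
  have "norm (amp (onb_proj b m) f - f) < e" if "m \<ge> N" for m
  proof -
    have "amp (onb_proj b m) u = u"
      using onb_proj_absorb[OF b that] u(2) unfolding N by (metis amp_apply ell2_eqI)
    hence "amp (onb_proj b m) f - f = amp (onb_proj b m) (f - u) - (f - u)"
      by (simp add: blinfun.diff_right)
    also have "norm \<dots> \<le> norm (amp (onb_proj b m) (f - u)) + norm (f - u)"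
      by (rule norm_triangle_ineq4)
    also have "\<dots> \<le> norm (f - u) + norm (f - u)" by (intro add_mono norm_amp_le) auto
    finally show ?thesis using u(3) by simp
  qed
  thus "\<exists>N. \<forall>m\<ge>N. norm (amp (onb_proj b m) f - f) < e" by blast
qed

lemma insert_slice_core:
  fixes a :: "('x::metric_space, complex) ell2_op"
  assumes "clinear_op a" "finite_propagation a"
  shows "ell2_insert (b i) o\<^sub>L a o\<^sub>L ell2_slice (b j) \<in> core"
proof -
  let ?T = "ell2_insert (b i) o\<^sub>L a o\<^sub>L ell2_slice (b j)"
  have entry: "matrix_entry ?T x y = rank_one (matrix_entry a x y 1 *\<^sub>C b i) (b j)" for x y
  proof (rule blinfun_eqI)
    fix h
    have "ell2_slice (b j) (ell2_single y h) = cinner h (b j) *\<^sub>C ell2_single y 1"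
      by (rule ell2_eqI) (auto simp: ell2_simps cinner.zero_left)
    thus "matrix_entry ?T x y h = rank_one (matrix_entry a x y 1 *\<^sub>C b i) (b j) h"
      by (simp add: clinear_opD[OF assms(1)] ell2_simps scaleC_scaleC)
  qed
  have "finite_propagation ?T"
  proof -
    obtain R where R: "\<And>x y. R < dist x y \<Longrightarrow> matrix_entry a x y = 0"
      using finite_propagationE[OF assms(2)] by metis
    show ?thesis
    proof (rule finite_propagationI[of _ R], rule ccontr)
      fix x y assume *: "matrix_entry ?T x y \<noteq> 0" "\<not> dist x y \<le> R"
      hence "matrix_entry a x y 1 = 0" using R by (metis blinfun.zero_left not_le)
      hence "matrix_entry ?T x y = rank_one 0 (b j)" unfolding entry by (simp only: scaleC.zero_left)
      hence "matrix_entry ?T x y = 0" by (auto intro!: blinfun_eqI simp: scaleC.zero_right)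
      thus False using * by blast
    qed
  qed
  moreover have "locally_compact_op ?T"
    unfolding locally_compact_op_def entry by (simp add: compact_op_rank_one)
  \<comment> \<open>\<open>onb_proj b n\<close> spans the indices below \<open>n\<close>, so
    \<open>Suc\<close> is needed to include both \<open>i\<close> and \<open>j\<close>.\<close>
  moreover have "amp (onb_proj b (Suc (max i j))) o\<^sub>L ?T o\<^sub>L amp (onb_proj b (Suc (max i j))) = ?T"
  proof (rule blinfun_eqI)
    fix v :: "('x, 'k) ell2"
    have "ell2_slice (b j) (amp (onb_proj b (Suc (max i j))) v) = ell2_slice (b j) v"
      by (rule ell2_eqI) (simp add: cinner_onb_proj onb_proj_basis[OF b] less_Suc_eq_le)
    moreover have "amp (onb_proj b (Suc (max i j))) (ell2_tensor \<xi> (b i)) = ell2_tensor \<xi> (b i)" for \<xi> :: "('x, complex) ell2"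
      by (simp add: amp_tensor[OF clinear_onb_proj] onb_proj_basis[OF b] less_Suc_eq_le)
    ultimately show "(amp (onb_proj b (Suc (max i j))) o\<^sub>L ?T o\<^sub>L amp (onb_proj b (Suc (max i j)))) v = ?T v"
      by simp
  qed
  moreover have "clinear_op ?T"
    by (intro clinear_op_compose assms(1) clinear_ell2_slice clinear_ell2_insert)
  ultimately show ?thesis unfolding roe_core_def by blast
qed

lemma insert_slice_closure_core:
  fixes a :: "('x::metric_space, complex) ell2_op"
  assumes "a \<in> uniform_Roe_algebra TYPE('x)"
  shows "ell2_insert (b i) o\<^sub>L a o\<^sub>L ell2_slice (b j) \<in> closure core"
proof (rule core_closure_image[where f = "\<lambda>a. ell2_insert (b i) o\<^sub>L a o\<^sub>L ell2_slice (b j)"])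
  show "bounded_linear (\<lambda>a. ell2_insert (b i) o\<^sub>L a o\<^sub>L ell2_slice (b j))"
    by (rule bounded_linear_compose[
          OF bounded_bilinear.bounded_linear_left[OF bounded_bilinear_blinfun_compose]
          bounded_bilinear.bounded_linear_right[OF bounded_bilinear_blinfun_compose]])
  show "a \<in> closure {T :: ('x, complex) ell2_op. clinear_op T \<and> finite_propagation T}"
    using assms by (simp add: uniform_Roe_algebra_def)
qed (auto intro: insert_slice_core subsetD[OF closure_subset])

text \<open>\<open>S\<close> is \<open>a \<otimes> k\<close>, known only on elementary tensors.
  Cutting it on both sides by the basis projections gives a finite combination of \<open>a\<close>
  tensored with matrix units, and the cut operators converge in norm because those for
  \<open>k\<close> do. This uses that \<open>a \<otimes> 1\<close> does not increase norms by more
  than \<open>norm a\<close>.\<close>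

lemma tensor_generator_closure_core:
  fixes a :: "('x::metric_space, complex) ell2_op"
    and S :: "('x, 'k) ell2_op"
  assumes a: "a \<in> uniform_Roe_algebra TYPE('x)" and ca: "clinear_op a"
    and k: "clinear_op k" "compact_op k" and cS: "clinear_op S"
    and S: "\<And>\<xi> h. S (ell2_tensor \<xi> h) = ell2_tensor (a \<xi>) (blinfun_apply k h)"
  shows "S \<in> closure core"
proof -
  \<comment> \<open>\<open>A f G\<close> is \<open>a \<otimes> 1\<close> applied to a vector
    \<open>f\<close> supported in the finite set \<open>G\<close>. Slicing commutes with it, so its
    norm is controlled slice by slice.\<close>
  define A where "A f G = (\<Sum>x\<in>G. ell2_tensor (a (ell2_single x 1)) (ell2_apply f x))"
    for f :: "('x, 'k) ell2" and G
  have nA: "norm (A f G) \<le> norm a * norm f" if G: "finite G" "ell2_restrict G f = f" for f G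
  proof (rule LIMSEQ_le_const2[OF tendsto_norm[OF amp_onb_proj_tendsto]], intro exI allI impI)
    fix m :: nat
    have "ell2_slice (b i) (A f G) = a (ell2_slice (b i) f)" for i
    proof -
      have "ell2_apply f x = 0" if "x \<notin> G" for x using G(2) that by (metis ell2_restrict_apply)
      hence "ell2_slice (b i) f = (\<Sum>x\<in>G. cinner (ell2_apply f x) (b i) *\<^sub>C ell2_single x 1)"
        using G(1) by (intro ell2_eqI)
          (auto simp: ell2_apply_sum ell2_simps cinner.zero_left if_distrib[of "\<lambda>z. _ * z"] cong: if_cong)
      hence "a (ell2_slice (b i) f) = (\<Sum>x\<in>G. cinner (ell2_apply f x) (b i) *\<^sub>C a (ell2_single x 1))"
        by (simp add: blinfun.sum_right clinear_opD[OF ca])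
      also have "\<dots> = ell2_slice (b i) (A f G)"
        by (rule ell2_eqI) (simp add: A_def blinfun.sum_right ell2_apply_sum ell2_simps
            cinner_scaleC_left mult.commute)
      finally show ?thesis by simp
    qed
    hence "(norm (amp (onb_proj b m) (A f G)))\<^sup>2 = (\<Sum>i<m. (norm (a (ell2_slice (b i) f)))\<^sup>2)"
      unfolding norm_amp_onb_proj[OF b] by simp
    also have "\<dots> \<le> (\<Sum>i<m. (norm a)\<^sup>2 * (norm (ell2_slice (b i) f))\<^sup>2)"
      unfolding power_mult_distrib[symmetric] by (intro sum_mono power_mono norm_blinfun) auto
    also have "\<dots> = (norm a)\<^sup>2 * (norm (amp (onb_proj b m) f))\<^sup>2"
      unfolding norm_amp_onb_proj[OF b] by (simp add: sum_distrib_left)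
    also have "\<dots> \<le> (norm a)\<^sup>2 * (norm f)\<^sup>2"
      by (intro mult_left_mono power_mono norm_amp_le) auto
    finally have "(norm (amp (onb_proj b m) (A f G)))\<^sup>2 \<le> (norm a * norm f)\<^sup>2"
      by (simp add: power_mult_distrib)
    thus "norm (amp (onb_proj b m) (A f G)) \<le> norm a * norm f"
      by (rule power2_le_imp_le) simp
  qed
  have SA: "S (amp q f) = amp (k o\<^sub>L q) (A f G)" "amp q (S f) = amp (q o\<^sub>L k) (A f G)"
    if q: "clinear_op q" and G: "finite G" "ell2_restrict G f = f" for q f G
  proof -
    have f: "f = (\<Sum>x\<in>G. ell2_tensor (ell2_single x 1) (ell2_apply f x))"
      using G ell2_restrict_finite[of G f] by (simp add: ell2_single_tensor[symmetric])
    show "S (amp q f) = amp (k o\<^sub>L q) (A f G)"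
      by (subst f) (simp add: blinfun.sum_right amp_tensor q clinear_op_compose k S A_def)
    show "amp q (S f) = amp (q o\<^sub>L k) (A f G)"
      by (subst f) (simp add: blinfun.sum_right amp_tensor q clinear_op_compose k S A_def)
  qed
  have bound: "norm W \<le> c * norm a"
    if "0 \<le> c" and W: "\<And>f G. finite G \<Longrightarrow> ell2_restrict G f = f \<Longrightarrow> norm (blinfun_apply W f) \<le> c * norm (A f G)"
    for W :: "('x, 'k) ell2_op" and c
  proof (rule norm_blinfun_bound)
    fix f
    have "norm (W (ell2_restrict G f)) \<le> c * norm a * norm f" if "finite G" for G
    proof -
      have "norm (W (ell2_restrict G f)) \<le> c * norm (A (ell2_restrict G f) G)"
        by (rule W[OF that]) simp
      also have "\<dots> \<le> c * (norm a * norm (ell2_restrict G f))"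
        using \<open>0 \<le> c\<close> by (intro mult_left_mono nA that) auto
      also have "\<dots> \<le> c * (norm a * norm f)"
        using \<open>0 \<le> c\<close> by (intro mult_left_mono norm_ell2_restrict_le) auto
      finally show ?thesis by (simp add: mult.assoc)
    qed
    hence "\<forall>\<^sub>F G in finite_subsets_at_top UNIV. norm (W (ell2_restrict G f)) \<le> c * norm a * norm f"
      by (intro eventually_finite_subsets_at_top_weakI)
    moreover have "((\<lambda>G. norm (W (ell2_restrict G f))) \<longlongrightarrow> norm (W f)) (finite_subsets_at_top UNIV)"
      by (intro tendsto_norm blinfun.tendsto tendsto_const ell2_restrict_tendsto)
    ultimately show "norm (W f) \<le> c * norm a * norm f"
      by (intro tendsto_upperbound) (auto simp: finite_subsets_at_top_neq_bot)
  qed (use that in simp)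
  have "\<exists>T\<in>closure core. dist T S < e" if e: "e > 0" for e
  proof -
    define d where "d = e / (2 * (norm a + 1))"
    have na: "norm a + 1 > 0" by (simp add: add_nonneg_pos)
    hence d: "d > 0" using e by (simp add: d_def)
    obtain m where m: "norm (k o\<^sub>L (id_blinfun - onb_proj b m)) \<le> d"
      "norm ((id_blinfun - onb_proj b m) o\<^sub>L k) \<le> d"
      using compact_op_onb_coproj[OF b k(2,1) d] by blast
    define q where "q = id_blinfun - onb_proj b m"
    have q: "clinear_op q" unfolding q_def by (intro clinear_op_diff clinear_op_id clinear_onb_proj)
    have ampq: "amp q f = f - amp (onb_proj b m) f" for f :: "('x, 'k) ell2"
      by (rule ell2_eqI) (simp add: q_def blinfun.diff_left ell2_simps)
    define T where "T = amp (onb_proj b m) o\<^sub>L S o\<^sub>L amp (onb_proj b m)"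
    have le: "norm (amp r f) \<le> d * norm f" if "norm r \<le> d" for r and f :: "('x, 'k) ell2"
      by (rule norm_amp_apply_le)
        (use d that in \<open>auto intro: order_trans[OF norm_blinfun mult_right_mono]\<close>)
    have "norm (S o\<^sub>L amp q) \<le> d * norm a" "norm (amp q o\<^sub>L S) \<le> d * norm a"
      using SA[OF q] le m d by (auto intro!: bound simp: q_def)
    \<comment> \<open>With \<open>P\<close> the cutdown and \<open>q = 1 - P\<close>, this is
      \<open>S - P S P = q S + P S q\<close>.\<close>
    moreover have "S - T = (amp q o\<^sub>L S) + (amp (onb_proj b m) o\<^sub>L (S o\<^sub>L amp q))"
      by (rule blinfun_eqI) (simp add: T_def ampq blinfun.add_left blinfun.diff_left blinfun.diff_right)
    moreover have "norm (amp (onb_proj b m) o\<^sub>L (S o\<^sub>L amp q)) \<le> norm (S o\<^sub>L amp q)"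
    proof (rule norm_blinfun_bound)
      show "norm ((amp (onb_proj b m) o\<^sub>L (S o\<^sub>L amp q)) f) \<le> norm (S o\<^sub>L amp q) * norm f" for f
        using order_trans[OF norm_amp_le norm_blinfun[of "S o\<^sub>L amp q" f]] by simp
    qed simp
    ultimately have "norm (S - T) \<le> d * norm a + d * norm a"
      by (smt (verit) norm_triangle_ineq)
    also have "\<dots> < e"
    proof -
      have "d * (2 * (norm a + 1)) = e" using na by (simp add: d_def)
      thus ?thesis using d by (simp add: algebra_simps)
    qed
    finally have "dist T S < e" by (simp add: dist_norm norm_minus_commute)
    moreover have "T = (\<Sum>i<m. \<Sum>j<m. cinner (k (b j)) (b i) *\<^sub>C
        (ell2_insert (b i) o\<^sub>L a o\<^sub>L ell2_slice (b j)))"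
    proof (rule blinfun_eqI)
      fix f
      have "ell2_slice (b i) (S (amp (onb_proj b m) f))
          = (\<Sum>j<m. cinner (k (b j)) (b i) *\<^sub>C a (ell2_slice (b j) f))" for i
        by (rule ell2_eqI) (simp add: amp_onb_proj blinfun.sum_right S ell2_apply_sum ell2_simps
            cinner.sum_left cinner_scaleC_left mult.commute)
      hence "T f = (\<Sum>i<m. ell2_insert (b i) (\<Sum>j<m. cinner (k (b j)) (b i) *\<^sub>C a (ell2_slice (b j) f)))"
        by (simp add: T_def amp_onb_proj[of b m "S _"])
      thus "T f = (\<Sum>i<m. \<Sum>j<m. cinner (k (b j)) (b i) *\<^sub>C
          (ell2_insert (b i) o\<^sub>L a o\<^sub>L ell2_slice (b j))) f"
        by (simp add: blinfun.sum_right blinfun.sum_left scaleC_blinfun.rep_eq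
            clinear_opD[OF clinear_ell2_insert] del: ell2_insert_eq)
    qed
    hence "T \<in> closure core"
      by (auto intro!: cvec.subspace_sum[OF closure_core_subspace]
          cvec.subspace_scale[OF closure_core_subspace] insert_slice_closure_core[OF a])
    ultimately show ?thesis by blast
  qed
  hence "S \<in> closure (closure core)" unfolding closure_approachable[of S] by blast
  thus ?thesis by simp
qed

text \<open>The generators lie in the closed subspace \<open>closure core\<close>. Conversely an
  operator cut down by finitely many basis vectors is a finite matrix of scalar operators, each of
  finite propagation.\<close>

lemma tensor_compacts_uniform_Roe:
  "tensor_compacts (uniform_Roe_algebra TYPE('x::metric_space)) =
    closure (core :: ('x, 'k) ell2_op set)"
  unfolding tensor_compacts_def
proof (rule antisym)
  let ?G = "{S :: ('x, 'k) ell2_op. clinear_op S \<and>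
    (\<exists>a\<in>uniform_Roe_algebra TYPE('x). \<exists>k. clinear_op k \<and> compact_op k \<and>
      (\<forall>\<xi> \<eta>. S (ell2_tensor \<xi> \<eta>) = ell2_tensor (a \<xi>) (blinfun_apply k \<eta>)))}"
  have clin: "clinear_op a" if "a \<in> uniform_Roe_algebra TYPE('x)" for a
  proof -
    have "closure {T :: ('x, complex) ell2_op. clinear_op T \<and> finite_propagation T}
        \<subseteq> {T. clinear_op T}"
      by (intro closure_minimal closed_clinear_op) auto
    thus ?thesis using that by (auto simp: uniform_Roe_algebra_def)
  qed
  have "?G \<subseteq> closure core"
  proof
    fix S assume "S \<in> ?G"
    then obtain a k where "clinear_op S" "a \<in> uniform_Roe_algebra TYPE('x)" "clinear_op k" "compact_op k"
      "\<And>\<xi> \<eta>. S (ell2_tensor \<xi> \<eta>) = ell2_tensor (a \<xi>) (blinfun_apply k \<eta>)" by auto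
    thus "S \<in> closure core" using tensor_generator_closure_core[of a k S] clin by metis
  qed
  hence "cvec.span ?G \<subseteq> closure core" by (rule cvec.span_minimal[OF _ closure_core_subspace])
  thus "closure (cvec.span ?G) \<subseteq> closure core" by (rule closure_minimal) simp
  have "core \<subseteq> cvec.span ?G"
  proof
    fix T :: "('x, 'k) ell2_op" assume T: "T \<in> core"
    then obtain m where m: "amp (onb_proj b m) o\<^sub>L T o\<^sub>L amp (onb_proj b m) = T"
      by (auto simp: roe_core_def)
    define a where "a i j = ell2_slice (b i) o\<^sub>L T o\<^sub>L ell2_insert (b j)" for i j
    have ca: "clinear_op (a i j)" for i j
      unfolding a_def using T
      by (intro clinear_op_compose clinear_ell2_slice clinear_ell2_insert) (auto simp: roe_core_def)
    have "finite_propagation (a i j)" for i j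
    proof -
      obtain R where R: "\<And>x y. R < dist x y \<Longrightarrow> matrix_entry T x y = 0"
        using T finite_propagationE unfolding roe_core_def by blast
      show ?thesis
      proof (rule finite_propagationI[of _ R], rule ccontr)
        fix x y assume *: "matrix_entry (a i j) x y \<noteq> 0" "\<not> dist x y \<le> R"
        have "matrix_entry (a i j) x y c = 0" for c
        proof -
          have "ell2_tensor (ell2_single y c) (b j) = ell2_single y (c *\<^sub>C b j)"
            by (rule ell2_eqI) (simp add: scaleC.zero_left)
          hence "matrix_entry (a i j) x y c = cinner (matrix_entry T x y (c *\<^sub>C b j)) (b i)"
            by (simp add: a_def)
          thus ?thesis using R[of x y] * by (simp add: cinner.zero_left del: matrix_entry_apply)
        qed
        thus False using * by (metis blinfun_eqI blinfun.zero_left)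
      qed
    qed
    hence aU: "a i j \<in> uniform_Roe_algebra TYPE('x)" for i j
      unfolding uniform_Roe_algebra_def by (intro subsetD[OF closure_subset]) (simp add: ca)
    have mem: "ell2_insert (b i) o\<^sub>L a i j o\<^sub>L ell2_slice (b j) \<in> ?G" for i j
    proof -
      have "ell2_slice (b j) (ell2_tensor \<xi> h) = cinner h (b j) *\<^sub>C \<xi>" for \<xi> :: "('x, complex) ell2" and h
        by (rule ell2_eqI) (simp add: ell2_simps cinner_scaleC_left mult.commute)
      hence "(ell2_insert (b i) o\<^sub>L a i j o\<^sub>L ell2_slice (b j)) (ell2_tensor \<xi> h)
          = ell2_tensor (a i j \<xi>) (rank_one (b i) (b j) h)" for \<xi> h
        by (intro ell2_eqI) (simp add: clinear_opD[OF ca] ell2_simps scaleC_scaleC mult.commute)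
      moreover have "clinear_op (ell2_insert (b i) o\<^sub>L a i j o\<^sub>L ell2_slice (b j))"
        by (intro clinear_op_compose ca clinear_ell2_slice clinear_ell2_insert)
      ultimately show ?thesis
        by (intro CollectI conjI bexI[OF _ aU] exI[of _ "rank_one (b i) (b j)"] allI
            clinear_rank_one compact_op_rank_one)
    qed
    have T_eq: "T = (\<Sum>i<m. \<Sum>j<m. ell2_insert (b i) o\<^sub>L a i j o\<^sub>L ell2_slice (b j))"
      by (subst m[symmetric], rule blinfun_eqI)
        (simp add: amp_onb_proj blinfun.sum_left blinfun.sum_right a_def flip: ell2_insert_eq,
          rule sum.swap)
    show "T \<in> cvec.span ?G"
      by (subst T_eq) (intro cvec.span_sum cvec.span_base mem)
  qed
  thus "closure core \<subseteq> closure (cvec.span ?G)" by (rule closure_mono)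
qed

end

section \<open>Coarse equivalences induce isomorphisms\<close>

text \<open>A fibre with \<open>n\<close> points times the naturals is enumerated by division with
  remainder: the index in the fibre is the remainder and the level is the quotient. The level
  changes by a factor of at most \<open>N\<close>.\<close>

lemma fibre_enumeration:
  fixes q :: "'a \<Rightarrow> 'b"
  assumes fin: "\<And>z. finite {a. q a = z}" and N: "\<And>z. card {a. q a = z} \<le> N"
  obtains \<psi> :: "'a \<times> nat \<Rightarrow> 'b \<times> nat" where "bij_betw \<psi> UNIV (range q \<times> UNIV)"
    "\<And>a i. fst (\<psi> (a, i)) = q a" "\<And>a i. i \<le> snd (\<psi> (a, i))" "\<And>a i. snd (\<psi> (a, i)) < (i + 1) * N"
proof -
  define n where "n z = card {a. q a = z}" for z
  have "\<forall>z. \<exists>h. bij_betw h {a. q a = z} {0..<n z}"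
    unfolding n_def using ex_bij_betw_finite_nat[OF fin] by blast
  then obtain h where h: "\<And>z. bij_betw (h z) {a. q a = z} {0..<n z}" by metis
  define \<beta> where "\<beta> a = h (q a) a" for a
  have \<beta>: "\<beta> a < n (q a)" for a using h[of "q a"] by (auto simp: \<beta>_def bij_betw_def)
  have inj: "a = a'" if "q a = q a'" "\<beta> a = \<beta> a'" for a a'
    using h[of "q a"] that by (auto simp: \<beta>_def bij_betw_def inj_on_def)
  have surj: "\<exists>a. q a = z \<and> \<beta> a = k" if "k < n z" for k z
  proof -
    have "k \<in> h z ` {a. q a = z}" using h[of z] that by (simp add: bij_betw_def)
    thus ?thesis by (auto simp: \<beta>_def)
  qed
  define \<psi> where "\<psi> = (\<lambda>(a, i). (q a, i * n (q a) + \<beta> a))"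
  show ?thesis
  proof (rule that[of \<psi>])
    show "bij_betw \<psi> UNIV (range q \<times> UNIV)"
      unfolding bij_betw_def
    proof (intro conjI equalityI subsetI)
      show "inj \<psi>"
      proof (rule injI)
        fix u v assume eq: "\<psi> u = \<psi> v"
        obtain a i a' i' where uv: "u = (a, i)" "v = (a', i')" by (metis surj_pair)
        have q: "q a = q a'" and s: "i * n (q a) + \<beta> a = i' * n (q a) + \<beta> a'"
          using eq by (auto simp: \<psi>_def uv)
        have "\<beta> a = \<beta> a'"
          using arg_cong[OF s, of "\<lambda>k. k mod n (q a)"] \<beta>[of a] \<beta>[of a'] q by simp
        moreover have "i = i'" using s \<open>\<beta> a = \<beta> a'\<close> \<beta>[of a] by simp
        ultimately show "u = v" using inj q by (simp add: uv)
      qed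
    next
      fix zk assume "zk \<in> range q \<times> (UNIV :: nat set)"
      then obtain a0 k where zk: "zk = (q a0, k)" by auto
      have n0: "n (q a0) > 0" using \<beta>[of a0] by simp
      then obtain a where a: "q a = q a0" "\<beta> a = k mod n (q a0)" using surj[of "k mod n (q a0)" "q a0"] by auto
      have "\<psi> (a, k div n (q a0)) = zk" by (simp add: \<psi>_def a zk)
      thus "zk \<in> range \<psi>" by (metis rangeI)
    qed (auto simp: \<psi>_def)
    show "fst (\<psi> (a, i)) = q a" for a i by (simp add: \<psi>_def)
    show "i \<le> snd (\<psi> (a, i))" for a i
      using \<beta>[of a] by (cases "n (q a)") (auto simp: \<psi>_def)
    show "snd (\<psi> (a, i)) < (i + 1) * N" for a i
    proof -
      have "snd (\<psi> (a, i)) < (i + 1) * n (q a)" using \<beta>[of a] by (simp add: \<psi>_def)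
      also have "\<dots> \<le> (i + 1) * N" using N by (intro mult_left_mono) (auto simp: n_def)
      finally show ?thesis .
    qed
  qed
qed

text \<open>The first clause, uniform in the levels, preserves finite propagation. The second keeps
  the span of the first \<open>m\<close> basis vectors inside that of the first \<open>m'\<close>,
  as the stabilised uniform algebra demands.\<close>

definition controlled :: "('x::metric_space \<times> nat \<Rightarrow> 'y::metric_space \<times> nat) \<Rightarrow> bool"
  where "controlled \<phi> \<longleftrightarrow>
    (\<forall>R. \<exists>S. \<forall>x i x' i'. dist x x' \<le> R \<longrightarrow> dist (fst (\<phi> (x, i))) (fst (\<phi> (x', i'))) \<le> S) \<and>
    (\<forall>m. \<exists>m'. \<forall>x i. i < m \<longrightarrow> snd (\<phi> (x, i)) < m')"

text \<open>Both \<open>f\<close> and a map \<open>g\<close> of \<open>Y\<close> onto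
  \<open>range f\<close> close to the identity have fibres of bounded size. Hence \<open>X\<close>
  times the naturals and \<open>Y\<close> times the naturals are both in bijection with
  \<open>range f\<close> times the naturals.\<close>

lemma coarsely_equivalent_bijection:
  assumes X: "bounded_geometry TYPE('x::metric_space)" and Y: "bounded_geometry TYPE('y::metric_space)"
    and "coarsely_equivalent TYPE('x) TYPE('y)"
  obtains \<phi> :: "'x::metric_space \<times> nat \<Rightarrow> 'y::metric_space \<times> nat" where "bij \<phi>" "controlled \<phi>" "controlled (inv \<phi>)"
proof -
  obtain f :: "'x \<Rightarrow> 'y" and C where f: "coarse_embedding dist dist f" and C: "\<And>y. \<exists>x. dist y (f x) \<le> C"
    using assms(3) unfolding coarsely_equivalent_def by blast
  note fD = coarse_embeddingD[OF f zero_le_dist]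
  \<comment> \<open>Fixing \<open>range f\<close> pointwise makes \<open>range g\<close> equal to
    \<open>range f\<close>, so both enumerations have the same target.\<close>
  define g where "g y = (if y \<in> range f then y else f (SOME x. dist y (f x) \<le> C))" for y
  have C0: "0 \<le> C" using C zero_le_dist order_trans by blast
  have g: "dist y (g y) \<le> C" for y using someI_ex[OF C[of y]] C0 by (auto simp: g_def)
  have rg: "range g = range f" by (force simp: g_def)
  have fibres: "\<exists>N. \<forall>z. finite {a. q a = z} \<and> card {a. q a = z} \<le> N"
    if bg: "bounded_geometry TYPE('c)" and q: "\<And>a a'. q a = q a' \<Longrightarrow> dist a a' \<le> S"
    for q :: "'c::metric_space \<Rightarrow> 'y" and S
  proof -
    obtain N where N: "\<And>x :: 'c. finite (cball x (max S 1)) \<and> card (cball x (max S 1)) \<le> N"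
      using bg unfolding bounded_geometry_def by (metis less_max_iff_disj zero_less_one)
    have "finite {a. q a = z} \<and> card {a. q a = z} \<le> N" for z
    proof (cases "{a. q a = z} = {}")
      case False
      then obtain a0 where "q a0 = z" by blast
      hence sub: "{a. q a = z} \<subseteq> cball a0 (max S 1)" using q by (auto simp: le_max_iff_disj)
      thus ?thesis using N[of a0] finite_subset card_mono le_trans by meson
    qed simp
    thus ?thesis by blast
  qed
  obtain S0 where S0: "\<And>x x'. dist (f x) (f x') \<le> 0 \<Longrightarrow> dist x x' \<le> S0" using fD(2)[of 0] by blast
  obtain N where N: "\<And>z. finite {x. f x = z}" "\<And>z. card {x. f x = z} \<le> N"
    using fibres[OF X, of f S0] S0 by auto
  have "dist y y' \<le> 2 * C" if "g y = g y'" for y y'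
    using g[of y] g[of y'] that dist_triangle2[of y y' "g y"] by simp
  then obtain N' where N': "\<And>z. finite {y. g y = z}" "\<And>z. card {y. g y = z} \<le> N'"
    using fibres[OF Y, of g "2 * C"] by auto
  obtain F where F: "bij_betw F UNIV (range f \<times> UNIV)" "\<And>x i. fst (F (x, i)) = f x"
    "\<And>x i. i \<le> snd (F (x, i))" "\<And>x i. snd (F (x, i)) < (i + 1) * N"
    using fibre_enumeration[of f N] N by blast
  obtain G where G: "bij_betw G UNIV (range f \<times> UNIV)" "\<And>y j. fst (G (y, j)) = g y"
    "\<And>y j. j \<le> snd (G (y, j))" "\<And>y j. snd (G (y, j)) < (j + 1) * N'"
    using fibre_enumeration[of g N'] N' unfolding rg by blast
  define \<phi> where "\<phi> = inv_into UNIV G \<circ> F"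
  have bij: "bij \<phi>"
    unfolding \<phi>_def by (rule bij_betw_trans[OF F(1) bij_betw_inv_into[OF G(1)]])
  have G\<phi>: "G (\<phi> u) = F u" for u
    unfolding \<phi>_def comp_def using F(1) G(1) by (intro f_inv_into_f) (auto simp: bij_betw_def)
  have rel: "g y = f x" "j < (i + 1) * N" "i < (j + 1) * N'" if "\<phi> (x, i) = (y, j)" for x i y j
  proof -
    have eq: "G (y, j) = F (x, i)" using G\<phi>[of "(x, i)"] that by simp
    show "g y = f x" using F(2)[of x i] G(2)[of y j] eq by simp
    show "j < (i + 1) * N" using G(3)[of j y] F(4)[of x i] eq by simp
    show "i < (j + 1) * N'" using F(3)[of i x] G(4)[of y j] eq by simp
  qed
  have near: "dist y (f x) \<le> C" if "\<phi> (x, i) = (y, j)" for x i y j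
    using rel(1)[OF that] g[of y] by simp
  have "controlled \<phi>"
    unfolding controlled_def
  proof (intro conjI allI)
    fix R
    obtain S where S: "\<And>x x'. dist x x' \<le> R \<Longrightarrow> dist (f x) (f x') \<le> S" using fD(1) by blast
    have "dist (fst (\<phi> (x, i))) (fst (\<phi> (x', i'))) \<le> S + 2 * C" if "dist x x' \<le> R" for x i x' i'
    proof -
      obtain y j y' j' where eq: "\<phi> (x, i) = (y, j)" "\<phi> (x', i') = (y', j')" by fastforce
      have "dist y y' \<le> dist y (f x) + dist (f x) (f x') + dist y' (f x')"
        using dist_triangle[of y y' "f x"] dist_triangle[of "f x" y' "f x'"] by (simp add: dist_commute)
      thus ?thesis using near[OF eq(1)] near[OF eq(2)] S[OF that] by (simp add: eq)
    qed
    thus "\<exists>S. \<forall>x i x' i'. dist x x' \<le> R \<longrightarrow> dist (fst (\<phi> (x, i))) (fst (\<phi> (x', i'))) \<le> S" by blast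
  next
    fix m
    have "snd (\<phi> (x, i)) < (m + 1) * N" if "i < m" for x i
    proof -
      have "snd (\<phi> (x, i)) < (i + 1) * N" using rel(2)[of x i] by (metis prod.collapse)
      also have "\<dots> \<le> (m + 1) * N" using that by (intro mult_right_mono) auto
      finally show ?thesis .
    qed
    thus "\<exists>m'. \<forall>x i. i < m \<longrightarrow> snd (\<phi> (x, i)) < m'" by blast
  qed
  moreover have "controlled (inv \<phi>)"
    unfolding controlled_def
  proof (intro conjI allI)
    have inv: "\<phi> (fst (inv \<phi> u), snd (inv \<phi> u)) = u" for u
      using bij by (simp add: bij_is_surj surj_f_inv_f)
    fix R
    obtain S where S: "\<And>x x'. dist (f x) (f x') \<le> R + 2 * C \<Longrightarrow> dist x x' \<le> S" using fD(2) by blast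
    have "dist (fst (inv \<phi> (y, j))) (fst (inv \<phi> (y', j'))) \<le> S" if "dist y y' \<le> R" for y j y' j'
    proof (rule S)
      have "dist y (f (fst (inv \<phi> (y, j)))) \<le> C" "dist y' (f (fst (inv \<phi> (y', j')))) \<le> C"
        using near[OF inv[of "(y, j)"]] near[OF inv[of "(y', j')"]] by auto
      thus "dist (f (fst (inv \<phi> (y, j)))) (f (fst (inv \<phi> (y', j')))) \<le> R + 2 * C"
        using that dist_triangle[of "f (fst (inv \<phi> (y, j)))" "f (fst (inv \<phi> (y', j')))" y]
          dist_triangle[of y "f (fst (inv \<phi> (y', j')))" y'] by (simp add: dist_commute)
    qed
    thus "\<exists>S. \<forall>y j y' j'. dist y y' \<le> R \<longrightarrow> dist (fst (inv \<phi> (y, j))) (fst (inv \<phi> (y', j'))) \<le> S"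
      by blast
    fix m
    have "snd (inv \<phi> (y, j)) < (m + 1) * N'" if "j < m" for y j
    proof -
      have "snd (inv \<phi> (y, j)) < (j + 1) * N'" using rel(3)[OF inv[of "(y, j)"]] .
      also have "\<dots> \<le> (m + 1) * N'" using that by (intro mult_right_mono) auto
      finally show ?thesis .
    qed
    thus "\<exists>m'. \<forall>y j. j < m \<longrightarrow> snd (inv \<phi> (y, j)) < m'" by blast
  qed
  ultimately show ?thesis using that bij by blast
qed

section \<open>Unitaries induced by bijections of basis vectors\<close>

lemma onb_unitary:
  fixes b :: "nat \<Rightarrow> 'a::chilbert_space" and c :: "nat \<Rightarrow> 'b::chilbert_space"
  assumes b: "onb b" and c: "onb c"
  obtains U V where "unitary_pair U V" "\<And>n. U (b n) = c n"
proof -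
  have ob: "i \<noteq> j \<Longrightarrow> cinner (b i) (b j) = 0" and oc: "i \<noteq> j \<Longrightarrow> cinner (c i) (c j) = 0" for i j
    by (simp_all add: onb_cinner b c)
  have nb: "norm (b i) \<le> 1" and nc: "norm (c i) \<le> 1" for i by (simp_all add: norm_onb b c)
  obtain U :: "'a \<Rightarrow>\<^sub>L 'b" where U: "clinear_op U" "\<And>v. (\<lambda>n. cinner v (b n) *\<^sub>C c n) sums U v"
    using orthogonal_sum_operator[of c b, OF oc nc ob nb] by blast
  obtain V :: "'b \<Rightarrow>\<^sub>L 'a" where V: "clinear_op V" "\<And>v. (\<lambda>n. cinner v (c n) *\<^sub>C b n) sums V v"
    using orthogonal_sum_operator[of b c, OF ob nb oc nc] by blast
  have Ub: "U (b n) = c n" for n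
  proof (rule sums_unique2[OF U(2)])
    have "(\<lambda>m. cinner (b n) (b m) *\<^sub>C c m) = (\<lambda>m. if m = n then c m else 0)"
      by (auto simp: onb_cinner b scaleC.zero_left)
    thus "(\<lambda>m. cinner (b n) (b m) *\<^sub>C c m) sums c n" using sums_single[of n c] by simp
  qed
  have Vc: "V (c n) = b n" for n
  proof (rule sums_unique2[OF V(2)])
    have "(\<lambda>m. cinner (c n) (c m) *\<^sub>C b m) = (\<lambda>m. if m = n then b m else 0)"
      by (auto simp: onb_cinner c scaleC.zero_left)
    thus "(\<lambda>m. cinner (c n) (c m) *\<^sub>C b m) sums b n" using sums_single[of n b] by simp
  qed
  have "cinner (U x) y = cinner x (V y)" for x y
  proof (rule sums_unique2)
    show "(\<lambda>n. cinner (cinner x (b n) *\<^sub>C c n) y) sums cinner (U x) y"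
      by (rule bounded_linear.sums[OF cinner.bounded_linear_left U(2)])
    have "(\<lambda>n. cinner x (cinner y (c n) *\<^sub>C b n)) sums cinner x (V y)"
      by (rule bounded_linear.sums[OF cinner.bounded_linear_right V(2)])
    thus "(\<lambda>n. cinner (cinner x (b n) *\<^sub>C c n) y) sums cinner x (V y)"
      by (simp add: cinner_scaleC_left cinner_scaleC_right mult.commute)
  qed
  moreover have "V (U x) = x" for x
  proof (rule sums_unique2)
    show "(\<lambda>n. V (cinner x (b n) *\<^sub>C c n)) sums V (U x)"
      by (rule bounded_linear.sums[OF blinfun.bounded_linear_right U(2)])
    show "(\<lambda>n. V (cinner x (b n) *\<^sub>C c n)) sums x"
      using onb_sums[OF b, of x] by (simp add: clinear_opD[OF V(1)] Vc)
  qed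
  moreover have "U (V y) = y" for y
  proof (rule sums_unique2)
    show "(\<lambda>n. U (cinner y (c n) *\<^sub>C b n)) sums U (V y)"
      by (rule bounded_linear.sums[OF blinfun.bounded_linear_right V(2)])
    show "(\<lambda>n. U (cinner y (c n) *\<^sub>C b n)) sums y"
      using onb_sums[OF c, of y] by (simp add: clinear_opD[OF U(1)] Ub)
  qed
  ultimately have "unitary_pair U V" unfolding unitary_pair_def using U V by blast
  thus ?thesis using that Ub by blast
qed

lemma onb_ell2:
  assumes e: "onb e" and g: "bij g"
  shows "onb (\<lambda>n. ell2_single (fst (g n)) (e (snd (g n))) :: ('x, 'h::chilbert_space) ell2)"
proof (rule onbI_total)
  fix i j
  have "g i = g j \<longleftrightarrow> i = j" using g by (simp add: bij_def inj_eq)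
  thus "cinner (ell2_single (fst (g i)) (e (snd (g i))))
      (ell2_single (fst (g j)) (e (snd (g j))) :: ('x, 'h) ell2) = (if i = j then 1 else 0)"
    using e by (auto simp: cinner_ell2_single onb_cinner cinner.zero_left prod_eq_iff)
next
  fix v :: "('x, 'h) ell2"
  assume v: "\<And>n. cinner v (ell2_single (fst (g n)) (e (snd (g n)))) = 0"
  have "cinner (ell2_apply v x) (e i) = 0" for x i
    using v[of "inv g (x, i)"] g by (simp add: cinner_ell2_single bij_is_surj surj_f_inv_f)
  hence "ell2_apply v x = 0" for x by (rule onb_eq_0[OF e])
  thus "v = 0" by (intro ell2_eqI) (simp add: ell2_simps)
qed

lemma controlled_unitary:
  fixes e :: "nat \<Rightarrow> 'h::chilbert_space" and \<phi> :: "'x::metric_space \<times> nat \<Rightarrow> 'y::metric_space \<times> nat"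
  assumes X: "bounded_geometry TYPE('x)" and e: "onb e" and \<phi>: "bij \<phi>"
  obtains U :: "('x, 'h) ell2 \<Rightarrow>\<^sub>L ('y, 'h) ell2" and V where "unitary_pair U V"
    "\<And>u. U (ell2_single (fst u) (e (snd u))) = ell2_single (fst (\<phi> u)) (e (snd (\<phi> u)))"
proof -
  \<comment> \<open>Balls are finite, so \<open>X\<close> is countable; \<open>undefined\<close>
    serves as an arbitrary base point.\<close>
  have "(UNIV :: 'x set) = (\<Union>n::nat. cball undefined (real n))"
    using real_arch_simple by (auto simp: dist_commute)
  hence "countable (UNIV :: 'x set)"
    using bounded_geometry_finite_cball[OF X] by (metis countable_UN countable_finite countableI_type)
  hence "countable (UNIV :: ('x \<times> nat) set)"
    using countable_SIGMA[of UNIV "\<lambda>_. UNIV :: nat set"] by simp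
  moreover have "infinite (UNIV :: ('x \<times> nat) set)"
    by (simp add: finite_prod)
  ultimately have g: "bij (from_nat_into (UNIV :: ('x \<times> nat) set))"
    by (rule bij_betw_from_nat_into)
  define g where "g = from_nat_into (UNIV :: ('x \<times> nat) set)"
  have g: "bij g" using g by (simp add: g_def)
  have \<phi>g: "bij (\<phi> \<circ> g)" using g \<phi> by (rule bij_comp)
  obtain U V where UV: "unitary_pair U V" and U: "\<And>n. U (ell2_single (fst (g n)) (e (snd (g n))))
      = (ell2_single (fst ((\<phi> \<circ> g) n)) (e (snd ((\<phi> \<circ> g) n))) :: ('y, 'h) ell2)"
    by (rule onb_unitary[OF onb_ell2[OF e g] onb_ell2[OF e \<phi>g]]) (rule that)
  have "U (ell2_single (fst u) (e (snd u))) = ell2_single (fst (\<phi> u)) (e (snd (\<phi> u)))" for u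
  proof -
    obtain n where "u = g n" using bij_is_surj[OF g] by (rule surjE)
    thus ?thesis using U[of n] by simp
  qed
  thus ?thesis by (rule that[OF UV])
qed

lemma id_blinfun_compose [simp]: "id_blinfun o\<^sub>L T = T" "T o\<^sub>L id_blinfun = T"
  by (auto intro: blinfun_eqI)

lemma blinfun_eq_ell2_basis:
  fixes S T :: "('x, 'h::chilbert_space) ell2 \<Rightarrow>\<^sub>L 'a::chilbert_space"
  assumes "clinear_op S" "clinear_op T" "onb e"
    and eq: "\<And>x i. S (ell2_single x (e i)) = T (ell2_single x (e i))"
  shows "S = T"
proof (rule blinfun_eq_ell2I)
  fix x h
  let ?S = "S o\<^sub>L ell2_single x" and ?T = "T o\<^sub>L ell2_single x"
  have "(\<lambda>n. ?S (cinner h (e n) *\<^sub>C e n)) sums ?S h" "(\<lambda>n. ?T (cinner h (e n) *\<^sub>C e n)) sums ?T h"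
    by (intro bounded_linear.sums[OF blinfun.bounded_linear_right] onb_sums assms)+
  hence "?S h = ?T h"
    by (intro sums_unique2) (simp_all add: clinear_opD[OF clinear_ell2_single] clinear_opD[OF assms(1)]
        clinear_opD[OF assms(2)] eq)
  thus "S (ell2_single x h) = T (ell2_single x h)" by simp
qed

lemma clinear_op_eq_0_basis:
  fixes T :: "'h::chilbert_space \<Rightarrow>\<^sub>L 'h"
  assumes "clinear_op T" "onb e" and eq: "\<And>i j. cinner (T (e j)) (e i) = 0"
  shows "T = 0"
proof (rule blinfun_eqI)
  fix h
  have "(\<lambda>n. T (cinner h (e n) *\<^sub>C e n)) sums T h"
    by (intro bounded_linear.sums[OF blinfun.bounded_linear_right] onb_sums assms)
  moreover have "T (e j) = 0" for j using onb_eq_0[OF assms(2)] eq by blast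
  ultimately have "(\<lambda>n. 0) sums T h" by (simp add: clinear_opD[OF assms(1)] scaleC.zero_right)
  hence "T h = 0" using sums_unique2[OF _ sums_zero] by blast
  thus "T h = (0 :: 'h \<Rightarrow>\<^sub>L 'h) h" by simp
qed

text \<open>\<open>U\<close> permutes the basis along \<open>\<phi>\<close>, so the coefficients of
  the conjugate are those of \<open>T\<close> at points moved by \<open>inv \<phi>\<close>. Control
  of \<open>\<phi>\<close> bounds the propagation; control of \<open>inv \<phi>\<close> makes each
  matrix entry a finite sum of compact operators.\<close>

lemma conjugation_core:
  fixes e :: "nat \<Rightarrow> 'h::chilbert_space"
    and U :: "('x::metric_space, 'h) ell2 \<Rightarrow>\<^sub>L ('y::metric_space, 'h) ell2"
  assumes X: "bounded_geometry TYPE('x)" and e: "onb e" and UV: "unitary_pair U V"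
    and \<phi>: "bij \<phi>" "controlled \<phi>" "controlled (inv \<phi>)"
    and U\<phi>: "\<And>u. U (ell2_single (fst u) (e (snd u))) = ell2_single (fst (\<phi> u)) (e (snd (\<phi> u)))"
    and T: "T \<in> roe_core \<P>"
    and \<P>: "\<And>p. p \<in> \<P> \<Longrightarrow> \<exists>q\<in>\<P>. amp q o\<^sub>L U o\<^sub>L amp p = U o\<^sub>L amp p \<and> amp p o\<^sub>L V o\<^sub>L amp q = amp p o\<^sub>L V"
  shows "U o\<^sub>L T o\<^sub>L V \<in> roe_core \<P>"
proof -
  define W where "W = U o\<^sub>L T o\<^sub>L V"
  have cU: "clinear_op U" and cV: "clinear_op V" and adj: "\<And>x y. cinner (U x) y = cinner x (V y)"
    and VU: "\<And>x. V (U x) = x"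
    using UV by (auto simp: unitary_pair_def)
  have cT: "clinear_op T" and lT: "locally_compact_op T" using T by (auto simp: roe_core_def)
  have cW: "clinear_op W" unfolding W_def by (intro clinear_op_compose cU cT cV)
  have V\<phi>: "V (ell2_single (fst w) (e (snd w))) = ell2_single (fst (inv \<phi> w)) (e (snd (inv \<phi> w)))" for w
    using VU[of "ell2_single (fst (inv \<phi> w)) (e (snd (inv \<phi> w)))"] U\<phi>[of "inv \<phi> w"] \<phi>(1)
    by (simp add: bij_is_surj surj_f_inv_f)
  obtain R where R: "\<And>x y. R < dist x y \<Longrightarrow> matrix_entry T x y = 0"
    using T finite_propagationE unfolding roe_core_def by blast
  have "finite_propagation W"
  proof -
    obtain S where S: "\<And>x i x' i'. dist x x' \<le> R \<Longrightarrow> dist (fst (\<phi> (x, i))) (fst (\<phi> (x', i'))) \<le> S"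
      using \<phi>(2) unfolding controlled_def by meson
    show ?thesis
    proof (rule finite_propagationI[of _ S])
      fix y y' assume "matrix_entry W y y' \<noteq> 0"
      then obtain i j where ne: "cinner (matrix_entry W y y' (e j)) (e i) \<noteq> 0"
        using clinear_op_eq_0_basis[OF clinear_matrix_entry[OF cW] e] by metis
      obtain x k x' k' where x: "inv \<phi> (y, i) = (x, k)" "inv \<phi> (y', j) = (x', k')" by fastforce
      have \<phi>x: "\<phi> (x, k) = (y, i)" "\<phi> (x', k') = (y', j)"
        using \<phi>(1) unfolding x[symmetric] by (simp_all add: bij_is_surj surj_f_inv_f)
      have "cinner (matrix_entry W y y' (e j)) (e i) = cinner (W (ell2_single y' (e j))) (ell2_single y (e i))"
        by (simp add: cinner_ell2_single)
      also have "\<dots> = cinner (T (V (ell2_single y' (e j)))) (V (ell2_single y (e i)))"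
        by (simp add: W_def adj)
      also have "\<dots> = cinner (T (ell2_single x' (e k'))) (ell2_single x (e k))"
        using V\<phi>[of "(y, i)"] V\<phi>[of "(y', j)"] x by simp
      also have "\<dots> = cinner (matrix_entry T x x' (e k')) (e k)" by (simp add: cinner_ell2_single)
      finally have "matrix_entry T x x' \<noteq> 0" using ne by (metis blinfun.zero_left cinner.zero_left)
      hence "dist x x' \<le> R" using R by (meson not_le)
      thus "dist y y' \<le> S" using S[of x x' k k'] \<phi>x by simp
    qed
  qed
  moreover have "locally_compact_op W"
    unfolding locally_compact_op_def
  proof (intro allI)
    fix y y'
    \<comment> \<open>The points whose copies of the fibre contribute to the fibre over
      \<open>z\<close>. They are finitely many: \<open>inv \<phi>\<close> keeps all levels over the
      one point \<open>z\<close> within bounded distance.\<close>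
    define G where "G z = {x. \<exists>i j. \<phi> (x, i) = (z, j)}" for z
    have fG: "finite (G z)" for z
    proof (cases "G z = {}")
      case False
      then obtain x0 i0 j0 where x0: "\<phi> (x0, i0) = (z, j0)" by (auto simp: G_def)
      obtain S where S: "\<And>u i u' i'. dist u u' \<le> 0 \<Longrightarrow> dist (fst (inv \<phi> (u, i))) (fst (inv \<phi> (u', i'))) \<le> S"
        using \<phi>(3) unfolding controlled_def by meson
      have "G z \<subseteq> cball x0 S"
      proof
        fix x assume "x \<in> G z"
        then obtain i j where "\<phi> (x, i) = (z, j)" by (auto simp: G_def)
        hence "inv \<phi> (z, j) = (x, i)" "inv \<phi> (z, j0) = (x0, i0)"
          using x0 \<phi>(1) by (metis bij_is_inj inv_f_f)+
        thus "x \<in> cball x0 S" using S[of z z j0 j] by simp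
      qed
      thus ?thesis using bounded_geometry_finite_cball[OF X] finite_subset by blast
    qed simp
    have supp: "ell2_apply (V (ell2_single z h)) x = 0" if "x \<notin> G z" for x z h
    proof (rule onb_eq_0[OF e])
      fix i
      have "cinner (V (ell2_single z h)) (ell2_single x (e i)) = cinner (ell2_single z h) (U (ell2_single x (e i)))"
        using unitary_pair_sym[OF UV] by (simp add: unitary_pair_def)
      also have "\<dots> = 0"
        using U\<phi>[of "(x, i)"] that surj_pair[of "\<phi> (x, i)"] by (force simp: G_def cinner_ell2_single cinner.zero_left)
      finally show "cinner (ell2_apply (V (ell2_single z h)) x) (e i) = 0"
        by (simp add: cinner_ell2_single)
    qed
    have V_eq: "V (ell2_single z h) = (\<Sum>x\<in>G z. ell2_single x (ell2_apply (V (ell2_single z h)) x))" for z h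
      using fG[of z] supp[of _ z h] by (intro ell2_eqI) (auto simp: ell2_apply_sum)
    have U_eq: "ell2_apply (U f) z = (\<Sum>x\<in>G z. ell2_apply (U (ell2_single x (ell2_apply f x))) z)" for f z
    proof (rule onb_eq_0[OF e, THEN eq_iff_diff_eq_0[THEN iffD2]])
      fix n
      have "cinner (ell2_apply (U f) z) (e n) = cinner f (V (ell2_single z (e n)))"
        by (metis adj cinner_ell2_single)
      also have "\<dots> = (\<Sum>x\<in>G z. cinner (ell2_apply f x) (ell2_apply (V (ell2_single z (e n))) x))"
        by (subst V_eq) (simp add: cinner.sum_right cinner_ell2_single)
      also have "\<dots> = (\<Sum>x\<in>G z. cinner (ell2_single x (ell2_apply f x)) (V (ell2_single z (e n))))"
        by (simp add: cinner_ell2_single')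
      also have "\<dots> = cinner (\<Sum>x\<in>G z. ell2_apply (U (ell2_single x (ell2_apply f x))) z) (e n)"
        by (simp add: cinner.sum_left adj[symmetric] cinner_ell2_single)
      finally show "cinner (ell2_apply (U f) z - (\<Sum>x\<in>G z. ell2_apply (U (ell2_single x (ell2_apply f x))) z)) (e n) = 0"
        by (simp add: cinner_diff_left)
    qed
    have "matrix_entry W y y' = (\<Sum>x\<in>G y. \<Sum>x'\<in>G y'.
        (ell2_coord y o\<^sub>L U o\<^sub>L ell2_single x) o\<^sub>L (matrix_entry T x x' o\<^sub>L (ell2_coord x' o\<^sub>L V o\<^sub>L ell2_single y')))"
    proof (rule blinfun_eqI)
      fix h
      have "ell2_apply (T (V (ell2_single y' h))) x
          = (\<Sum>x'\<in>G y'. ell2_apply (T (ell2_single x' (ell2_apply (V (ell2_single y' h)) x'))) x)" for x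
        by (subst V_eq) (simp add: blinfun.sum_right ell2_apply_sum)
      hence "matrix_entry W y y' h = (\<Sum>x\<in>G y. ell2_apply (U (ell2_single x
          (\<Sum>x'\<in>G y'. ell2_apply (T (ell2_single x' (ell2_apply (V (ell2_single y' h)) x'))) x))) y)"
        using U_eq[of "T (V (ell2_single y' h))" y] by (simp add: W_def)
      thus "matrix_entry W y y' h = (\<Sum>x\<in>G y. \<Sum>x'\<in>G y'.
          (ell2_coord y o\<^sub>L U o\<^sub>L ell2_single x) o\<^sub>L (matrix_entry T x x' o\<^sub>L (ell2_coord x' o\<^sub>L V o\<^sub>L ell2_single y'))) h"
        by (simp add: blinfun.sum_right blinfun.sum_left ell2_apply_sum)
    qed
    also have "compact_op \<dots>"
      using lT unfolding locally_compact_op_def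
      by (intro compact_op_sum compact_op_compose_left compact_op_compose_right) blast
    finally show "compact_op (matrix_entry W y y')" .
  qed
  moreover have "\<exists>q\<in>\<P>. amp q o\<^sub>L W o\<^sub>L amp q = W"
  proof -
    obtain p where p: "p \<in> \<P>" "amp p o\<^sub>L T o\<^sub>L amp p = T" using T by (auto simp: roe_core_def)
    obtain q where q: "q \<in> \<P>" "amp q o\<^sub>L U o\<^sub>L amp p = U o\<^sub>L amp p" "amp p o\<^sub>L V o\<^sub>L amp q = amp p o\<^sub>L V"
      using \<P>[OF p(1)] by blast
    have "amp q (U (amp p v)) = U (amp p v)" "amp p (V (amp q w)) = amp p (V w)" for v w
      using arg_cong[OF q(2), of "\<lambda>T. blinfun_apply T v"] arg_cong[OF q(3), of "\<lambda>T. blinfun_apply T w"]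
      by simp_all
    hence "amp q o\<^sub>L (U o\<^sub>L (amp p o\<^sub>L T o\<^sub>L amp p) o\<^sub>L V) o\<^sub>L amp q = U o\<^sub>L (amp p o\<^sub>L T o\<^sub>L amp p) o\<^sub>L V"
      by (intro blinfun_eqI) simp
    thus ?thesis using q(1) unfolding p(2) W_def by blast
  qed
  ultimately show ?thesis using cW unfolding W_def[symmetric] roe_core_def by blast
qed

lemma star_isomorphic_conjugation:
  assumes UV: "unitary_pair U V" and A: "\<And>T. T \<in> A \<Longrightarrow> clinear_op T"
    and AB: "\<And>T. T \<in> A \<Longrightarrow> U o\<^sub>L T o\<^sub>L V \<in> B" and BA: "\<And>S. S \<in> B \<Longrightarrow> V o\<^sub>L S o\<^sub>L U \<in> A"
  shows "star_isomorphic A B"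
proof -
  have cU: "clinear_op U" and adjU: "\<And>x y. cinner (U x) y = cinner x (V y)"
    and adjV: "\<And>x y. cinner (V y) x = cinner y (U x)" and VU: "\<And>x. V (U x) = x" "\<And>y. U (V y) = y"
    using UV unitary_pair_sym[OF UV] by (auto simp: unitary_pair_def)
  define \<phi> where "\<phi> T = U o\<^sub>L T o\<^sub>L V" for T
  have "bij_betw \<phi> A B"
    by (rule bij_betw_byWitness[where f' = "\<lambda>S. V o\<^sub>L S o\<^sub>L U"])
      (auto simp: \<phi>_def VU AB BA intro!: blinfun_eqI)
  moreover have "\<phi> (S + T) = \<phi> S + \<phi> T" for S T
    by (rule blinfun_eqI) (simp add: \<phi>_def blinfun.add_left blinfun.add_right)
  moreover have "\<phi> (a *\<^sub>C T) = a *\<^sub>C \<phi> T" for a T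
    by (rule blinfun_eqI) (simp add: \<phi>_def scaleC_blinfun.rep_eq clinear_opD[OF cU])
  moreover have "\<phi> (S o\<^sub>L T) = \<phi> S o\<^sub>L \<phi> T" for S T
    by (rule blinfun_eqI) (simp add: \<phi>_def VU)
  moreover have "\<phi> (adj T) = adj (\<phi> T)" if "T \<in> A" for T
    by (rule adj_unique[symmetric]) (simp add: \<phi>_def adjU adjV cinner_adj[OF A[OF that]])
  ultimately show ?thesis unfolding star_isomorphic_def by blast
qed

lemma (in exhausting_projections) star_isomorphic_core:
  fixes U :: "('x::metric_space, 'h) ell2 \<Rightarrow>\<^sub>L ('y::metric_space, 'h) ell2"
  assumes UV: "unitary_pair U V"
    and core: "\<And>T. T \<in> core \<Longrightarrow> U o\<^sub>L T o\<^sub>L V \<in> core" "\<And>S. S \<in> core \<Longrightarrow> V o\<^sub>L S o\<^sub>L U \<in> core"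
  shows "star_isomorphic (closure (core :: ('x, 'h) ell2_op set))
    (closure (core :: ('y, 'h) ell2_op set))"
proof (rule star_isomorphic_conjugation[OF UV clinear_closure_core])
  have lin: "bounded_linear (\<lambda>T. A o\<^sub>L T o\<^sub>L B)"
    for A :: "'b::real_normed_vector \<Rightarrow>\<^sub>L 'c::real_normed_vector" and B :: "'a::real_normed_vector \<Rightarrow>\<^sub>L 'd::real_normed_vector"
    by (rule bounded_linear_compose[
          OF bounded_bilinear.bounded_linear_left[OF bounded_bilinear_blinfun_compose]
          bounded_bilinear.bounded_linear_right[OF bounded_bilinear_blinfun_compose]])
  show "U o\<^sub>L T o\<^sub>L V \<in> closure core" if "T \<in> closure core" for T
    by (rule core_closure_image[OF lin _ that]) (intro subsetD[OF closure_subset] core)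
  show "V o\<^sub>L S o\<^sub>L U \<in> closure core" if "S \<in> closure core" for S
    by (rule core_closure_image[OF lin _ that]) (intro subsetD[OF closure_subset] core)
qed

text \<open>Levels below \<open>m\<close> are sent below \<open>m'\<close>, so the range of
  \<open>U\<close> after \<open>amp p\<close> is absorbed by \<open>amp q\<close>; the second
  equation is the adjoint statement.\<close>

lemma onb_proj_intertwine:
  fixes e :: "nat \<Rightarrow> 'h::chilbert_space"
    and U :: "('x::metric_space, 'h) ell2 \<Rightarrow>\<^sub>L ('y::metric_space, 'h) ell2"
  assumes e: "onb e" and UV: "unitary_pair U V" and \<phi>: "bij \<phi>" "controlled \<phi>"
    and U\<phi>: "\<And>u. U (ell2_single (fst u) (e (snd u))) = ell2_single (fst (\<phi> u)) (e (snd (\<phi> u)))"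
    and p: "p \<in> range (onb_proj e)"
  shows "\<exists>q\<in>range (onb_proj e). amp q o\<^sub>L U o\<^sub>L amp p = U o\<^sub>L amp p \<and> amp p o\<^sub>L V o\<^sub>L amp q = amp p o\<^sub>L V"
proof -
  obtain m where m: "p = onb_proj e m" using p by blast
  obtain m' where m': "\<And>x i. i < m \<Longrightarrow> snd (\<phi> (x, i)) < m'" using \<phi>(2) unfolding controlled_def by blast
  have cU: "clinear_op U" and cV: "clinear_op V" and VU: "\<And>x. V (U x) = x"
    using UV by (auto simp: unitary_pair_def)
  have camp: "clinear_op (amp (onb_proj e k))" for k by (intro clinear_amp clinear_onb_proj)
  have "amp (onb_proj e m') o\<^sub>L U o\<^sub>L amp (onb_proj e m) = U o\<^sub>L amp (onb_proj e m)"
  proof (rule blinfun_eq_ell2_basis[OF _ _ e])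
    fix x i
    show "(amp (onb_proj e m') o\<^sub>L U o\<^sub>L amp (onb_proj e m)) (ell2_single x (e i))
        = (U o\<^sub>L amp (onb_proj e m)) (ell2_single x (e i))"
      using U\<phi>[of "(x, i)"] m'[of i x]
      by (auto simp: onb_proj_basis[OF e] blinfun.zero_right)
  qed (intro clinear_op_compose cU camp)+
  moreover have "amp (onb_proj e m) o\<^sub>L V o\<^sub>L amp (onb_proj e m') = amp (onb_proj e m) o\<^sub>L V"
  proof (rule blinfun_eq_ell2_basis[OF _ _ e])
    fix y j
    obtain x i where xi: "\<phi> (x, i) = (y, j)" using bij_is_surj[OF \<phi>(1)] by (metis surjD surj_pair)
    have "V (ell2_single y (e j)) = ell2_single x (e i)"
      using U\<phi>[of "(x, i)"] VU[of "ell2_single x (e i)"] xi by simp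
    moreover have "i < m \<Longrightarrow> j < m'" using m'[of i x] xi by simp
    ultimately show "(amp (onb_proj e m) o\<^sub>L V o\<^sub>L amp (onb_proj e m')) (ell2_single y (e j))
        = (amp (onb_proj e m) o\<^sub>L V) (ell2_single y (e j))"
      by (auto simp: onb_proj_basis[OF e] blinfun.zero_right)
  qed (intro clinear_op_compose cV camp)+
  ultimately show ?thesis unfolding m by blast
qed

lemma coarsely_equivalent_star_isomorphic:
  assumes X: "bounded_geometry TYPE('x::metric_space)" and Y: "bounded_geometry TYPE('y::metric_space)"
    and XY: "coarsely_equivalent TYPE('x) TYPE('y)" and e: "onb (e :: nat \<Rightarrow> 'h::chilbert_space)"
    and \<P>: "\<P> = {id_blinfun} \<or> \<P> = range (onb_proj e)"
  shows "star_isomorphic (closure (roe_core \<P> :: ('x, 'h) ell2_op set))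
    (closure (roe_core \<P> :: ('y, 'h) ell2_op set))"
proof -
  interpret exhausting_projections \<P> using \<P> exhausting_id exhausting_onb_proj[OF e] by blast
  obtain \<phi> :: "'x \<times> nat \<Rightarrow> 'y \<times> nat" where \<phi>: "bij \<phi>" "controlled \<phi>" "controlled (inv \<phi>)"
    using coarsely_equivalent_bijection[OF X Y XY] by blast
  obtain U :: "('x, 'h) ell2 \<Rightarrow>\<^sub>L ('y, 'h) ell2" and V where UV: "unitary_pair U V"
    and U\<phi>: "\<And>u. U (ell2_single (fst u) (e (snd u))) = ell2_single (fst (\<phi> u)) (e (snd (\<phi> u)))"
    using controlled_unitary[OF X e \<phi>(1)] by blast
  have V\<phi>: "V (ell2_single (fst w) (e (snd w))) = ell2_single (fst (inv \<phi> w)) (e (snd (inv \<phi> w)))" for w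
  proof -
    have "V (U (ell2_single (fst (inv \<phi> w)) (e (snd (inv \<phi> w))))) = ell2_single (fst (inv \<phi> w)) (e (snd (inv \<phi> w)))"
      using UV by (simp add: unitary_pair_def)
    thus ?thesis using U\<phi>[of "inv \<phi> w"] \<phi>(1) by (simp add: bij_is_surj surj_f_inv_f)
  qed
  have ii: "controlled (inv (inv \<phi>))" using \<phi>(2) by (simp add: inv_inv_eq[OF \<phi>(1)])
  have bi: "bij (inv \<phi>)" using \<phi>(1) by (rule bij_imp_bij_inv)
  note VU = unitary_pair_sym[OF UV]
  show ?thesis
  proof (rule star_isomorphic_core[OF UV])
    fix T :: "('x, 'h) ell2_op" assume "T \<in> core"
    thus "U o\<^sub>L T o\<^sub>L V \<in> core"
    proof (rule conjugation_core[OF X e UV \<phi> U\<phi>])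
      fix p assume p: "p \<in> \<P>"
      show "\<exists>q\<in>\<P>. amp q o\<^sub>L U o\<^sub>L amp p = U o\<^sub>L amp p \<and> amp p o\<^sub>L V o\<^sub>L amp q = amp p o\<^sub>L V"
        using \<P>
      proof
        assume "\<P> = range (onb_proj e)"
        thus ?thesis using onb_proj_intertwine[OF e UV \<phi>(1,2) U\<phi>] p by simp
      qed (use p in \<open>simp add: amp_id\<close>)
    qed
  next
    fix S :: "('y, 'h) ell2_op" assume "S \<in> core"
    thus "V o\<^sub>L S o\<^sub>L U \<in> core"
    proof (rule conjugation_core[OF Y e VU bi \<phi>(3) ii V\<phi>])
      fix p assume p: "p \<in> \<P>"
      show "\<exists>q\<in>\<P>. amp q o\<^sub>L V o\<^sub>L amp p = V o\<^sub>L amp p \<and> amp p o\<^sub>L U o\<^sub>L amp q = amp p o\<^sub>L U"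
        using \<P>
      proof
        assume "\<P> = range (onb_proj e)"
        thus ?thesis using onb_proj_intertwine[OF e VU bi \<phi>(3) V\<phi>] p by simp
      qed (use p in \<open>simp add: amp_id\<close>)
    qed
  qed
qed

lemma Roe_algebra_core:
  "Roe_algebra TYPE('x::metric_space) TYPE('h::chilbert_space) = closure (roe_core {id_blinfun})"
  by (simp add: Roe_algebra_def roe_core_def amp_id)

theorem corollary5:
  fixes p :: real and \<nu> :: "'z measure"
  assumes "bounded_geometry TYPE('x::metric_space)"
    and "bounded_geometry TYPE('y::metric_space)"
    and "infinite_dimensional_separable TYPE('h::chilbert_space)"
    and "infinite_dimensional_separable TYPE('k::chilbert_space)"
    and "1 \<le> p" and "coarsely_embeds_into_Lp TYPE('y) p \<nu>"
  shows "(coarsely_equivalent TYPE('x) TYPE('y) \<longleftrightarrow>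
      stably_star_isomorphic TYPE('k)
        (uniform_Roe_algebra TYPE('x)) (uniform_Roe_algebra TYPE('y))) \<and>
    (stably_star_isomorphic TYPE('k)
        (uniform_Roe_algebra TYPE('x)) (uniform_Roe_algebra TYPE('y)) \<longleftrightarrow>
      star_isomorphic (Roe_algebra TYPE('x) TYPE('h)) (Roe_algebra TYPE('y) TYPE('h)))"
proof -
  obtain b :: "nat \<Rightarrow> 'h" where b: "onb b" using onb_exists[OF assms(3)] by blast
  obtain c :: "nat \<Rightarrow> 'k" where c: "onb c" using onb_exists[OF assms(4)] by blast
  have b0: "b 0 \<noteq> 0" and c0: "c 0 \<noteq> 0" using norm_onb[OF b, of 0] norm_onb[OF c, of 0] by auto
  note equiv = coarsely_equivalent_star_isomorphic[OF assms(1,2)]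
  have "coarsely_equivalent TYPE('x) TYPE('y) \<longleftrightarrow>
      star_isomorphic (Roe_algebra TYPE('x) TYPE('h)) (Roe_algebra TYPE('y) TYPE('h))"
    unfolding Roe_algebra_core
    using equiv[OF _ b disjI1[OF refl]]
      exhausting_projections.star_isomorphic_coarsely_equivalent[OF exhausting_id assms(1,2,5,6) b0]
    by blast
  moreover have "coarsely_equivalent TYPE('x) TYPE('y) \<longleftrightarrow>
      stably_star_isomorphic TYPE('k) (uniform_Roe_algebra TYPE('x)) (uniform_Roe_algebra TYPE('y))"
    unfolding stably_star_isomorphic_def tensor_compacts_uniform_Roe[OF c]
    using equiv[OF _ c disjI2[OF refl]]
      exhausting_projections.star_isomorphic_coarsely_equivalent[OF exhausting_onb_proj[OF c] assms(1,2,5,6) c0]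
    by blast
  ultimately show ?thesis by blast
qed

end
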